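(* Let $d\ge1$, $r_1,\dots,r_d\in\mathbb{Z}$, and let $(U_n)_{n\ge0}$ be a sequence of integers with $U_n=r_1U_{n-1}+\cdots+r_dU_{n-d}$ for all $n\ge d$. Let $C(x)=x^d-r_1x^{d-1}-\cdots-r_d=\prod_{i=0}^{d-1}(x-\alpha_i)$ and assume $\Delta=\prod_{0\le i<j<d}(\alpha_i-\alpha_j)^2\neq0$. Let $K=\mathbb{Q}(\alpha_0,\dots,\alpha_{d-1})$ be the splitting field of $C$, $m=[K:\mathbb{Q}]$, and $\Delta_K$ the discriminant of $K$. Then for every $t\in\mathbb{N}_+$ with $m\mid t$, the sequence $\big(r_d\,\Delta\,\operatorname{rad}(\Delta_K)\,U_{n^t}\big)_{n\ge1}$ satisfies the Dold condition.
   Context: A sequence of integers $(A_n)_{n\ge1}$ satisfies the Dold condition if $n\mid\sum_{d\mid n}\mu(d)A_{n/d}$ for every $n\in\mathbb{N}_+$ ($\mu$ the Möbius function). For a nonzero integer $a$, $\operatorname{rad}(a)$ denotes the product of the distinct primes dividing $a$. *)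

theory Defs
  imports
    Complex_Main
    "HOL-Computational_Algebra.Polynomial"
    "HOL-Computational_Algebra.Squarefree"
    "Jordan_Normal_Form.Determinant"
begin

definition moebius_mu :: "nat \<Rightarrow> int" where
  "moebius_mu n = (if squarefree n then (- 1) ^ card (prime_factors n) else 0)"

text \<open>The value \<open>A 0\<close> is irrelevant: the sequence is \<open>A 1, A 2, \<dots>\<close>.\<close>

definition dold_condition :: "(nat \<Rightarrow> int) \<Rightarrow> bool" where
  "dold_condition A \<longleftrightarrow>
     (\<forall>n\<ge>1. int n dvd (\<Sum>d | d dvd n. moebius_mu d * A (n div d)))"

definition rad :: "int \<Rightarrow> int" where
  "rad a = \<Prod>(prime_factors a)"

text \<open>Number fields are represented as subfields of the complex numbers. The field
  generated by a set \<open>S\<close> is \<open>complex_subfield hull S\<close>; it contains the rationals, so it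
  is \<open>\<rat>(S)\<close>.\<close>

definition complex_subfield :: "complex set \<Rightarrow> bool" where
  "complex_subfield F \<longleftrightarrow>
     0 \<in> F \<and> 1 \<in> F \<and>
     (\<forall>x\<in>F. \<forall>y\<in>F. x + y \<in> F \<and> x * y \<in> F) \<and>
     (\<forall>x\<in>F. - x \<in> F \<and> inverse x \<in> F)"

global_interpretation rat_vs: vector_space "\<lambda>(q::rat) (x::complex). of_rat q * x"
  by unfold_locales (simp_all add: algebra_simps of_rat_add of_rat_mult)

global_interpretation int_mod: Modules.module "\<lambda>(k::int) (x::complex). of_int k * x"
  by unfold_locales (simp_all add: algebra_simps)

text \<open>The trace over \<open>\<rat>\<close> of the endomorphism \<open>y \<mapsto> x * y\<close> of \<open>K\<close>, for \<open>K\<close> of finite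
  degree; it does not depend on the chosen basis.\<close>

definition field_trace :: "complex set \<Rightarrow> complex \<Rightarrow> rat" where
  "field_trace K x =
     (let B = (SOME B. rat_vs.independent B \<and> rat_vs.span B = K)
      in \<Sum>b\<in>B. rat_vs.representation B (x * b) b)"

definition ring_of_integers :: "complex set \<Rightarrow> complex set" where
  "ring_of_integers K = {x \<in> K. algebraic_int x}"

definition integral_basis :: "complex set \<Rightarrow> complex list \<Rightarrow> bool" where
  "integral_basis K bs \<longleftrightarrow>
     distinct bs \<and> int_mod.independent (set bs) \<and>
     int_mod.span (set bs) = ring_of_integers K"

text \<open>The determinant below is an integer that is the same for all integral bases.\<close>

definition field_discriminant :: "complex set \<Rightarrow> int" where
  "field_discriminant K =
     (SOME D. \<exists>bs. integral_basis K bs \<and>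
        of_int D = det (mat (length bs) (length bs)
                          (\<lambda>(i, j). field_trace K (bs ! i * bs ! j))))"

end

theory Submission
  imports Defs "Jordan_Normal_Form.Char_Poly" "HOL-Algebra.Multiplicative_Group"
    "HOL-Computational_Algebra.Fundamental_Theorem_Algebra"
begin

text \<open>
  The Dold condition follows from the congruences \<open>A (p\<^sup>k s) \<equiv> A (p\<^sup>k\<^sup>-\<^sup>1 s)\<close> modulo \<open>p\<^sup>k\<close>. By Lagrange
  interpolation \<open>\<Delta> U\<^sub>n\<close> is a combination of the \<open>\<alpha>\<^sub>i\<^sup>n\<close> whose coefficients are integers of \<open>K\<close>, so the
  congruences reduce to powers of a single root. For every prime ideal \<open>P\<close> above \<open>p\<close> there is an
  automorphism \<open>\<sigma>\<close> with \<open>\<alpha>\<^sub>i\<^sup>p \<equiv> \<sigma> \<alpha>\<^sub>i\<close> modulo \<open>P\<close>; its order divides \<open>m\<close>, hence \<open>\<alpha>\<^sub>i\<close> to the power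
  \<open>p\<^sup>t\<close> is congruent to \<open>\<alpha>\<^sub>i\<close> modulo every such \<open>P\<close>, that is, modulo the radical of \<open>p\<close>.
  If \<open>p\<close> does not divide the discriminant, the trace form shows that this radical is generated by \<open>p\<close>,
  and the congruence lifts to powers of \<open>p\<close>. Otherwise the \<open>m\<close>-th powers of elements of the radical are
  divisible by \<open>p\<close>, since the characteristic polynomial is \<open>X\<^sup>m\<close> modulo \<open>p\<close>, so that \<open>t \<ge> m\<close> further
  Frobenius steps reach a congruence modulo \<open>p\<close>; the lost factor \<open>p\<close> is supplied by the radical of the
  discriminant.
\<close>

hide_const (open) up_ring.coeff up_ring.monom

section \<open>Subrings and congruences\<close>

text \<open>Replacing \<open>p^l * s\<close> by \<open>p^(l+1) * s\<close> in the index
  \<open>n\<close> multiplies the exponent \<open>n^t\<close> by \<open>p^t\<close>, so one step in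
  \<open>n\<close> is \<open>t\<close> Frobenius steps at once. This is what the power
  \<open>n^t\<close> achieves: the Frobenius automorphism varies with the prime ideal above
  \<open>p\<close>, and a number of iterations divisible by the group order trivialises all of them
  together. Iterating also explains why one automorphism has to serve all roots simultaneously: it
  moves a root to another root, where its congruence is needed again.

  The outcome is a congruence modulo the radical of \<open>p\<close>, and the two cases measure how
  far this radical is from the ideal generated by \<open>p\<close>. If they agree, \<open>l\<close>
  steps in \<open>n\<close> give at least \<open>p^(l+1)\<close>. If \<open>p\<close> divides the
  discriminant, one of these steps is spent on turning the radical into a multiple of
  \<open>p\<close>, which leaves \<open>p^l\<close>. Exactly one factor \<open>p\<close> is missing
  for each such prime, whence the radical of the discriminant and not the discriminant.\<close>

locale comm_subring =
  fixes R :: "'a::comm_ring_1 set"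
  assumes one_mem: "1 \<in> R"
    and diff_mem: "x \<in> R \<Longrightarrow> y \<in> R \<Longrightarrow> x - y \<in> R"
    and mult_mem: "x \<in> R \<Longrightarrow> y \<in> R \<Longrightarrow> x * y \<in> R"
begin

lemma zero_mem: "0 \<in> R"
  using diff_mem[OF one_mem one_mem] by simp

lemma uminus_mem: "x \<in> R \<Longrightarrow> - x \<in> R"
  using diff_mem[OF zero_mem] by fastforce

lemma add_mem: "x \<in> R \<Longrightarrow> y \<in> R \<Longrightarrow> x + y \<in> R"
  using diff_mem[of x "- y"] uminus_mem[of y] by simp

lemma power_mem: "x \<in> R \<Longrightarrow> x ^ n \<in> R"
  by (induction n) (auto intro: one_mem mult_mem)

lemma sum_mem: "(\<And>i. i \<in> I \<Longrightarrow> f i \<in> R) \<Longrightarrow> sum f I \<in> R"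
  by (induction I rule: infinite_finite_induct) (auto intro: zero_mem add_mem)

lemma prod_mem: "(\<And>i. i \<in> I \<Longrightarrow> f i \<in> R) \<Longrightarrow> prod f I \<in> R"
  by (induction I rule: infinite_finite_induct) (auto intro: one_mem mult_mem)

lemma of_nat_mem: "of_nat n \<in> R"
  by (induction n) (auto intro: zero_mem one_mem add_mem)

lemma of_int_mem: "of_int n \<in> R"
  by (cases n rule: int_cases2) (auto intro: of_nat_mem uminus_mem)

lemma Ints_mem: "x \<in> \<int> \<Longrightarrow> x \<in> R"
  by (auto elim!: Ints_cases intro: of_int_mem)

lemma signof_mem: "signof \<pi> \<in> R"
  by (auto simp: sign_def intro: one_mem uminus_mem)

lemma det_mem:
  assumes "A \<in> carrier_mat n n" and "\<And>i j. i < n \<Longrightarrow> j < n \<Longrightarrow> A $$ (i, j) \<in> R"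
  shows "det A \<in> R"
  unfolding det_def'[OF assms(1)]
  by (intro sum_mem mult_mem signof_mem prod_mem assms(2)) (auto simp: permutes_in_image)

text \<open>The modulus is an element and not an ideal: the congruences of the proof are modulo
  powers of a rational prime. Only the quotient is required to lie in \<open>R\<close>, not the two
  sides, which is why multiplication and powers below carry membership hypotheses.\<close>

definition cong_mod :: "'a \<Rightarrow> 'a \<Rightarrow> 'a \<Rightarrow> bool" where
  "cong_mod q x y \<longleftrightarrow> (\<exists>c\<in>R. x - y = q * c)"

lemma cong_modI: "c \<in> R \<Longrightarrow> x - y = q * c \<Longrightarrow> cong_mod q x y"
  unfolding cong_mod_def by blast

lemma cong_modE:
  assumes "cong_mod q x y"
  obtains c where "c \<in> R" "x = y + q * c"
  using assms unfolding cong_mod_def by (metis add.commute diff_add_cancel)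

lemma cong_mod_refl: "cong_mod q x x"
  by (rule cong_modI[OF zero_mem]) simp

lemma cong_mod_sym: "cong_mod q x y \<Longrightarrow> cong_mod q y x"
  by (elim cong_modE, rule cong_modI[OF uminus_mem]) auto

lemma cong_mod_add:
  assumes "cong_mod q x y" "cong_mod q x' y'"
  shows "cong_mod q (x + x') (y + y')"
proof -
  obtain c c' where "c \<in> R" "c' \<in> R" "x = y + q * c" "x' = y' + q * c'"
    using assms by (elim cong_modE)
  then show ?thesis
    by (intro cong_modI[OF add_mem[of c c']]) (auto simp: algebra_simps)
qed

lemma cong_mod_uminus: "cong_mod q x y \<Longrightarrow> cong_mod q (- x) (- y)"
  by (elim cong_modE, rule cong_modI[OF uminus_mem]) auto

lemma cong_mod_diff:
  "cong_mod q x y \<Longrightarrow> cong_mod q x' y' \<Longrightarrow> cong_mod q (x - x') (y - y')"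
  using cong_mod_add[OF _ cong_mod_uminus] by fastforce

lemma cong_mod_trans: "cong_mod q x y \<Longrightarrow> cong_mod q y z \<Longrightarrow> cong_mod q x z"
  using cong_mod_add[of q x y y z] unfolding cong_mod_def by (simp add: algebra_simps)

lemma cong_mod_mult:
  assumes "cong_mod q x y" "cong_mod q x' y'" "y \<in> R" "x' \<in> R"
  shows "cong_mod q (x * x') (y * y')"
proof -
  obtain c c' where "c \<in> R" "c' \<in> R" "x = y + q * c" "x' = y' + q * c'"
    using assms by (elim cong_modE)
  then show ?thesis
    using assms by (intro cong_modI[of "c * x' + y * c'"] add_mem mult_mem) (auto simp: algebra_simps)
qed

lemma cong_mod_sum:
  "(\<And>i. i \<in> I \<Longrightarrow> cong_mod q (f i) (g i)) \<Longrightarrow> cong_mod q (sum f I) (sum g I)"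
  by (induction I rule: infinite_finite_induct) (auto intro: cong_mod_refl cong_mod_add)

lemma cong_mod_prod:
  "(\<And>i. i \<in> I \<Longrightarrow> f i \<in> R \<and> g i \<in> R \<and> cong_mod q (f i) (g i)) \<Longrightarrow>
    cong_mod q (prod f I) (prod g I)"
  by (induction I rule: infinite_finite_induct) (auto intro: cong_mod_refl cong_mod_mult prod_mem)

lemma cong_mod_power:
  "cong_mod q x y \<Longrightarrow> x \<in> R \<Longrightarrow> y \<in> R \<Longrightarrow> cong_mod q (x ^ n) (y ^ n)"
  using cong_mod_prod[of "{..<n}" "\<lambda>_. x" "\<lambda>_. y" q] by simp

lemma cong_mod_dvd:
  "cong_mod (q * s) x y \<Longrightarrow> s \<in> R \<Longrightarrow> cong_mod q x y"
  unfolding cong_mod_def by (metis mult.assoc mult_mem)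

lemma cong_mod_power_le:
  assumes "cong_mod (q ^ b) x y" "a \<le> b" "q \<in> R"
  shows "cong_mod (q ^ a) x y"
  using assms by (intro cong_mod_dvd[of "q ^ a" "q ^ (b - a)"]) (auto simp: power_mem simp flip: power_add)

lemma cong_mod_zero_mult:
  "cong_mod q x 0 \<Longrightarrow> y \<in> R \<Longrightarrow> cong_mod q (x * y) 0"
  unfolding cong_mod_def by (metis diff_zero mult.assoc mult_mem)

section \<open>The \<open>p\<close>-th power map modulo a prime number \<open>p\<close>\<close>

lemma cong_mod_freshman:
  assumes p: "prime p" and "x \<in> R" "y \<in> R"
  shows "cong_mod (of_nat p) ((x + y) ^ p) (x ^ p + y ^ p)"
proof -
  have p0: "p > 0"
    using p prime_gt_0_nat by blast
  have "(x + y) ^ p = (\<Sum>k\<le>p. of_nat (p choose k) * x ^ k * y ^ (p - k))"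
    by (rule binomial_ring)
  also have "{..p} = {0, p} \<union> {1..<p}"
    using p0 by auto
  also have "(\<Sum>k\<in>\<dots>. of_nat (p choose k) * x ^ k * y ^ (p - k)) =
      x ^ p + y ^ p + (\<Sum>k=1..<p. of_nat (p choose k) * x ^ k * y ^ (p - k))"
    using p0 by (subst sum.union_disjoint) (auto simp: add_ac)
  also have "(\<Sum>k=1..<p. of_nat (p choose k) * x ^ k * y ^ (p - k)) =
      of_nat p * (\<Sum>k=1..<p. of_nat ((p choose k) div p) * x ^ k * y ^ (p - k))"
    unfolding sum_distrib_left
  proof (rule sum.cong, goal_cases)
    case (2 k)
    then have "p dvd (p choose k)"
      using p by (intro dvd_choose_prime) auto
    then show ?case
      by (metis (no_types, lifting) dvd_mult_div_cancel mult.assoc of_nat_mult)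
  qed simp
  finally show ?thesis
    using assms by (intro cong_modI[of "\<Sum>k=1..<p. of_nat ((p choose k) div p) * x ^ k * y ^ (p - k)"])
      (auto intro!: sum_mem mult_mem of_nat_mem power_mem)
qed

lemma cong_mod_freshman_sum:
  assumes p: "prime p" and "\<And>i. i \<in> I \<Longrightarrow> f i \<in> R"
  shows "cong_mod (of_nat p) (sum f I ^ p) (\<Sum>i\<in>I. f i ^ p)"
  using assms(2)
proof (induction I rule: infinite_finite_induct)
  case (insert i I)
  have "cong_mod (of_nat p) ((f i + sum f I) ^ p) (f i ^ p + sum f I ^ p)"
    using insert by (intro cong_mod_freshman p sum_mem) auto
  moreover have "cong_mod (of_nat p) (f i ^ p + sum f I ^ p) (f i ^ p + (\<Sum>i\<in>I. f i ^ p))"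
    using insert by (intro cong_mod_add cong_mod_refl) auto
  ultimately show ?case
    using insert.hyps by (auto intro: cong_mod_trans)
qed (use p in \<open>auto simp: power_0_left intro: cong_mod_refl\<close>)

text \<open>Only \<open>p = 2\<close> needs an argument: there the sign is lost, and the two sides
  differ by \<open>2 * x^2\<close>.\<close>

lemma cong_mod_freshman_uminus:
  assumes p: "prime p" and x: "x \<in> R"
  shows "cong_mod (of_nat p) ((- x) ^ p) (- (x ^ p))"
proof (cases "p = 2")
  case True
  then show ?thesis
    using x by (intro cong_modI[of "x ^ 2"] power_mem) auto
next
  case False
  then have "odd p"
    using p primes_dvd_imp_eq two_is_prime_nat by blast
  then show ?thesis
    by (simp add: cong_mod_refl)
qed

lemma cong_mod_freshman_diff:
  assumes p: "prime p" and "x \<in> R" "y \<in> R"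
  shows "cong_mod (of_nat p) ((x - y) ^ p) (x ^ p - y ^ p)"
proof -
  have "cong_mod (of_nat p) ((x + - y) ^ p) (x ^ p + (- y) ^ p)"
    using assms by (intro cong_mod_freshman uminus_mem)
  moreover have "cong_mod (of_nat p) (x ^ p + (- y) ^ p) (x ^ p + - (y ^ p))"
    using assms by (intro cong_mod_add cong_mod_refl cong_mod_freshman_uminus)
  ultimately show ?thesis
    using cong_mod_trans by fastforce
qed

lemma cong_mod_freshman_diff_power:
  assumes p: "prime p" and "x \<in> R" "y \<in> R"
  shows "cong_mod (of_nat p) ((x - y) ^ (p ^ n)) (x ^ (p ^ n) - y ^ (p ^ n))"
proof (induction n)
  case (Suc n)
  have "cong_mod (of_nat p) (((x - y) ^ (p ^ n)) ^ p) ((x ^ (p ^ n) - y ^ (p ^ n)) ^ p)"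
    using assms by (intro cong_mod_power Suc.IH power_mem diff_mem)
  moreover have "cong_mod (of_nat p) ((x ^ (p ^ n) - y ^ (p ^ n)) ^ p) ((x ^ (p ^ n)) ^ p - (y ^ (p ^ n)) ^ p)"
    using assms by (intro cong_mod_freshman_diff power_mem)
  ultimately show ?case
    unfolding power_Suc2 power_mult by (rule cong_mod_trans)
qed (auto intro: cong_mod_refl)

text \<open>A determinant is a signed sum of products of entries, and modulo \<open>p\<close> the
  \<open>p\<close>-th power passes through all of these operations. The entries of \<open>B\<close>
  only have to agree modulo \<open>p\<close> with the powers of the entries of \<open>A\<close>; for
  \<open>Frobenius_element\<close> they are obtained by substituting \<open>X^p\<close>.\<close>

lemma cong_mod_det_power:
  assumes p: "prime p" and A: "A \<in> carrier_mat n n" and B: "B \<in> carrier_mat n n"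
    and AR: "\<And>i j. i < n \<Longrightarrow> j < n \<Longrightarrow> A $$ (i, j) \<in> R"
    and BR: "\<And>i j. i < n \<Longrightarrow> j < n \<Longrightarrow> B $$ (i, j) \<in> R"
    and AB: "\<And>i j. i < n \<Longrightarrow> j < n \<Longrightarrow> cong_mod (of_nat p) (A $$ (i, j) ^ p) (B $$ (i, j))"
  shows "cong_mod (of_nat p) (det A ^ p) (det B)"
proof -
  let ?S = "{\<pi>. \<pi> permutes {0..<n}}"
  have lt: "\<pi> i < n" if "\<pi> permutes {0..<n}" "i < n" for \<pi> i
    using that by (auto simp: permutes_in_image)
  have "cong_mod (of_nat p) (det A ^ p)
      (\<Sum>\<pi>\<in>?S. (signof \<pi> * (\<Prod>i=0..<n. A $$ (i, \<pi> i))) ^ p)"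
    unfolding det_def'[OF A] using AR lt
    by (intro cong_mod_freshman_sum p mult_mem signof_mem prod_mem) auto
  moreover have "cong_mod (of_nat p) (\<Sum>\<pi>\<in>?S. (signof \<pi> * (\<Prod>i=0..<n. A $$ (i, \<pi> i))) ^ p) (det B)"
    unfolding det_def'[OF B]
  proof (rule cong_mod_sum)
    fix \<pi> assume "\<pi> \<in> ?S"
    then have \<pi>: "\<pi> permutes {0..<n}"
      by simp
    \<comment> \<open>For odd \<open>p\<close> this is an equality; for \<open>p = 2\<close> it uses
      that 1 and -1 agree modulo 2.\<close>
    have "cong_mod (of_nat p) (signof \<pi> ^ p) (signof \<pi>)"
      using cong_mod_freshman_uminus[OF p one_mem] by (auto simp: sign_def intro: cong_mod_refl)
    moreover have "cong_mod (of_nat p) ((\<Prod>i=0..<n. A $$ (i, \<pi> i) ^ p)) (\<Prod>i=0..<n. B $$ (i, \<pi> i))"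
      using AR BR AB lt[OF \<pi>] by (intro cong_mod_prod) (auto intro: power_mem)
    ultimately show "cong_mod (of_nat p) ((signof \<pi> * (\<Prod>i=0..<n. A $$ (i, \<pi> i))) ^ p)
        (signof \<pi> * (\<Prod>i=0..<n. B $$ (i, \<pi> i)))"
      unfolding power_mult_distrib prod_power_distrib using AR lt[OF \<pi>]
      by (intro cong_mod_mult signof_mem prod_mem power_mem) auto
  qed
  ultimately show ?thesis
    by (rule cong_mod_trans)
qed

text \<open>The cofactor of \<open>x - y\<close> in \<open>x^p - y^p\<close> is a sum of
  \<open>p\<close> products, each congruent to \<open>y^(p-1)\<close> modulo \<open>p\<close>, so it
  contributes one further factor \<open>p\<close>. The exponent is written \<open>Suc a\<close>
  because this comparison already uses the congruence modulo \<open>p\<close>.\<close>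

lemma cong_mod_lift:
  assumes "cong_mod (of_nat p ^ Suc a) x y" "x \<in> R" "y \<in> R"
  shows "cong_mod (of_nat p ^ Suc (Suc a)) (x ^ p) (y ^ p)"
proof -
  obtain c where c: "c \<in> R" "x = y + of_nat p ^ Suc a * c"
    using assms by (elim cong_modE)
  have "cong_mod (of_nat p) (\<Sum>i<p. y ^ (p - Suc i) * x ^ i) (\<Sum>i<p. y ^ (p - Suc i) * y ^ i)"
  proof (intro cong_mod_sum cong_mod_mult cong_mod_refl cong_mod_power)
    show "cong_mod (of_nat p) x y"
      by (rule cong_mod_dvd[of _ "of_nat p ^ a"]) (use assms in \<open>auto intro: power_mem of_nat_mem\<close>)
  qed (use assms in \<open>auto intro: power_mem\<close>)
  also have "(\<Sum>i<p. y ^ (p - Suc i) * y ^ i) = of_nat p * y ^ (p - 1)"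
    by (simp flip: power_add)
  finally obtain e where e: "e \<in> R"
      "(\<Sum>i<p. y ^ (p - Suc i) * x ^ i) = of_nat p * y ^ (p - 1) + of_nat p * e"
    by (elim cong_modE)
  have "x ^ p - y ^ p = (x - y) * (\<Sum>i<p. y ^ (p - Suc i) * x ^ i)"
    by (rule power_diff_sumr2)
  also have "\<dots> = of_nat p ^ Suc (Suc a) * (c * (y ^ (p - 1) + e))"
    unfolding e(2) by (simp add: c(2) algebra_simps)
  finally show ?thesis
    using c e assms by (intro cong_modI[of "c * (y ^ (p - 1) + e)"] mult_mem add_mem power_mem)
qed

lemma cong_mod_lift_iterate:
  assumes "cong_mod (of_nat p) x y" "x \<in> R" "y \<in> R"
  shows "cong_mod (of_nat p ^ Suc n) (x ^ (p ^ n)) (y ^ (p ^ n))"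
proof (induction n)
  case (Suc n)
  show ?case
    using cong_mod_lift[OF Suc] assms by (simp add: power_mem mult.commute flip: power_mult)
qed (use assms in simp)

end

section \<open>Polynomials with coefficients in a subring\<close>

definition polys_over :: "'a::comm_ring_1 set \<Rightarrow> 'a poly set" where
  "polys_over R = {f. \<forall>n. coeff f n \<in> R}"

lemma coeff_polys_over: "f \<in> polys_over R \<Longrightarrow> coeff f n \<in> R"
  by (simp add: polys_over_def)

lemma polys_over_mono: "R \<subseteq> S \<Longrightarrow> polys_over R \<subseteq> polys_over S"
  by (auto simp: polys_over_def)

context comm_subring
begin

lemma comm_subring_polys_over: "comm_subring (polys_over R)"
proof
  show "f * g \<in> polys_over R" if "f \<in> polys_over R" "g \<in> polys_over R" for f g
    using that by (auto simp: polys_over_def coeff_mult intro!: sum_mem mult_mem)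
qed (auto simp: polys_over_def intro: one_mem zero_mem diff_mem)

lemma pCons_polys_over: "pCons a f \<in> polys_over R \<longleftrightarrow> a \<in> R \<and> f \<in> polys_over R"
  unfolding polys_over_def by (auto simp: coeff_pCons split: nat.splits)

lemma monom_polys_over: "a \<in> R \<Longrightarrow> monom a n \<in> polys_over R"
  by (auto simp: polys_over_def intro: zero_mem)

lemma smult_polys_over: "a \<in> R \<Longrightarrow> f \<in> polys_over R \<Longrightarrow> smult a f \<in> polys_over R"
  by (auto simp: polys_over_def intro: mult_mem)

lemma poly_mem: "f \<in> polys_over R \<Longrightarrow> x \<in> R \<Longrightarrow> poly f x \<in> R"
  by (auto simp: poly_altdef polys_over_def intro!: sum_mem mult_mem power_mem)

lemma pcompose_polys_over: "f \<in> polys_over R \<Longrightarrow> g \<in> polys_over R \<Longrightarrow> pcompose f g \<in> polys_over R"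
proof (induction f)
  case 0
  then show ?case by simp
next
  case (pCons a f)
  interpret P: comm_subring "polys_over R"
    by (rule comm_subring_polys_over)
  show ?case
    using pCons P.zero_mem by (auto simp: pcompose_pCons pCons_polys_over intro!: P.add_mem P.mult_mem)
qed

lemma monic_division:
  assumes g: "g \<in> polys_over R" "lead_coeff g = 1" and f: "f \<in> polys_over R"
  shows "\<exists>s\<in>polys_over R. \<exists>r\<in>polys_over R. f = g * s + r \<and> (r = 0 \<or> degree r < degree g)"
  using f
proof (induction "degree f" arbitrary: f rule: less_induct)
  case less
  interpret P: comm_subring "polys_over R"
    by (rule comm_subring_polys_over)
  show ?case
  proof (cases "f = 0 \<or> degree f < degree g")
    case True
    then show ?thesis
      using less.prems by (intro bexI[of _ 0] bexI[of _ f]) (auto intro: P.zero_mem)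
  next
    case False
    define h where "h = monom (lead_coeff f) (degree f - degree g)"
    have h: "h \<in> polys_over R"
      unfolding h_def using less.prems by (intro monom_polys_over) (auto intro: coeff_polys_over)
    have gh: "degree (g * h) \<le> degree f"
      using False degree_mult_le[of g h] degree_monom_le[of "lead_coeff f" "degree f - degree g"]
      unfolding h_def by linarith
    have "coeff (g * h) (degree f) = lead_coeff f"
      using False g(2) by (simp add: h_def mult.commute[of g] coeff_monom_mult)
    \<comment> \<open>Cancelling the leading term lowers the degree only if there is a degree to
      lower. A nonzero constant \<open>f\<close> is therefore treated apart; then \<open>g\<close>
      is a monic constant, that is, 1.\<close>
    show ?thesis
    proof (cases "degree f = 0")
      case True
      then have "degree g = 0" "f = [:lead_coeff f:]"
        using False by (auto elim: degree_eq_zeroE)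
      then have "g = 1" "f = g * f"
        using g(2) by (auto elim!: degree_eq_zeroE simp: one_pCons)
      then show ?thesis
        using less.prems by (intro bexI[of _ f] bexI[of _ 0]) (auto intro: P.zero_mem)
    next
      case nz: False
      have "degree (f - g * h) < degree f"
        using \<open>coeff (g * h) (degree f) = lead_coeff f\<close> nz gh
        using eq_zero_or_degree_less[of "f - g * h" "degree f"] degree_diff_le[OF le_refl gh] by auto
      moreover have "f - g * h \<in> polys_over R"
        using less.prems g h by (intro P.diff_mem P.mult_mem)
      ultimately obtain s r where sr: "s \<in> polys_over R" "r \<in> polys_over R"
        "f - g * h = g * s + r" "r = 0 \<or> degree r < degree g"
        using less.hyps by blast
      then show ?thesis
        using h by (intro bexI[of _ "s + h"] bexI[of _ r]) (auto intro: P.add_mem simp: algebra_simps)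
    qed
  qed
qed

end

lemma pderiv_polys_over:
  fixes f :: "'a::idom poly"
  assumes "comm_subring R" and "f \<in> polys_over R"
  shows "pderiv f \<in> polys_over R"
proof -
  interpret comm_subring R
    by fact
  show ?thesis
    using assms(2) by (auto simp: polys_over_def coeff_pderiv intro!: mult_mem add_mem one_mem of_nat_mem
        simp del: of_nat_Suc)
qed

section \<open>Algebraic integers form a ring\<close>

lemma comm_subring_Ints: "comm_subring (\<int> :: 'a::comm_ring_1 set)"
  by unfold_locales auto

lemma comm_subring_Rats: "comm_subring (\<rat> :: complex set)"
  by unfold_locales auto

lemma algebraic_int_of_monic_root:
  "lead_coeff g = 1 \<Longrightarrow> g \<in> polys_over \<int> \<Longrightarrow> poly g x = 0 \<Longrightarrow> algebraic_int x"
  unfolding polys_over_def by (auto intro: algebraic_int.intros)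

text \<open>\<open>x\<close> is an eigenvalue of an integer matrix, hence a root of its
  characteristic polynomial, which is monic with integer coefficients.\<close>

lemma algebraic_int_integer_eigenvalue:
  fixes x :: complex and v :: "nat \<Rightarrow> complex" and A :: "nat \<Rightarrow> nat \<Rightarrow> int"
  assumes "\<And>i. i < n \<Longrightarrow> x * v i = (\<Sum>j<n. of_int (A i j) * v j)"
    and "k < n" "v k \<noteq> 0"
  shows "algebraic_int x"
proof -
  define B where "B = mat n n (\<lambda>(i, j). A i j)"
  define C where "C = (map_mat of_int B :: complex mat)"
  have B: "B \<in> carrier_mat n n" and C: "C \<in> carrier_mat n n"
    by (auto simp: B_def C_def)
  have "eigenvector C (vec n v) x"
    unfolding eigenvector_def
  proof (intro conjI)
    show "vec n v \<in> carrier_vec (dim_row C)"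
      using C by auto
    show "vec n v \<noteq> 0\<^sub>v (dim_row C)"
      using assms(2,3) C by (metis carrier_matD(1) index_vec index_zero_vec(1))
    show "C *\<^sub>v vec n v = x \<cdot>\<^sub>v vec n v"
      using assms(1) by (auto simp: C_def B_def scalar_prod_def atLeast0LessThan)
  qed
  then have "poly (char_poly C) x = 0"
    using eigenvalue_root_char_poly[OF C] by (auto simp: eigenvalue_def)
  moreover have "char_poly C = map_poly of_int (char_poly B)"
    unfolding C_def by (rule of_int_hom.char_poly_hom[OF B])
  moreover have "lead_coeff (char_poly B) = 1"
    using degree_monic_char_poly[OF B] by simp
  ultimately show ?thesis
    unfolding algebraic_int_altdef_ipoly by metis
qed

text \<open>On the generators \<open>V\<close>, independent or not, multiplication by
  \<open>x\<close> is given by an integer matrix with the vector of generators as eigenvector. The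
  element 1 ensures that this vector is nonzero.\<close>

lemma algebraic_int_if_stable_lattice:
  fixes V :: "complex set"
  assumes V: "finite V" "1 \<in> V" and stable: "\<And>v. v \<in> V \<Longrightarrow> x * v \<in> int_mod.span V"
  shows "algebraic_int x"
proof -
  obtain v where v: "bij_betw v {..<card V} V"
    using V(1) ex_bij_betw_nat_finite atLeast0LessThan by metis
  have "\<exists>c. x * u = (\<Sum>w\<in>V. of_int (c w) * w)" if "u \<in> V" for u
    using stable[OF that] unfolding int_mod.span_finite[OF V(1)] by auto
  then obtain c where c: "\<And>u. u \<in> V \<Longrightarrow> x * u = (\<Sum>w\<in>V. of_int (c u w) * w)"
    by metis
  obtain k where k: "k < card V" "v k = 1"
    using v V(2) unfolding bij_betw_def by (metis imageE lessThan_iff)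
  show ?thesis
  proof (rule algebraic_int_integer_eigenvalue[of "card V" x v "\<lambda>i j. c (v i) (v j)" k])
    fix i assume "i < card V"
    then have "v i \<in> V"
      using v by (auto simp: bij_betw_def)
    then have "x * v i = (\<Sum>w\<in>V. of_int (c (v i) w) * w)"
      by (rule c)
    also have "\<dots> = (\<Sum>j<card V. of_int (c (v i) (v j)) * v j)"
      by (rule sum.reindex_bij_betw[OF v, symmetric])
    finally show "x * v i = (\<Sum>j<card V. of_int (c (v i) (v j)) * v j)" .
  qed (use k in auto)
qed

lemma int_span_mult_closed:
  assumes "\<And>v. v \<in> V \<Longrightarrow> x * v \<in> int_mod.span V" and "z \<in> int_mod.span V"
  shows "x * z \<in> int_mod.span V"
  using assms(2)
proof (induction rule: int_mod.span_induct_alt)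
  case base
  then show ?case
    by (simp add: int_mod.span_zero)
next
  case (step c v y)
  then have "of_int c * (x * v) + x * y \<in> int_mod.span V"
    using assms(1) by (intro int_mod.span_add int_mod.span_scale)
  then show ?case
    by (simp add: algebra_simps)
qed

lemma algebraic_int_power_relation:
  assumes "algebraic_int (x :: complex)"
  obtains n :: nat and c :: "nat \<Rightarrow> int" where "x ^ n = (\<Sum>i<n. of_int (c i) * x ^ i)"
proof -
  obtain p where p: "poly (map_poly of_int p) x = 0" "lead_coeff p = 1"
    using assms unfolding algebraic_int_altdef_ipoly by blast
  have "0 = (\<Sum>i\<le>degree p. of_int (coeff p i) * x ^ i)"
    using p(1) by (simp add: poly_altdef degree_map_poly coeff_map_poly)
  also have "{..degree p} = insert (degree p) {..<degree p}"
    by auto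
  finally have "x ^ degree p = (\<Sum>i<degree p. of_int (- coeff p i) * x ^ i)"
    using p(2) by (simp add: sum_negf eq_neg_iff_add_eq_0)
  then show ?thesis
    by (rule that)
qed

text \<open>A lattice stable under \<open>x\<close> and \<open>y\<close> is also stable under
  \<open>x - y\<close> and \<open>x * y\<close>. The monomials with exponents below those of the two
  monic relations span such a lattice, since an overflowing \<open>x^n\<close> or \<open>y^m\<close>
  is rewritten by its relation.\<close>

lemma algebraic_int_common_lattice:
  assumes "algebraic_int (x :: complex)" "algebraic_int y"
  obtains V where "finite V" "1 \<in> V"
    "\<And>v. v \<in> V \<Longrightarrow> x * v \<in> int_mod.span V" "\<And>v. v \<in> V \<Longrightarrow> y * v \<in> int_mod.span V"
proof -
  obtain n c where c: "x ^ n = (\<Sum>i<n. of_int (c i :: int) * x ^ i)"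
    using algebraic_int_power_relation[OF assms(1)] by blast
  obtain m e where e: "y ^ m = (\<Sum>i<m. of_int (e i :: int) * y ^ i)"
    using algebraic_int_power_relation[OF assms(2)] by blast
  \<comment> \<open>A relation with exponent 0 would read \<open>1 = 0\<close>.\<close>
  have n0: "n > 0" and m0: "m > 0"
    using c e by (auto intro!: Nat.gr0I)
  define V where "V = (\<lambda>(i, j). x ^ i * y ^ j) ` ({..<n} \<times> {..<m})"
  have V: "x ^ i * y ^ j \<in> int_mod.span V" if "i < n" "j < m" for i j
    using that by (intro int_mod.span_base) (auto simp: V_def)
  show ?thesis
  proof (rule that[of V])
    show "1 \<in> V"
      unfolding V_def using n0 m0 by (intro image_eqI[of _ _ "(0, 0)"]) auto
    show "x * v \<in> int_mod.span V" if v: "v \<in> V" for v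
    proof -
      obtain i j where ij: "i < n" "j < m" "v = x ^ i * y ^ j"
        using v unfolding V_def by auto
      show ?thesis
      proof (cases "Suc i < n")
        case True
        then show ?thesis
          using V[OF True ij(2)] ij(3) by (simp add: mult.assoc)
      next
        case False
        then have "Suc i = n"
          using ij by auto
        then have "x * v = x ^ n * y ^ j"
          using ij(3) by auto
        also have "\<dots> = (\<Sum>i<n. of_int (c i) * (x ^ i * y ^ j))"
          unfolding c by (simp add: sum_distrib_right mult.assoc)
        also have "\<dots> \<in> int_mod.span V"
          using V ij by (intro int_mod.span_sum int_mod.span_scale) auto
        finally show ?thesis .
      qed
    qed
    show "y * v \<in> int_mod.span V" if v: "v \<in> V" for v
    proof -
      obtain i j where ij: "i < n" "j < m" "v = x ^ i * y ^ j"
        using v unfolding V_def by auto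
      show ?thesis
      proof (cases "Suc j < m")
        case True
        then show ?thesis
          using V[OF ij(1) True] ij(3) by (simp add: mult_ac)
      next
        case False
        then have "Suc j = m"
          using ij by auto
        then have "y * v = x ^ i * y ^ m"
          using ij(3) by auto
        also have "\<dots> = (\<Sum>j<m. of_int (e j) * (x ^ i * y ^ j))"
          unfolding e by (simp add: sum_distrib_left mult_ac)
        also have "\<dots> \<in> int_mod.span V"
          using V ij by (intro int_mod.span_sum int_mod.span_scale) auto
        finally show ?thesis .
      qed
    qed
  qed (auto simp: V_def)
qed

lemma algebraic_int_diff:
  assumes "algebraic_int (x :: complex)" "algebraic_int y"
  shows "algebraic_int (x - y)"
proof -
  obtain V where V: "finite V" "1 \<in> V"
    "\<And>v. v \<in> V \<Longrightarrow> x * v \<in> int_mod.span V" "\<And>v. v \<in> V \<Longrightarrow> y * v \<in> int_mod.span V"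
    using algebraic_int_common_lattice[OF assms] by blast
  show ?thesis
    using V int_mod.span_diff by (intro algebraic_int_if_stable_lattice[of V]) (auto simp: left_diff_distrib)
qed

lemma algebraic_int_mult:
  assumes "algebraic_int (x :: complex)" "algebraic_int y"
  shows "algebraic_int (x * y)"
proof -
  obtain V where V: "finite V" "1 \<in> V"
    "\<And>v. v \<in> V \<Longrightarrow> x * v \<in> int_mod.span V" "\<And>v. v \<in> V \<Longrightarrow> y * v \<in> int_mod.span V"
    using algebraic_int_common_lattice[OF assms] by blast
  show ?thesis
    using V int_span_mult_closed[of V x]
    by (intro algebraic_int_if_stable_lattice[of V]) (auto simp: mult.assoc)
qed

lemma comm_subring_algebraic_ints: "comm_subring {x :: complex. algebraic_int x}"
  by unfold_locales (auto intro: algebraic_int_diff algebraic_int_mult)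

lemma comm_subring_Int:
  "comm_subring R \<Longrightarrow> comm_subring S \<Longrightarrow> comm_subring (R \<inter> S)"
  unfolding comm_subring_def by auto

section \<open>Primitive elements\<close>

lemma complex_subfield_hull: "complex_subfield (complex_subfield hull S)"
  by (rule hull_in) (auto simp: complex_subfield_def)

lemma complex_subfield_comm_subring: "complex_subfield F \<Longrightarrow> comm_subring F"
proof (unfold_locales, goal_cases)
  case (2 x y)
  then have "x + - y \<in> F"
    unfolding complex_subfield_def by blast
  then show ?case
    by simp
qed (auto simp: complex_subfield_def)

lemma complex_subfield_inverse: "complex_subfield F \<Longrightarrow> x \<in> F \<Longrightarrow> inverse x \<in> F"
  by (simp add: complex_subfield_def)

lemma complex_subfield_divide: "complex_subfield F \<Longrightarrow> x \<in> F \<Longrightarrow> y \<in> F \<Longrightarrow> x / y \<in> F"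
  unfolding divide_inverse complex_subfield_def by blast

lemma complex_subfield_Rats: "complex_subfield F \<Longrightarrow> \<rat> \<subseteq> F"
proof
  fix x :: complex assume F: "complex_subfield F" and "x \<in> \<rat>"
  then obtain a b where "x = of_int a / of_int b"
    by (auto elim!: Rats_cases')
  then show "x \<in> F"
    using F complex_subfield_divide comm_subring.of_int_mem[OF complex_subfield_comm_subring[OF F]]
    by auto
qed

lemma complex_subfield_Rats_self: "complex_subfield \<rat>"
  by (auto simp: complex_subfield_def)

section \<open>Minimal polynomials over a subfield\<close>

definition minimal_poly :: "complex set \<Rightarrow> complex \<Rightarrow> complex poly \<Rightarrow> bool" where
  "minimal_poly F x g \<longleftrightarrow> g \<in> polys_over F \<and> lead_coeff g = 1 \<and> poly g x = 0 \<and>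
     (\<forall>h\<in>polys_over F. h \<noteq> 0 \<longrightarrow> poly h x = 0 \<longrightarrow> degree g \<le> degree h)"

lemma ex_minimal_poly:
  assumes F: "complex_subfield F" and f: "f \<in> polys_over F" "f \<noteq> 0" "poly f x = 0"
  shows "\<exists>g. minimal_poly F x g"
proof -
  interpret comm_subring F
    using F by (rule complex_subfield_comm_subring)
  define h where "h = arg_min degree (\<lambda>h. h \<in> polys_over F \<and> h \<noteq> 0 \<and> poly h x = 0)"
  have h: "h \<in> polys_over F" "h \<noteq> 0" "poly h x = 0"
    using arg_min_natI[of "\<lambda>h. h \<in> polys_over F \<and> h \<noteq> 0 \<and> poly h x = 0" f degree] f
    unfolding h_def by blast+
  have min: "degree h \<le> degree k" if "k \<in> polys_over F" "k \<noteq> 0" "poly k x = 0" for k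
    unfolding h_def by (rule arg_min_nat_le) (use that in auto)
  show ?thesis
    using h min F unfolding minimal_poly_def
    by (intro exI[of _ "smult (inverse (lead_coeff h)) h"])
      (auto intro!: smult_polys_over complex_subfield_inverse coeff_polys_over)
qed

lemma minimal_poly_dvd:
  assumes F: "complex_subfield F" and g: "minimal_poly F x g" and h: "h \<in> polys_over F" "poly h x = 0"
  shows "\<exists>s\<in>polys_over F. h = g * s"
proof -
  interpret comm_subring F
    using F by (rule complex_subfield_comm_subring)
  obtain s r where sr: "s \<in> polys_over F" "r \<in> polys_over F" "h = g * s + r" "r = 0 \<or> degree r < degree g"
    using monic_division[of g h] g h unfolding minimal_poly_def by blast
  have "poly r x = 0"
    using sr(3) g h by (simp add: minimal_poly_def)
  then have "r = 0"
    using sr g unfolding minimal_poly_def by (meson leD)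
  then show ?thesis
    using sr by auto
qed

lemma minimal_poly_degree_pos: "minimal_poly F x g \<Longrightarrow> degree g > 0"
  unfolding minimal_poly_def by (auto intro!: Nat.gr0I elim!: degree_eq_zeroE)

text \<open>This is irreducibility in disguise. If \<open>g = g1 * s\<close> with \<open>g1\<close>
  minimal for \<open>z\<close>, then \<open>x\<close> cannot be a root of \<open>s\<close>, whose
  degree is too small, so it is a root of \<open>g1\<close>, and minimality of \<open>g\<close>
  makes the degrees equal.\<close>

lemma minimal_poly_other_root:
  assumes F: "complex_subfield F" and g: "minimal_poly F x g" and z: "poly g z = 0"
  shows "minimal_poly F z g"
proof -
  have "g \<in> polys_over F" "g \<noteq> 0"
    using g by (auto simp: minimal_poly_def)
  then obtain g1 where g1: "minimal_poly F z g1"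
    using ex_minimal_poly[OF F _ _ z] by blast
  obtain s where s: "s \<in> polys_over F" "g = g1 * s"
    using minimal_poly_dvd[OF F g1, of g] g z by (auto simp: minimal_poly_def)
  have nz: "g1 \<noteq> 0" "s \<noteq> 0"
    using s g by (auto simp: minimal_poly_def)
  then have deg: "degree g = degree g1 + degree s"
    using s(2) degree_mult_eq by blast
  have "poly s x \<noteq> 0"
  proof
    assume "poly s x = 0"
    then have "degree g \<le> degree s"
      using g s nz unfolding minimal_poly_def by blast
    then show False
      using deg minimal_poly_degree_pos[OF g1] by simp
  qed
  moreover have "poly g x = 0"
    using g by (simp add: minimal_poly_def)
  ultimately have "poly g1 x = 0"
    using s(2) by simp
  then have "degree g \<le> degree g1"
    using g g1 nz unfolding minimal_poly_def by blast
  then show ?thesis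
    using g g1 z unfolding minimal_poly_def by (meson order_trans)
qed

text \<open>In characteristic 0 the derivative is nonzero of smaller degree, so it cannot vanish at
  \<open>z\<close>, for which \<open>g\<close> is minimal as well.\<close>

lemma minimal_poly_simple_roots:
  assumes F: "complex_subfield F" and g: "minimal_poly F x g" and z: "poly g z = 0"
  shows "poly (pderiv g) z \<noteq> 0"
proof
  assume "poly (pderiv g) z = 0"
  moreover have "pderiv g \<noteq> 0" and "degree (pderiv g) < degree g"
    using minimal_poly_degree_pos[OF g] by (auto simp: pderiv_eq_0_iff degree_pderiv)
  moreover have "pderiv g \<in> polys_over F"
    using g complex_subfield_comm_subring[OF F] by (auto simp: minimal_poly_def intro: pderiv_polys_over)
  ultimately show False
    using minimal_poly_other_root[OF F g z] unfolding minimal_poly_def by (meson leD)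
qed

lemma card_roots_minimal_poly:
  assumes F: "complex_subfield F" and g: "minimal_poly F x g"
  shows "card {z. poly g z = 0} = degree g"
proof -
  have "rsquarefree g"
    unfolding rsquarefree_roots using minimal_poly_simple_roots[OF F g] by blast
  then have "g = smult (lead_coeff g) (\<Prod>z|poly g z = 0. [:- z, 1:])"
    by (simp add: complex_poly_decompose_rsquarefree)
  then have "g = (\<Prod>z|poly g z = 0. [:- z, 1:])"
    using g by (simp add: minimal_poly_def)
  then have "degree g = degree (\<Prod>z|poly g z = 0. [:- z, 1:])"
    by simp
  also have "\<dots> = card {z. poly g z = 0}"
    by (subst degree_prod_eq_sum_degree) auto
  finally show ?thesis ..
qed

text \<open>A common root of \<open>g\<close> and \<open>f (a + c b - c X)\<close> other than \<open>b\<close> is excluded by the choice of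
  \<open>c\<close>, so the minimal polynomial of \<open>b\<close> over \<open>\<rat>(a + c b)\<close> is linear.\<close>

lemma primitive_element_two:
  assumes f: "f \<in> polys_over \<rat>" "f \<noteq> 0" "poly f a = 0"
    and g: "g \<in> polys_over \<rat>" "poly g b = 0" "poly (pderiv g) b \<noteq> 0"
  obtains c :: int where "a \<in> complex_subfield hull {a + of_int c * b}"
    "b \<in> complex_subfield hull {a + of_int c * b}"
proof -
  have g0: "g \<noteq> 0"
    using g by auto
  \<comment> \<open>If \<open>a + c * b = u + c * v\<close> for roots \<open>u\<close> of
    \<open>f\<close> and \<open>v \<noteq> b\<close> of \<open>g\<close>, then \<open>c\<close> is
    the quotient listed here. Pairs with \<open>v = b\<close> only add the value 0, by the
    convention for division by zero.\<close>
  define bad where "bad = (\<lambda>(u, v). (u - a) / (b - v)) ` ({u. poly f u = 0} \<times> {v. poly g v = 0})"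
  have "finite bad"
    unfolding bad_def using f g0 by (intro finite_imageI finite_cartesian_product poly_roots_finite)
  then have "finite ((of_int :: int \<Rightarrow> complex) -` bad)"
    by (rule finite_vimageI) (simp add: inj_on_def)
  then obtain c :: int where c: "of_int c \<notin> bad"
    using infinite_UNIV_int by (metis ex_new_if_finite vimage_eq)
  define \<gamma> where "\<gamma> = a + of_int c * b"
  define F where "F = complex_subfield hull {\<gamma>}"
  have F: "complex_subfield F"
    unfolding F_def by (rule complex_subfield_hull)
  interpret comm_subring F
    using F by (rule complex_subfield_comm_subring)
  have \<gamma>F: "\<gamma> \<in> F"
    unfolding F_def by (simp add: hull_inc)
  have RF: "polys_over \<rat> \<subseteq> polys_over F"
    by (intro polys_over_mono complex_subfield_Rats F)
  define h where "h = pcompose f [:\<gamma>, - of_int c:]"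
  have h: "h \<in> polys_over F"
    unfolding h_def using f RF \<gamma>F
    by (intro pcompose_polys_over) (auto simp: pCons_polys_over comm_subring.zero_mem[OF comm_subring_polys_over]
        intro: uminus_mem of_int_mem)
  have hb: "poly h b = 0"
    using f by (simp add: h_def poly_pcompose \<gamma>_def mult.commute)
  obtain q where q: "minimal_poly F b q"
    using ex_minimal_poly[OF F, of g b] g g0 RF by auto
  obtain s where s: "g = q * s"
    using minimal_poly_dvd[OF F q, of g] g RF by auto
  obtain s' where s': "h = q * s'"
    using minimal_poly_dvd[OF F q h hb] by auto
  have uniq: "z = b" if "poly q z = 0" for z
  proof (rule ccontr)
    assume "z \<noteq> b"
    have "poly g z = 0" "poly f (\<gamma> - of_int c * z) = 0"
      using that s s' by (auto simp: h_def poly_pcompose mult.commute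
          dest!: arg_cong[where f = "\<lambda>p. poly p z"])
    moreover have "of_int c = ((\<gamma> - of_int c * z) - a) / (b - z)"
      using \<open>z \<noteq> b\<close> by (simp add: \<gamma>_def field_simps)
    ultimately have "of_int c \<in> bad"
      unfolding bad_def by (intro image_eqI[of _ _ "(\<gamma> - of_int c * z, z)"]) auto
    then show False
      using c by simp
  qed
  obtain q1 where q1: "q = [:- b, 1:] * q1"
    using q by (auto simp: minimal_poly_def poly_eq_0_iff_dvd elim: dvdE)
  \<comment> \<open>Any root of \<open>q1\<close> is a root of \<open>q\<close> and hence equals
    \<open>b\<close>, which would make \<open>b\<close> a double root of \<open>g\<close>.\<close>
  have "degree q1 = 0"
  proof (rule ccontr)
    assume "degree q1 \<noteq> 0"
    then have "\<not> constant (poly q1)"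
      by (simp add: constant_degree)
    then obtain z where "poly q1 z = 0"
      using fundamental_theorem_of_algebra by blast
    then have "poly q1 b = 0"
      using uniq[of z] q1 by auto
    then have "poly (pderiv g) b = 0"
      unfolding s q1 pderiv_mult by (simp add: pderiv_pCons)
    then show False
      using g by simp
  qed
  then obtain k where "q1 = [:k:]"
    by (auto elim: degree_eq_zeroE)
  moreover have "lead_coeff q = 1"
    using q by (simp add: minimal_poly_def)
  ultimately have "q = [:- b, 1:]"
    using q1 by (auto split: if_splits)
  then have "- b \<in> F"
    using q by (auto simp: minimal_poly_def pCons_polys_over)
  then have b: "b \<in> F"
    using uminus_mem by fastforce
  have "\<gamma> - of_int c * b \<in> F"
    using b \<gamma>F by (intro diff_mem mult_mem of_int_mem)
  then have "a \<in> F"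
    by (simp add: \<gamma>_def)
  then show ?thesis
    using b that unfolding F_def \<gamma>_def by blast
qed

lemma algebraic_int_monic_poly:
  assumes "algebraic_int (x :: complex)"
  obtains f where "f \<in> polys_over \<int>" "lead_coeff f = 1" "poly f x = 0"
  using assms by (auto simp: polys_over_def elim!: algebraic_int.cases)

text \<open>The roots are adjoined one at a time; the two-generator step applies because each
  \<open>\<alpha> i\<close> is a simple root of \<open>C\<close>. Its multiplier is an integer, so
  the generator stays an algebraic integer and its powers can later be used inside the ring of
  integers.\<close>

lemma primitive_element:
  fixes \<alpha> :: "nat \<Rightarrow> complex"
  assumes C: "C \<in> polys_over \<int>" "lead_coeff C = 1"
    and \<alpha>: "\<And>i. i < n \<Longrightarrow> poly C (\<alpha> i) = 0" "\<And>i. i < n \<Longrightarrow> poly (pderiv C) (\<alpha> i) \<noteq> 0"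
  shows "\<exists>\<theta>. algebraic_int \<theta> \<and> complex_subfield hull {\<theta>} = complex_subfield hull (\<alpha> ` {..<n})"
  using \<alpha>
proof (induction n)
  case 0
  have "0 \<in> complex_subfield hull {}"
    using complex_subfield_hull[of "{}"] by (simp add: complex_subfield_def)
  then have "complex_subfield hull {0} = complex_subfield hull {}"
    by (rule hull_redundant)
  then show ?case
    by (intro exI[of _ 0]) auto
next
  case (Suc n)
  then obtain \<theta> where \<theta>: "algebraic_int \<theta>" "complex_subfield hull {\<theta>} = complex_subfield hull (\<alpha> ` {..<n})"
    by (metis less_SucI)
  obtain f where f: "f \<in> polys_over \<int>" "lead_coeff f = 1" "poly f \<theta> = 0"
    using \<theta>(1) by (rule algebraic_int_monic_poly)
  have ZQ: "polys_over \<int> \<subseteq> (polys_over \<rat> :: complex poly set)"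
    by (intro polys_over_mono) (auto elim!: Ints_cases)
  obtain c :: int where c: "\<theta> \<in> complex_subfield hull {\<theta> + of_int c * \<alpha> n}"
    "\<alpha> n \<in> complex_subfield hull {\<theta> + of_int c * \<alpha> n}"
  proof (rule primitive_element_two[of f \<theta> C "\<alpha> n"])
    show "f \<in> polys_over \<rat>" "C \<in> polys_over \<rat>"
      using f C ZQ by blast+
    show "f \<noteq> 0"
      using f by auto
  qed (use f Suc.prems in simp_all)
  let ?L = "complex_subfield hull (\<alpha> ` {..<Suc n})"
  let ?F = "complex_subfield hull {\<theta> + of_int c * \<alpha> n}"
  interpret L: comm_subring ?L
    by (intro complex_subfield_comm_subring complex_subfield_hull)
  interpret A: comm_subring "{x :: complex. algebraic_int x}"
    by (rule comm_subring_algebraic_ints)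
  have \<theta>L: "\<theta> \<in> ?L"
  proof -
    have "\<theta> \<in> complex_subfield hull (\<alpha> ` {..<n})"
      unfolding \<theta>(2)[symmetric] by (rule hull_inc) simp
    also have "\<dots> \<subseteq> ?L"
      by (intro hull_mono image_mono) auto
    finally show ?thesis .
  qed
  have "?F \<subseteq> ?L"
  proof (rule hull_minimal)
    have "\<alpha> n \<in> ?L"
      by (rule hull_inc) simp
    then show "{\<theta> + of_int c * \<alpha> n} \<subseteq> ?L"
      using \<theta>L by (auto intro!: L.add_mem L.mult_mem L.of_int_mem)
  qed (rule complex_subfield_hull)
  moreover have "?L \<subseteq> ?F"
  proof (rule hull_minimal)
    have "complex_subfield hull {\<theta>} \<subseteq> ?F"
      using c by (intro hull_minimal complex_subfield_hull) auto
    moreover have "\<alpha> ` {..<n} \<subseteq> complex_subfield hull {\<theta>}"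
      unfolding \<theta>(2) by (rule hull_subset)
    ultimately have "\<alpha> ` {..<n} \<subseteq> ?F"
      by (rule subset_trans[rotated])
    then show "\<alpha> ` {..<Suc n} \<subseteq> ?F"
      using c(2) by (simp add: lessThan_Suc)
  qed (rule complex_subfield_hull)
  moreover have "algebraic_int (\<alpha> n)"
    using C Suc.prems by (intro algebraic_int_of_monic_root[of C]) auto
  then have "algebraic_int (\<theta> + of_int c * \<alpha> n)"
    using A.add_mem[of \<theta> "of_int c * \<alpha> n"] A.mult_mem[of "of_int c" "\<alpha> n"] A.of_int_mem[of c] \<theta>(1)
    by simp
  ultimately show ?case
    by blast
qed

lemma clear_denominators_poly:
  assumes "h \<in> polys_over (\<rat> :: complex set)"
  shows "\<exists>N::int. N > 0 \<and> smult (of_int N) h \<in> polys_over \<int>"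
  using assms
proof (induction h)
  case 0
  then show ?case
    by (intro exI[of _ 1]) (simp add: polys_over_def)
next
  case (pCons a h)
  interpret Z: comm_subring "\<int> :: complex set"
    by (rule comm_subring_Ints)
  interpret Q: comm_subring "\<rat> :: complex set"
    by (rule comm_subring_Rats)
  obtain N where N: "N > 0" "smult (of_int N) h \<in> polys_over \<int>"
    using pCons by (auto simp: Q.pCons_polys_over)
  have "a \<in> \<rat>"
    using pCons.prems by (simp add: Q.pCons_polys_over)
  then obtain u v where uv: "v > 0" "a = of_int u / of_int v"
    by (auto elim!: Rats_cases')
  have "smult (of_int (v * N)) (pCons a h) = pCons (of_int (N * u)) (smult (of_int v) (smult (of_int N) h))"
    using uv by simp
  also have "\<dots> \<in> polys_over \<int>"
    unfolding Z.pCons_polys_over using Z.smult_polys_over[OF Ints_of_int N(2)] by (intro conjI Ints_of_int)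
  finally show ?case
    using uv N by (intro exI[of _ "v * N"]) auto
qed

section \<open>The Galois group of a splitting field\<close>

lemma Ints_le_Rats_polys: "f \<in> polys_over \<int> \<Longrightarrow> f \<in> polys_over (\<rat> :: complex set)"
  by (erule subsetD[OF polys_over_mono, rotated]) (auto elim!: Ints_cases)

text \<open>The values are allowed to lie outside \<open>K\<close>, so that an embedding can be
  handled before it is known to map \<open>K\<close> into itself; that fact is proved inside
  \<open>ex_Gal\<close>. The condition on 1 excludes the zero map.\<close>

locale subfield_hom =
  fixes K :: "complex set" and \<sigma> :: "complex \<Rightarrow> complex"
  assumes subfield: "complex_subfield K"
    and hom_one: "\<sigma> 1 = 1"
    and hom_add: "x \<in> K \<Longrightarrow> y \<in> K \<Longrightarrow> \<sigma> (x + y) = \<sigma> x + \<sigma> y"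
    and hom_mult: "x \<in> K \<Longrightarrow> y \<in> K \<Longrightarrow> \<sigma> (x * y) = \<sigma> x * \<sigma> y"
begin

sublocale dom: comm_subring K
  using subfield by (rule complex_subfield_comm_subring)

lemma hom_zero: "\<sigma> 0 = 0"
  using hom_add[OF dom.zero_mem dom.zero_mem] by simp

lemma hom_uminus: "x \<in> K \<Longrightarrow> \<sigma> (- x) = - \<sigma> x"
  using hom_add[of x "- x"] dom.uminus_mem[of x] hom_zero by (simp add: add_eq_0_iff2)

lemma hom_diff: "x \<in> K \<Longrightarrow> y \<in> K \<Longrightarrow> \<sigma> (x - y) = \<sigma> x - \<sigma> y"
  using hom_add[of x "- y"] dom.uminus_mem[of y] hom_uminus[of y] by simp

lemma hom_sum: "(\<And>i. i \<in> I \<Longrightarrow> f i \<in> K) \<Longrightarrow> \<sigma> (sum f I) = (\<Sum>i\<in>I. \<sigma> (f i))"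
  by (induction I rule: infinite_finite_induct) (auto simp: hom_zero hom_add dom.sum_mem)

lemma hom_prod: "(\<And>i. i \<in> I \<Longrightarrow> f i \<in> K) \<Longrightarrow> \<sigma> (prod f I) = (\<Prod>i\<in>I. \<sigma> (f i))"
  by (induction I rule: infinite_finite_induct) (auto simp: hom_one hom_mult dom.prod_mem)

lemma hom_power: "x \<in> K \<Longrightarrow> \<sigma> (x ^ n) = \<sigma> x ^ n"
  by (induction n) (auto simp: hom_one hom_mult dom.power_mem)

lemma hom_of_nat: "\<sigma> (of_nat n) = of_nat n"
  by (induction n) (auto simp: hom_zero hom_one hom_add dom.of_nat_mem dom.one_mem)

lemma hom_of_int: "\<sigma> (of_int n) = of_int n"
  by (cases n rule: int_cases2) (auto simp: hom_of_nat hom_uminus dom.of_nat_mem)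

lemma hom_inverse: "x \<in> K \<Longrightarrow> \<sigma> (inverse x) = inverse (\<sigma> x)"
proof (cases "x = 0")
  case False
  assume "x \<in> K"
  moreover from this have "inverse x \<in> K"
    using subfield by (intro complex_subfield_inverse)
  ultimately have "\<sigma> x * \<sigma> (inverse x) = 1"
    using False by (simp add: hom_one flip: hom_mult)
  then show ?thesis
    by (metis inverse_unique)
qed (simp add: hom_zero)

lemma hom_Rats: "x \<in> \<rat> \<Longrightarrow> \<sigma> x = x"
  using dom.of_int_mem complex_subfield_inverse[OF subfield dom.of_int_mem]
  by (auto elim!: Rats_cases' simp: divide_inverse hom_mult hom_of_int hom_inverse)

lemma hom_poly:
  assumes "h \<in> polys_over \<rat>" "x \<in> K"
  shows "\<sigma> (poly h x) = poly h (\<sigma> x)"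
proof -
  have "coeff h i \<in> \<rat>" "coeff h i \<in> K" for i
    using assms complex_subfield_Rats[OF subfield] by (auto simp: polys_over_def)
  then show ?thesis
    using assms by (simp add: poly_altdef hom_sum hom_mult hom_power hom_Rats dom.mult_mem dom.power_mem)
qed

lemma hom_eq_0_iff: "x \<in> K \<Longrightarrow> \<sigma> x = 0 \<longleftrightarrow> x = 0"
  using hom_mult[of x "inverse x"] hom_one hom_zero complex_subfield_inverse[OF subfield, of x]
  by (cases "x = 0") auto

lemma hom_inj: "inj_on \<sigma> K"
proof (rule inj_onI)
  fix x y assume xy: "x \<in> K" "y \<in> K" "\<sigma> x = \<sigma> y"
  then have "\<sigma> (x - y) = 0"
    by (simp add: hom_diff)
  then show "x = y"
    using xy by (simp add: hom_eq_0_iff dom.diff_mem)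
qed

lemma hom_algebraic_int:
  assumes "x \<in> K" "algebraic_int x"
  shows "algebraic_int (\<sigma> x)"
proof -
  obtain f where f: "f \<in> polys_over \<int>" "lead_coeff f = 1" "poly f x = 0"
    using assms(2) by (rule algebraic_int_monic_poly)
  moreover have "f \<in> polys_over \<rat>"
    using f(1) by (rule Ints_le_Rats_polys)
  ultimately have "poly f (\<sigma> x) = 0"
    using assms hom_poly[of f x] hom_zero by simp
  then show ?thesis
    using f by (intro algebraic_int_of_monic_root)
qed

end

text \<open>The nonvanishing of the discriminant enters as \<open>inj_\<alpha>\<close>.\<close>

locale splitting_field =
  fixes C :: "complex poly" and \<alpha> :: "nat \<Rightarrow> complex" and d :: nat and K :: "complex set"
  assumes C_int: "C \<in> polys_over \<int>"
    and C_split: "C = (\<Prod>i<d. [:- \<alpha> i, 1:])"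
    and inj_\<alpha>: "inj_on \<alpha> {..<d}"
    and K_hull: "K = complex_subfield hull (\<alpha> ` {..<d})"
begin

lemma K_subfield: "complex_subfield K"
  unfolding K_hull by (rule complex_subfield_hull)

sublocale K: comm_subring K
  using K_subfield by (rule complex_subfield_comm_subring)

lemma lead_coeff_C: "lead_coeff C = 1"
  unfolding C_split lead_coeff_prod by simp

lemma poly_C_eq_0_iff: "poly C x = 0 \<longleftrightarrow> x \<in> \<alpha> ` {..<d}"
  by (auto simp: C_split poly_prod)

lemma \<alpha>_K: "i < d \<Longrightarrow> \<alpha> i \<in> K"
  unfolding K_hull by (intro hull_inc) auto

lemma algebraic_int_\<alpha>: "i < d \<Longrightarrow> algebraic_int (\<alpha> i)"
  by (rule algebraic_int_of_monic_root[OF lead_coeff_C C_int]) (auto simp: poly_C_eq_0_iff)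

lemma pderiv_C_nonzero:
  assumes "i < d"
  shows "poly (pderiv C) (\<alpha> i) \<noteq> 0"
proof -
  have "C = [:- \<alpha> i, 1:] * (\<Prod>j\<in>{..<d} - {i}. [:- \<alpha> j, 1:])"
    unfolding C_split using assms by (subst prod.remove[of _ i]) auto
  then have "pderiv C = pderiv ([:- \<alpha> i, 1:] * (\<Prod>j\<in>{..<d} - {i}. [:- \<alpha> j, 1:]))"
    by simp
  then have "poly (pderiv C) (\<alpha> i) = (\<Prod>j\<in>{..<d} - {i}. \<alpha> i - \<alpha> j)"
    unfolding pderiv_mult by (simp add: pderiv_pCons poly_prod)
  moreover have "\<dots> \<noteq> 0"
    using inj_\<alpha> assms by (auto simp: inj_on_def)
  ultimately show ?thesis
    by simp
qed

lemma ex_primitive: "\<exists>\<theta>. algebraic_int \<theta> \<and> complex_subfield hull {\<theta>} = K"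
  unfolding K_hull
  by (rule primitive_element[OF C_int lead_coeff_C]) (auto simp: poly_C_eq_0_iff pderiv_C_nonzero)

definition \<theta> :: complex where
  "\<theta> = (SOME \<theta>. algebraic_int \<theta> \<and> complex_subfield hull {\<theta>} = K)"

lemma algebraic_int_\<theta>: "algebraic_int \<theta>" and hull_\<theta>: "complex_subfield hull {\<theta>} = K"
  using someI_ex[OF ex_primitive] unfolding \<theta>_def by blast+

lemma \<theta>_K: "\<theta> \<in> K"
  using hull_inc[of \<theta> "{\<theta>}" complex_subfield] hull_\<theta> by simp

definition mp :: "complex poly" where
  "mp = (SOME g. minimal_poly \<rat> \<theta> g)"

definition m :: nat where
  "m = degree mp"

lemma algebraic_int_ex_minimal_poly: "algebraic_int x \<Longrightarrow> \<exists>g. minimal_poly \<rat> x g"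
  by (elim algebraic_int_monic_poly, rule ex_minimal_poly[OF complex_subfield_Rats_self])
    (auto intro: Ints_le_Rats_polys)

lemma mp: "minimal_poly \<rat> \<theta> mp"
  using someI_ex[OF algebraic_int_ex_minimal_poly[OF algebraic_int_\<theta>]] unfolding mp_def .

lemma mp_rat: "mp \<in> polys_over \<rat>" and lead_coeff_mp: "lead_coeff mp = 1" and mp_\<theta>: "poly mp \<theta> = 0"
  using mp by (auto simp: minimal_poly_def)

lemma m_pos: "m > 0"
  unfolding m_def using mp by (rule minimal_poly_degree_pos)

interpretation Q: comm_subring "\<rat> :: complex set"
  by (rule comm_subring_Rats)

interpretation QX: comm_subring "polys_over (\<rat> :: complex set)"
  by (rule Q.comm_subring_polys_over)

interpretation Z: comm_subring "{x :: complex. algebraic_int x}"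
  by (rule comm_subring_algebraic_ints)

lemma poly_clear_denominators:
  assumes "h \<in> polys_over \<rat>"
  shows "\<exists>N::int. N > 0 \<and> algebraic_int (of_int N * poly h \<theta>)"
proof -
  obtain N :: int where N: "N > 0" "smult (of_int N) h \<in> polys_over \<int>"
    using clear_denominators_poly[OF assms] by blast
  then have "smult (of_int N) h \<in> polys_over {x. algebraic_int x}"
    by (auto simp: polys_over_def int_imp_algebraic_int)
  then have "algebraic_int (poly (smult (of_int N) h) \<theta>)"
    using Z.poly_mem algebraic_int_\<theta> by blast
  then show ?thesis
    using N by auto
qed

text \<open>The point is that polynomial expressions in \<open>\<theta>\<close> are closed under
  inverses. If the minimal polynomial of \<open>x \<noteq> 0\<close> is \<open>c + X * q1\<close>,
  then \<open>c \<noteq> 0\<close> by minimality and \<open>inverse x = - q1(x) / c\<close>.\<close>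

lemma K_eq: "K = (\<lambda>h. poly h \<theta>) ` polys_over \<rat>"
proof
  show "(\<lambda>h. poly h \<theta>) ` polys_over \<rat> \<subseteq> K"
    using K.poly_mem \<theta>_K polys_over_mono[OF complex_subfield_Rats[OF K_subfield]] by blast
  let ?L = "(\<lambda>h. poly h \<theta>) ` polys_over (\<rat> :: complex set)"
  have "inverse x \<in> ?L" if x: "x \<in> ?L" for x
  proof (cases "x = 0")
    case True
    then show ?thesis
      using x by simp
  next
    case False
    obtain h where h: "h \<in> polys_over \<rat>" "x = poly h \<theta>"
      using x by auto
    obtain N :: int where N: "N > 0" "algebraic_int (of_int N * x)"
      using poly_clear_denominators[OF h(1)] h(2) by blast
    obtain f where f: "f \<in> polys_over \<int>" "lead_coeff f = 1" "poly f (of_int N * x) = 0"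
      using N(2) by (rule algebraic_int_monic_poly)
    \<comment> \<open>Rescaling the variable turns the monic equation of \<open>N * x\<close> into a
      rational equation for \<open>x\<close>.\<close>
    have "pcompose f [:0, of_int N:] \<in> polys_over \<rat>"
      using f Ints_le_Rats_polys by (intro Q.pcompose_polys_over) (auto simp: Q.pCons_polys_over QX.zero_mem)
    moreover have "pcompose f [:0, of_int N:] \<noteq> 0"
      using f(2) N(1) by (subst pcompose_eq_0_iff) auto
    moreover have "poly (pcompose f [:0, of_int N:]) x = 0"
      using f by (simp add: poly_pcompose mult.commute)
    ultimately obtain q where q: "minimal_poly \<rat> x q"
      using ex_minimal_poly[OF complex_subfield_Rats_self] by blast
    obtain c q1 where cq: "q = pCons c q1"
      by (cases q)
    have q1: "q1 \<in> polys_over \<rat>" "c \<in> \<rat>" "c + x * poly q1 x = 0"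
      using q cq by (auto simp: minimal_poly_def Q.pCons_polys_over)
    have "c \<noteq> 0"
    proof
      assume "c = 0"
      then have "poly q1 x = 0"
        using q1(3) False by simp
      moreover have "q1 \<noteq> 0"
        using cq \<open>c = 0\<close> q by (auto simp: minimal_poly_def)
      ultimately have "degree q \<le> degree q1"
        using q q1 unfolding minimal_poly_def by blast
      then show False
        using cq \<open>q1 \<noteq> 0\<close> by simp
    qed
    then have "inverse x = - inverse c * poly q1 x"
      using q1(3) False by (simp add: field_simps add_eq_0_iff2)
    also have "\<dots> = poly (smult (- inverse c) (pcompose q1 h)) \<theta>"
      using h by (simp add: poly_pcompose)
    also have "\<dots> \<in> ?L"
      using q1 h by (intro imageI Q.smult_polys_over Q.pcompose_polys_over) auto
    finally show ?thesis .
  qed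
  moreover have "0 \<in> ?L" "1 \<in> ?L"
    by (rule image_eqI[of _ _ 0] image_eqI[of _ _ 1]; simp add: QX.zero_mem QX.one_mem)+
  moreover have "- x \<in> ?L" if x: "x \<in> ?L" for x
  proof -
    obtain f where f: "f \<in> polys_over \<rat>" "x = poly f \<theta>"
      using x by auto
    then show ?thesis
      using QX.uminus_mem by (intro image_eqI[of _ _ "- f"]) auto
  qed
  moreover have "x + y \<in> ?L" "x * y \<in> ?L" if xy: "x \<in> ?L" "y \<in> ?L" for x y
  proof -
    obtain f g where fg: "f \<in> polys_over \<rat>" "g \<in> polys_over \<rat>" "x = poly f \<theta>" "y = poly g \<theta>"
      using xy by auto
    show "x + y \<in> ?L"
      using fg QX.add_mem by (intro image_eqI[of _ _ "f + g"]) auto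
    show "x * y \<in> ?L"
      using fg QX.mult_mem by (intro image_eqI[of _ _ "f * g"]) auto
  qed
  ultimately have "complex_subfield ?L"
    unfolding complex_subfield_def by (intro conjI ballI)
  moreover have "\<theta> \<in> ?L"
    by (rule image_eqI[of _ _ "[:0, 1:]"]) (auto simp: Q.pCons_polys_over QX.zero_mem)
  ultimately have "complex_subfield hull {\<theta>} \<subseteq> ?L"
    by (intro hull_minimal) auto
  then show "K \<subseteq> ?L"
    by (simp only: hull_\<theta>)
qed

lemma K_cases:
  assumes "x \<in> K"
  obtains h where "h \<in> polys_over \<rat>" "x = poly h \<theta>"
  using equalityD1[OF K_eq] assms by auto

lemma poly_\<theta>_K: "h \<in> polys_over \<rat> \<Longrightarrow> poly h \<theta> \<in> K"
  using equalityD2[OF K_eq] by auto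

lemma K_clear_denominators: "x \<in> K \<Longrightarrow> \<exists>N::int. N > 0 \<and> algebraic_int (of_int N * x)"
  using poly_clear_denominators by (elim K_cases) auto

section \<open>The power basis of \<open>K\<close> and its degree\<close>

lemma K_power_combination:
  assumes "x \<in> K"
  obtains q :: "nat \<Rightarrow> rat" where "x = (\<Sum>i<m. of_rat (q i) * \<theta> ^ i)"
proof -
  obtain h where h: "h \<in> polys_over \<rat>" "x = poly h \<theta>"
    using assms by (rule K_cases)
  obtain s r where r: "r \<in> polys_over \<rat>" "h = mp * s + r" "r = 0 \<or> degree r < degree mp"
    using Q.monic_division[OF mp_rat lead_coeff_mp h(1)] by blast
  have "x = poly r \<theta>"
    using h r mp_\<theta> by simp
  also have "\<dots> = (\<Sum>i<m. coeff r i * \<theta> ^ i)"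
    unfolding poly_altdef
    by (rule sum.mono_neutral_left) (use r(3) m_pos in \<open>auto simp: m_def coeff_eq_0\<close>)
  finally have "x = (\<Sum>i<m. coeff r i * \<theta> ^ i)" .
  moreover have "\<exists>q. coeff r i = of_rat q" for i
    using coeff_polys_over[OF r(1), of i] by (auto elim: Rats_cases)
  then obtain q where "\<And>i. coeff r i = of_rat (q i)"
    by metis
  ultimately show ?thesis
    using that by simp
qed

lemma powers_independent:
  assumes "(\<Sum>i<m. of_rat (q i) * \<theta> ^ i) = 0" "j < m"
  shows "q j = 0"
proof -
  define h where "h = (\<Sum>i<m. monom (of_rat (q i) :: complex) i)"
  have coeff_h: "coeff h i = (if i < m then of_rat (q i) else 0)" for i
    by (simp add: h_def coeff_sum)
  have "poly h \<theta> = 0"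
    using assms(1) by (simp add: h_def poly_sum poly_monom)
  moreover have "h \<in> polys_over \<rat>"
    by (auto simp: polys_over_def coeff_h)
  moreover have "degree h < m"
    using m_pos by (intro degree_lessI) (auto simp: coeff_h)
  ultimately have "h = 0"
    using mp unfolding minimal_poly_def m_def by (meson leD)
  then show ?thesis
    using coeff_h[of j] assms(2) by simp
qed

text \<open>Independence in the vector space is a property of sets, so the family of powers must not
  collapse when its image is taken.\<close>

lemma inj_on_powers: "inj_on (\<lambda>i. \<theta> ^ i) {..<m}"
proof (rule inj_onI)
  fix i j assume ij: "i \<in> {..<m}" "j \<in> {..<m}" "\<theta> ^ i = \<theta> ^ j"
  show "i = j"
  proof (rule ccontr)
    assume ne: "i \<noteq> j"
    define q :: "nat \<Rightarrow> rat" where "q k = (if k = i then 1 else 0) - (if k = j then 1 else 0)" for k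
    have "(\<Sum>k<m. of_rat (q k) * \<theta> ^ k) =
        (\<Sum>k<m. if k = i then \<theta> ^ k else 0) - (\<Sum>k<m. if k = j then \<theta> ^ k else 0)"
      unfolding sum_subtractf[symmetric] by (rule sum.cong) (auto simp: q_def)
    also have "\<dots> = 0"
      using ij by simp
    finally have "q i = 0"
      using ij by (intro powers_independent) auto
    then show False
      using ne by (simp add: q_def)
  qed
qed

lemma rat_subspace_K: "rat_vs.subspace K"
  unfolding rat_vs.subspace_def
  using K.zero_mem K.add_mem K.mult_mem complex_subfield_Rats[OF K_subfield] by (auto simp: subset_iff)

lemma rat_span_powers: "rat_vs.span ((\<lambda>i. \<theta> ^ i) ` {..<m}) = K"
proof
  show "rat_vs.span ((\<lambda>i. \<theta> ^ i) ` {..<m}) \<subseteq> K"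
    using K.power_mem[OF \<theta>_K] by (intro rat_vs.span_minimal rat_subspace_K) auto
  show "K \<subseteq> rat_vs.span ((\<lambda>i. \<theta> ^ i) ` {..<m})"
  proof
    fix x assume "x \<in> K"
    then obtain q where x: "x = (\<Sum>i<m. of_rat (q i) * \<theta> ^ i)"
      by (rule K_power_combination)
    show "x \<in> rat_vs.span ((\<lambda>i. \<theta> ^ i) ` {..<m})"
      unfolding x by (intro rat_vs.span_sum rat_vs.span_scale rat_vs.span_base imageI)
  qed
qed

lemma rat_independent_powers: "rat_vs.independent ((\<lambda>i. \<theta> ^ i) ` {..<m})"
proof
  assume "rat_vs.dependent ((\<lambda>i. \<theta> ^ i) ` {..<m})"
  then obtain u j where u: "j < m" "u (\<theta> ^ j) \<noteq> 0"
    "(\<Sum>v\<in>(\<lambda>i. \<theta> ^ i) ` {..<m}. of_rat (u v) * v) = 0"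
    by (subst (asm) rat_vs.dependent_finite) auto
  then have "(\<Sum>i<m. of_rat (u (\<theta> ^ i)) * \<theta> ^ i) = 0"
    by (subst (asm) sum.reindex[OF inj_on_powers]) simp
  from powers_independent[OF this u(1)] show False
    using u(2) by simp
qed

lemma dim_K: "rat_vs.dim K = m"
proof -
  have "rat_vs.dim K = card ((\<lambda>i. \<theta> ^ i) ` {..<m})"
  proof (rule rat_vs.dim_eq_card)
    show "rat_vs.span ((\<lambda>i. \<theta> ^ i) ` {..<m}) = rat_vs.span K"
      unfolding rat_span_powers using rat_subspace_K rat_vs.span_eq_iff by metis
  qed (rule rat_independent_powers)
  then show ?thesis
    by (simp add: card_image inj_on_powers)
qed

section \<open>The automorphism group of \<open>K\<close>\<close>

text \<open>Automorphisms are extended by the identity outside \<open>K\<close>, so that they compose as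
  plain functions.\<close>

definition Gal :: "(complex \<Rightarrow> complex) set" where
  "Gal = {\<sigma>. subfield_hom K \<sigma> \<and> \<sigma> ` K \<subseteq> K \<and> (\<forall>x. x \<notin> K \<longrightarrow> \<sigma> x = x)}"

lemma Gal_hom: "\<sigma> \<in> Gal \<Longrightarrow> subfield_hom K \<sigma>"
  by (simp add: Gal_def)

lemma Gal_K: "\<sigma> \<in> Gal \<Longrightarrow> x \<in> K \<Longrightarrow> \<sigma> x \<in> K"
  by (auto simp: Gal_def)

lemma Gal_outside: "\<sigma> \<in> Gal \<Longrightarrow> x \<notin> K \<Longrightarrow> \<sigma> x = x"
  unfolding Gal_def by blast

lemma GalI:
  "subfield_hom K \<sigma> \<Longrightarrow> (\<And>x. x \<in> K \<Longrightarrow> \<sigma> x \<in> K) \<Longrightarrow> (\<And>x. x \<notin> K \<Longrightarrow> \<sigma> x = x) \<Longrightarrow> \<sigma> \<in> Gal"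
  unfolding Gal_def by blast

lemma Gal_root: "\<sigma> \<in> Gal \<Longrightarrow> poly mp (\<sigma> \<theta>) = 0"
  using subfield_hom.hom_poly[OF Gal_hom mp_rat \<theta>_K] mp_\<theta> subfield_hom.hom_zero[OF Gal_hom] by metis

lemma Gal_eqI:
  assumes "\<sigma> \<in> Gal" "\<tau> \<in> Gal" "\<sigma> \<theta> = \<tau> \<theta>"
  shows "\<sigma> = \<tau>"
proof
  fix x
  show "\<sigma> x = \<tau> x"
  proof (cases "x \<in> K")
    case True
    then obtain h where "h \<in> polys_over \<rat>" "x = poly h \<theta>"
      by (rule K_cases)
    then show ?thesis
      using assms subfield_hom.hom_poly[OF Gal_hom _ \<theta>_K] by metis
  qed (use assms in \<open>simp add: Gal_outside\<close>)
qed

text \<open>\<open>\<sigma>\<close> evaluates at \<open>z\<close> a polynomial that represents the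
  given element at \<open>\<theta>\<close>; the choice of the polynomial is immaterial, since two
  choices differ by a multiple of \<open>mp\<close>. It maps \<open>K\<close> into \<open>K\<close>
  because the elements with image in \<open>K\<close> form a subfield, and this contains all roots
  of \<open>C\<close>, which \<open>\<sigma>\<close> sends to roots of \<open>C\<close>.\<close>

lemma ex_Gal:
  assumes z: "poly mp z = 0"
  shows "\<exists>\<sigma>\<in>Gal. \<sigma> \<theta> = z"
proof -
  define \<sigma> where "\<sigma> x = (if x \<in> K then poly (SOME h. h \<in> polys_over \<rat> \<and> poly h \<theta> = x) z else x)" for x
  have \<sigma>: "\<sigma> (poly h \<theta>) = poly h z" if h: "h \<in> polys_over \<rat>" for h
  proof -
    define k where "k = (SOME k. k \<in> polys_over \<rat> \<and> poly k \<theta> = poly h \<theta>)"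
    have k: "k \<in> polys_over \<rat>" "poly k \<theta> = poly h \<theta>"
      using someI[of "\<lambda>k. k \<in> polys_over \<rat> \<and> poly k \<theta> = poly h \<theta>" h] h unfolding k_def by auto
    then obtain s where "k - h = mp * s"
      using minimal_poly_dvd[OF complex_subfield_Rats_self mp, of "k - h"] h QX.diff_mem by auto
    then have "poly (k - h) z = 0"
      using z by simp
    moreover have "poly h \<theta> \<in> K"
      using h by (rule poly_\<theta>_K)
    ultimately show ?thesis
      by (simp add: \<sigma>_def flip: k_def)
  qed
  have hom: "subfield_hom K \<sigma>"
  proof
    show "complex_subfield K"
      by (rule K_subfield)
    show "\<sigma> 1 = 1"
      using \<sigma>[of 1] QX.one_mem by simp
    fix x y assume "x \<in> K" "y \<in> K"
    then obtain f g where fg: "f \<in> polys_over \<rat>" "g \<in> polys_over \<rat>" "x = poly f \<theta>" "y = poly g \<theta>"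
      by (elim K_cases)
    then show "\<sigma> (x + y) = \<sigma> x + \<sigma> y" "\<sigma> (x * y) = \<sigma> x * \<sigma> y"
      using \<sigma>[of f] \<sigma>[of g] \<sigma>[of "f + g"] \<sigma>[of "f * g"] QX.add_mem QX.mult_mem by auto
  qed
  then interpret subfield_hom K \<sigma> .
  have "K \<subseteq> {x \<in> K. \<sigma> x \<in> K}"
    unfolding K_hull
  proof (rule hull_minimal, fold K_hull)
    have "\<sigma> (\<alpha> i) \<in> K" if "i < d" for i
    proof -
      have "poly C (\<sigma> (\<alpha> i)) = \<sigma> (poly C (\<alpha> i))"
        using Ints_le_Rats_polys[OF C_int] \<alpha>_K[OF that] by (simp add: hom_poly)
      also have "\<dots> = 0"
        using that poly_C_eq_0_iff[of "\<alpha> i"] hom_zero by simp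
      finally show ?thesis
        using \<alpha>_K by (auto simp: poly_C_eq_0_iff)
    qed
    then show "\<alpha> ` {..<d} \<subseteq> {x \<in> K. \<sigma> x \<in> K}"
      using \<alpha>_K by auto
    show "complex_subfield {x \<in> K. \<sigma> x \<in> K}"
      using K_subfield unfolding complex_subfield_def
      by (auto simp: hom_zero hom_one hom_add hom_mult hom_uminus hom_inverse)
  qed
  then have "\<sigma> x \<in> K" if "x \<in> K" for x
    using that by blast
  moreover have "\<sigma> x = x" if "x \<notin> K" for x
    using that by (simp add: \<sigma>_def)
  ultimately have "\<sigma> \<in> Gal"
    by (intro GalI hom)
  moreover have "\<sigma> \<theta> = z"
    using \<sigma>[of "[:0, 1:]"] by (auto simp: Q.pCons_polys_over QX.zero_mem)
  ultimately show ?thesis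
    by blast
qed

lemma Gal_bij: "bij_betw (\<lambda>\<sigma>. \<sigma> \<theta>) Gal {z. poly mp z = 0}"
  unfolding bij_betw_def inj_on_def using Gal_eqI Gal_root ex_Gal by (auto simp: image_iff) metis

lemma card_Gal: "card Gal = m"
  using bij_betw_same_card[OF Gal_bij] card_roots_minimal_poly[OF complex_subfield_Rats_self mp]
  by (simp add: m_def)

lemma finite_Gal: "finite Gal"
  using card_Gal m_pos card_ge_0_finite by force

lemma id_Gal: "id \<in> Gal"
  by (auto simp: Gal_def subfield_hom_def K_subfield)

lemma Gal_comp:
  assumes "\<sigma> \<in> Gal" "\<tau> \<in> Gal"
  shows "\<sigma> \<circ> \<tau> \<in> Gal"
proof -
  interpret s: subfield_hom K \<sigma>
    using assms by (intro Gal_hom)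
  interpret t: subfield_hom K \<tau>
    using assms by (intro Gal_hom)
  have "subfield_hom K (\<sigma> \<circ> \<tau>)"
    by unfold_locales
      (auto simp: K_subfield s.hom_one t.hom_one s.hom_add t.hom_add s.hom_mult t.hom_mult Gal_K[OF assms(2)])
  then show ?thesis
    by (rule GalI) (simp_all add: Gal_K[OF assms(1)] Gal_K[OF assms(2)] Gal_outside[OF assms(1)]
        Gal_outside[OF assms(2)])
qed

lemma Gal_inj:
  assumes "\<sigma> \<in> Gal"
  shows "inj \<sigma>"
proof (rule injI)
  fix x y assume "\<sigma> x = \<sigma> y"
  then show "x = y"
    using inj_onD[OF subfield_hom.hom_inj[OF Gal_hom[OF assms]]] Gal_K[OF assms] Gal_outside[OF assms]
    by metis
qed

lemma Gal_funpow_eq_id: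
  assumes "\<sigma> \<in> Gal" "m dvd t"
  shows "\<sigma> ^^ t = id"
proof -
  \<comment> \<open>The multiplication is reversed composition: finiteness yields right inverses, and the group
    axioms ask for left inverses.\<close>
  define G where "G = \<lparr>carrier = Gal, mult = (\<lambda>\<sigma> \<tau>. \<tau> \<circ> \<sigma>), one = (id :: complex \<Rightarrow> complex)\<rparr>"
  interpret G: group G
  proof (rule groupI)
    fix \<sigma> assume "\<sigma> \<in> carrier G"
    then have \<sigma>: "\<sigma> \<in> Gal"
      by (simp add: G_def)
    have "inj_on (\<lambda>\<tau>. \<sigma> \<circ> \<tau>) Gal"
      using Gal_inj[OF \<sigma>] by (auto simp: inj_on_def fun_eq_iff)
    then have "(\<lambda>\<tau>. \<sigma> \<circ> \<tau>) ` Gal = Gal"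
      using Gal_comp[OF \<sigma>] finite_Gal by (intro endo_inj_surj) auto
    then obtain \<tau> where "\<tau> \<in> Gal" "\<sigma> \<circ> \<tau> = id"
      using id_Gal by (metis imageE)
    then show "\<exists>\<tau>\<in>carrier G. \<tau> \<otimes>\<^bsub>G\<^esub> \<sigma> = \<one>\<^bsub>G\<^esub>"
      by (auto simp: G_def)
  qed (auto simp: G_def Gal_comp id_Gal o_assoc)
  have pow: "\<sigma> [^]\<^bsub>G\<^esub> n = \<sigma> ^^ n" for n :: nat
    by (induction n) (auto simp: G_def nat_pow_def)
  have "\<sigma> ^^ m = id"
    using G.pow_order_eq_1[of \<sigma>] assms(1) card_Gal unfolding pow by (simp add: G_def Coset.order_def)
  moreover obtain s where "t = m * s"
    using assms(2) by (elim dvdE)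
  then have "\<sigma> ^^ t = (\<sigma> ^^ m) ^^ s"
    by (simp add: funpow_mult)
  ultimately show ?thesis
    by simp
qed

end

section \<open>Traces and the discriminant\<close>

text \<open>The hypothesis \<open>eig\<close> says that the rows of \<open>P\<close> are left
  eigenvectors of \<open>N\<close>. Thus \<open>P\<close> intertwines \<open>y - N\<close> with the
  diagonal matrix of the \<open>y - \<phi> k\<close>, and \<open>det P\<close> cancels. Cancelling
  makes sense over any integral domain, which admits matrices of polynomials later on.\<close>

lemma det_shift_eq_prod:
  fixes P N :: "'a::idom mat" and y :: 'a and \<phi> :: "nat \<Rightarrow> 'a"
  assumes P: "P \<in> carrier_mat n n" "det P \<noteq> 0" and N: "N \<in> carrier_mat n n"
    and eig: "\<And>k j. k < n \<Longrightarrow> j < n \<Longrightarrow> \<phi> k * P $$ (k, j) = (\<Sum>i<n. P $$ (k, i) * N $$ (i, j))"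
  shows "det (y \<cdot>\<^sub>m 1\<^sub>m n - N) = (\<Prod>k<n. y - \<phi> k)"
proof -
  define E where "E = mat n n (\<lambda>(i, j). if i = j then y - \<phi> i else 0)"
  have E: "E \<in> carrier_mat n n"
    by (simp add: E_def)
  have yN: "y \<cdot>\<^sub>m 1\<^sub>m n - N \<in> carrier_mat n n"
    using N by (rule minus_carrier_mat)
  have "P * (y \<cdot>\<^sub>m 1\<^sub>m n - N) = E * P"
  proof (rule eq_matI)
    fix k j assume "k < dim_row (E * P)" "j < dim_col (E * P)"
    then have kj: "k < n" "j < n"
      using E P by auto
    have "(P * (y \<cdot>\<^sub>m 1\<^sub>m n - N)) $$ (k, j) =
        (\<Sum>i<n. (if i = j then y * P $$ (k, i) else 0) - P $$ (k, i) * N $$ (i, j))"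
      using P N kj by (auto simp: scalar_prod_def atLeast0LessThan algebra_simps intro!: sum.cong)
    also have "\<dots> = y * P $$ (k, j) - \<phi> k * P $$ (k, j)"
      unfolding sum_subtractf eig[OF kj] using kj by simp
    also have "\<dots> = (\<Sum>i<n. if k = i then (y - \<phi> k) * P $$ (i, j) else 0)"
      using kj by (simp add: algebra_simps)
    also have "\<dots> = (\<Sum>i<n. (if k = i then y - \<phi> k else 0) * P $$ (i, j))"
      by (intro sum.cong) auto
    also have "\<dots> = (E * P) $$ (k, j)"
      using P kj by (simp add: E_def scalar_prod_def atLeast0LessThan)
    finally show "(P * (y \<cdot>\<^sub>m 1\<^sub>m n - N)) $$ (k, j) = (E * P) $$ (k, j)" .
  qed (use P N E in auto)
  then have "det P * det (y \<cdot>\<^sub>m 1\<^sub>m n - N) = det E * det P"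
    unfolding det_mult[OF P(1) yN, symmetric] det_mult[OF E P(1), symmetric] by (rule arg_cong)
  moreover have "det E = (\<Prod>k<n. y - \<phi> k)"
  proof -
    have "det E = prod_list (diag_mat E)"
      by (rule det_upper_triangular[OF _ E]) (auto simp: E_def upper_triangular_def)
    also have "\<dots> = (\<Prod>k<n. y - \<phi> k)"
      by (auto simp: diag_mat_def E_def atLeast0LessThan simp flip: prod.distinct_set_conv_list intro!: prod.cong)
    finally show ?thesis .
  qed
  ultimately show ?thesis
    using P(2) by simp
qed

text \<open>With \<open>W\<close> inverse to \<open>P\<close>, the matrix \<open>N\<close> is
  \<open>W * diag \<phi> * P\<close>, and cyclicity of the trace removes \<open>W\<close> and
  \<open>P\<close>.\<close>

lemma trace_eq_sum_eigenvalues: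
  fixes P :: "'a::field mat" and N :: "nat \<Rightarrow> nat \<Rightarrow> 'a" and \<phi> :: "nat \<Rightarrow> 'a"
  assumes P: "P \<in> carrier_mat n n" "det P \<noteq> 0"
    and eig: "\<And>k j. k < n \<Longrightarrow> j < n \<Longrightarrow> \<phi> k * P $$ (k, j) = (\<Sum>i<n. P $$ (k, i) * N i j)"
  shows "(\<Sum>i<n. N i i) = (\<Sum>k<n. \<phi> k)"
proof -
  define W where "W = inverse (det P) \<cdot>\<^sub>m adj_mat P"
  have W: "W \<in> carrier_mat n n"
    using adj_mat(1)[OF P(1)] by (simp add: W_def)
  have "W * P = 1\<^sub>m n" "P * W = 1\<^sub>m n"
    unfolding W_def using adj_mat[OF P(1)] P
    by (auto simp: mult_smult_distrib[of P n n] mult_smult_assoc_mat[of _ n n])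
  then have WP: "(\<Sum>k<n. W $$ (l, k) * P $$ (k, i)) = (if l = i then 1 else 0)"
    and PW: "(\<Sum>k<n. P $$ (l, k) * W $$ (k, i)) = (if l = i then 1 else 0)" if "l < n" "i < n" for l i
    using that W P(1)
    by (auto dest!: arg_cong[where f = "\<lambda>A. A $$ (l, i)"] simp: scalar_prod_def atLeast0LessThan)
  have N: "N l j = (\<Sum>k<n. W $$ (l, k) * (\<phi> k * P $$ (k, j)))" if "l < n" "j < n" for l j
  proof -
    have "(\<Sum>k<n. W $$ (l, k) * (\<phi> k * P $$ (k, j))) =
        (\<Sum>k<n. \<Sum>i<n. W $$ (l, k) * P $$ (k, i) * N i j)"
      using that by (intro sum.cong) (auto simp: eig sum_distrib_left mult_ac)
    also have "\<dots> = (\<Sum>i<n. (\<Sum>k<n. W $$ (l, k) * P $$ (k, i)) * N i j)"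
      by (subst sum.swap) (simp add: sum_distrib_right)
    also have "\<dots> = (\<Sum>i<n. if l = i then N i j else 0)"
      using that by (intro sum.cong) (auto simp: WP)
    finally show ?thesis
      using that by simp
  qed
  have "(\<Sum>i<n. N i i) = (\<Sum>i<n. \<Sum>k<n. W $$ (i, k) * (\<phi> k * P $$ (k, i)))"
    by (intro sum.cong) (auto simp: N)
  also have "\<dots> = (\<Sum>k<n. \<phi> k * (\<Sum>i<n. P $$ (k, i) * W $$ (i, k)))"
    by (subst sum.swap) (simp add: sum_distrib_left mult_ac)
  also have "\<dots> = (\<Sum>k<n. \<phi> k)"
    by (intro sum.cong) (auto simp: PW)
  finally show ?thesis .
qed

context splitting_field
begin

definition gal :: "nat \<Rightarrow> complex \<Rightarrow> complex" where
  "gal = (SOME f. bij_betw f {..<m} Gal)"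

lemma bij_gal: "bij_betw gal {..<m} Gal"
proof -
  have "\<exists>h. bij_betw h {..<m} Gal"
    using ex_bij_betw_nat_finite[OF finite_Gal] by (simp add: card_Gal atLeast0LessThan)
  then show ?thesis
    unfolding gal_def by (rule someI_ex)
qed

lemma gal_Gal: "k < m \<Longrightarrow> gal k \<in> Gal"
  using bij_gal by (auto simp: bij_betw_def)

lemma ex_gal: "\<sigma> \<in> Gal \<Longrightarrow> \<exists>k<m. gal k = \<sigma>"
  using bij_betw_imp_surj_on[OF bij_gal] by (metis imageE lessThan_iff)

lemma gal_hom: "k < m \<Longrightarrow> subfield_hom K (gal k)"
  by (intro Gal_hom gal_Gal)

lemma gal_K: "k < m \<Longrightarrow> x \<in> K \<Longrightarrow> gal k x \<in> K"
  by (rule Gal_K[OF gal_Gal])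

lemma gal_inj_\<theta>: "k < m \<Longrightarrow> l < m \<Longrightarrow> gal k \<theta> = gal l \<theta> \<Longrightarrow> k = l"
  using bij_gal Gal_eqI[OF gal_Gal gal_Gal, of k l] by (auto simp: bij_betw_def inj_on_def)

abbreviation O_K :: "complex set" where
  "O_K \<equiv> ring_of_integers K"

lemma O_K_iff: "x \<in> O_K \<longleftrightarrow> x \<in> K \<and> algebraic_int x"
  by (simp add: ring_of_integers_def)

sublocale O_K: comm_subring O_K
proof -
  have "O_K = K \<inter> {x. algebraic_int x}"
    by (auto simp: O_K_iff)
  then show "comm_subring O_K"
    using comm_subring_Int[OF K.comm_subring_axioms comm_subring_algebraic_ints] by simp
qed

lemma O_K_Rats: "x \<in> O_K \<Longrightarrow> x \<in> \<rat> \<Longrightarrow> x \<in> \<int>"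
  by (auto simp: O_K_iff rational_algebraic_int_is_int)

lemma gal_O_K: "k < m \<Longrightarrow> x \<in> O_K \<Longrightarrow> gal k x \<in> O_K"
  using gal_K subfield_hom.hom_algebraic_int[OF gal_hom] by (auto simp: O_K_iff)

text \<open>The index range has the size of the degree \<open>m\<close>, so such a family is a basis
  of \<open>K\<close> over the rationals; the form independence takes below is
  \<open>det_conj_mat\<close>.\<close>

definition spanning :: "(nat \<Rightarrow> complex) \<Rightarrow> bool" where
  "spanning w \<longleftrightarrow> (\<forall>i<m. w i \<in> K) \<and> (\<forall>x\<in>K. \<exists>q::nat \<Rightarrow> rat. x = (\<Sum>i<m. of_rat (q i) * w i))"

lemma spanning_K: "spanning w \<Longrightarrow> i < m \<Longrightarrow> w i \<in> K"
  by (simp add: spanning_def)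

lemma spanning_combination:
  "spanning w \<Longrightarrow> x \<in> K \<Longrightarrow> \<exists>q::nat \<Rightarrow> rat. x = (\<Sum>i<m. of_rat (q i) * w i)"
  by (simp add: spanning_def)

lemma spanning_powers: "spanning (\<lambda>i. \<theta> ^ i)"
  unfolding spanning_def using K.power_mem[OF \<theta>_K] K_power_combination by metis

definition conj_mat :: "(nat \<Rightarrow> complex) \<Rightarrow> complex mat" where
  "conj_mat w = mat m m (\<lambda>(k, i). gal k (w i))"

lemma conj_mat_carrier: "conj_mat w \<in> carrier_mat m m"
  by (simp add: conj_mat_def)

lemma conj_mat_index: "k < m \<Longrightarrow> i < m \<Longrightarrow> conj_mat w $$ (k, i) = gal k (w i)"
  by (simp add: conj_mat_def)

lemma of_rat_K: "of_rat q \<in> K"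
  using complex_subfield_Rats[OF K_subfield] by auto

lemma gal_rat_combination:
  assumes "k < m" "\<And>i. i \<in> I \<Longrightarrow> w i \<in> K"
  shows "gal k (\<Sum>i\<in>I. of_rat (q i) * w i) = (\<Sum>i\<in>I. of_rat (q i) * gal k (w i))"
proof -
  interpret subfield_hom K "gal k"
    using assms(1) by (rule gal_hom)
  show ?thesis
    using assms(2) by (simp add: hom_sum hom_mult of_rat_K hom_Rats K.mult_mem)
qed

text \<open>Independence of automorphisms: a linear relation between the rows holds on the spanning
  family, hence on all of \<open>K\<close>, in particular on the powers of \<open>\<theta>\<close>.
  By linearity it then holds for the values of every complex polynomial at the conjugates of
  \<open>\<theta>\<close>. A polynomial vanishing at all conjugates but one isolates a nonzero
  coefficient of the relation.\<close>

lemma det_conj_mat: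
  assumes w: "spanning w"
  shows "det (conj_mat w) \<noteq> 0"
proof
  assume "det (conj_mat w) = 0"
  then have "det (transpose_mat (conj_mat w)) = 0"
    using det_transpose[OF conj_mat_carrier] by simp
  moreover have "transpose_mat (conj_mat w) \<in> carrier_mat m m"
    using conj_mat_carrier by simp
  ultimately obtain v where v: "v \<in> carrier_vec m" "v \<noteq> 0\<^sub>v m" "transpose_mat (conj_mat w) *\<^sub>v v = 0\<^sub>v m"
    using det_0_iff_vec_prod_zero_field by blast
  have row: "(\<Sum>k<m. v $ k * gal k (w i)) = 0" if "i < m" for i
  proof -
    have "(transpose_mat (conj_mat w) *\<^sub>v v) $ i = 0"
      using v(3) that by simp
    then show ?thesis
      using that v(1) conj_mat_carrier[of w]
      by (simp add: scalar_prod_def atLeast0LessThan conj_mat_index mult.commute)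
  qed
  have all: "(\<Sum>k<m. v $ k * gal k x) = 0" if x: "x \<in> K" for x
  proof -
    obtain q where q: "x = (\<Sum>i<m. of_rat (q i) * w i)"
      using spanning_combination[OF w x] ..
    have "gal k x = (\<Sum>i<m. of_rat (q i) * gal k (w i))" if "k < m" for k
      unfolding q using spanning_K[OF w] that by (intro gal_rat_combination) auto
    then have "(\<Sum>k<m. v $ k * gal k x) = (\<Sum>k<m. \<Sum>i<m. of_rat (q i) * (v $ k * gal k (w i)))"
      by (intro sum.cong) (simp_all add: sum_distrib_left mult.left_commute)
    also have "\<dots> = (\<Sum>i<m. of_rat (q i) * (\<Sum>k<m. v $ k * gal k (w i)))"
      by (subst sum.swap) (simp add: sum_distrib_left)
    also have "\<dots> = 0"
      by (simp add: row)
    finally show ?thesis .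
  qed
  have poly0: "(\<Sum>k<m. v $ k * poly h (gal k \<theta>)) = 0" for h
  proof -
    have "(\<Sum>k<m. v $ k * poly h (gal k \<theta>)) =
        (\<Sum>k<m. \<Sum>i\<le>degree h. coeff h i * (v $ k * gal k (\<theta> ^ i)))"
      by (intro sum.cong)
        (auto simp: poly_altdef sum_distrib_left mult_ac subfield_hom.hom_power[OF gal_hom _] \<theta>_K)
    also have "\<dots> = (\<Sum>i\<le>degree h. coeff h i * (\<Sum>k<m. v $ k * gal k (\<theta> ^ i)))"
      by (subst sum.swap) (simp add: sum_distrib_left)
    also have "\<dots> = 0"
      using all[OF K.power_mem[OF \<theta>_K]] by simp
    finally show ?thesis .
  qed
  obtain k where k: "k < m" "v $ k \<noteq> 0"
    using v(1,2) by (metis carrier_vecD eq_vecI index_zero_vec)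
  define h where "h = (\<Prod>l\<in>{..<m} - {k}. [:- gal l \<theta>, 1:])"
  have h: "poly h (gal l \<theta>) = 0" if "l < m" "l \<noteq> k" for l
    using that by (auto simp: h_def poly_prod)
  have "poly h (gal k \<theta>) \<noteq> 0"
    using k gal_inj_\<theta> by (auto simp: h_def poly_prod)
  moreover have "(\<Sum>l<m. v $ l * poly h (gal l \<theta>)) = v $ k * poly h (gal k \<theta>)"
    using k h by (subst sum.remove[of _ k]) auto
  ultimately show False
    using poly0[of h] k by simp
qed

section \<open>The trace as a sum of conjugates\<close>

definition Tr :: "complex \<Rightarrow> complex" where
  "Tr x = (\<Sum>k<m. gal k x)"

text \<open>Row \<open>k\<close> of \<open>conj_mat w\<close> is a left eigenvector of
  multiplication by \<open>x\<close>, with eigenvalue \<open>gal k x\<close>.\<close>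

lemma Tr_eq_matrix_trace:
  assumes w: "spanning w" and x: "x \<in> K"
    and M: "\<And>j. j < m \<Longrightarrow> x * w j = (\<Sum>i<m. of_rat (M i j) * w i)"
  shows "Tr x = of_rat (\<Sum>i<m. M i i)"
proof -
  have "(\<Sum>i<m. of_rat (M i i)) = (\<Sum>k<m. gal k x)"
  proof (rule trace_eq_sum_eigenvalues[OF conj_mat_carrier det_conj_mat[OF w],
        where N = "\<lambda>i j. of_rat (M i j)" and \<phi> = "\<lambda>k. gal k x"])
    fix k j assume kj: "k < m" "j < m"
    have "gal k x * conj_mat w $$ (k, j) = gal k (x * w j)"
      using kj x w by (simp add: conj_mat_index subfield_hom.hom_mult[OF gal_hom] spanning_K)
    also have "\<dots> = (\<Sum>i<m. of_rat (M i j) * gal k (w i))"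
      unfolding M[OF kj(2)] using kj spanning_K[OF w] by (intro gal_rat_combination) auto
    also have "\<dots> = (\<Sum>i<m. conj_mat w $$ (k, i) * of_rat (M i j))"
      using kj by (intro sum.cong) (auto simp: conj_mat_index)
    finally show "gal k x * conj_mat w $$ (k, j) = (\<Sum>i<m. conj_mat w $$ (k, i) * of_rat (M i j))" .
  qed
  then show ?thesis
    by (simp add: Tr_def of_rat_sum)
qed

lemma spanning_coordinates:
  assumes w: "spanning w" and x: "x \<in> K"
  obtains M :: "nat \<Rightarrow> nat \<Rightarrow> rat" where "\<And>j. j < m \<Longrightarrow> x * w j = (\<Sum>i<m. of_rat (M i j) * w i)"
proof -
  have "\<exists>q::nat \<Rightarrow> rat. x * w j = (\<Sum>i<m. of_rat (q i) * w i)" if "j < m" for j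
    by (rule spanning_combination[OF w K.mult_mem[OF x spanning_K[OF w that]]])
  then obtain M :: "nat \<Rightarrow> nat \<Rightarrow> rat" where "\<And>j. j < m \<Longrightarrow> x * w j = (\<Sum>i<m. of_rat (M j i) * w i)"
    by metis
  then show ?thesis
    using that[of "\<lambda>i j. M j i"] by simp
qed

lemma Tr_Rats:
  assumes "x \<in> K"
  shows "Tr x \<in> \<rat>"
proof -
  obtain M :: "nat \<Rightarrow> nat \<Rightarrow> rat" where
    "\<And>j. j < m \<Longrightarrow> x * \<theta> ^ j = (\<Sum>i<m. of_rat (M i j) * \<theta> ^ i)"
    using spanning_coordinates[OF spanning_powers assms] by blast
  then have "Tr x = of_rat (\<Sum>i<m. M i i)"
    by (rule Tr_eq_matrix_trace[OF spanning_powers assms])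
  then show ?thesis
    by simp
qed

lemma Tr_O_K: "x \<in> O_K \<Longrightarrow> Tr x \<in> O_K"
  unfolding Tr_def using gal_O_K by (intro O_K.sum_mem) auto

lemma Tr_Ints: "x \<in> O_K \<Longrightarrow> Tr x \<in> \<int>"
  using Tr_O_K Tr_Rats O_K_Rats by (auto simp: O_K_iff)

lemma Tr_rat_combination:
  assumes "\<And>i. i \<in> I \<Longrightarrow> w i \<in> K"
  shows "Tr (\<Sum>i\<in>I. of_rat (q i) * w i) = (\<Sum>i\<in>I. of_rat (q i) * Tr (w i))"
proof -
  have "Tr (\<Sum>i\<in>I. of_rat (q i) * w i) = (\<Sum>k<m. \<Sum>i\<in>I. of_rat (q i) * gal k (w i))"
    unfolding Tr_def using assms by (intro sum.cong) (auto simp: gal_rat_combination)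
  then show ?thesis
    by (subst (asm) sum.swap) (simp add: Tr_def sum_distrib_left)
qed

text \<open>A fixed element is the average of its conjugates, that is, \<open>Tr x / m\<close>, and
  traces are rational as traces of rational matrices.\<close>

lemma Gal_fixed_Rats:
  assumes "x \<in> K" "\<And>\<sigma>. \<sigma> \<in> Gal \<Longrightarrow> \<sigma> x = x"
  shows "x \<in> \<rat>"
proof -
  have "of_nat m * x = Tr x"
    using assms(2)[OF gal_Gal] by (simp add: Tr_def)
  then have "x = Tr x / of_nat m"
    using m_pos by (simp add: field_simps)
  then show ?thesis
    using Tr_Rats[OF assms(1)] by (metis Rats_divide Rats_of_nat)
qed

lemma rat_basis_spanning:
  assumes B: "rat_vs.independent B" "rat_vs.span B = K"
  shows "finite B" "card B = m" and "bij_betw w {..<m} B \<Longrightarrow> spanning w"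
proof -
  have "rat_vs.dim K = card B"
    by (rule rat_vs.dim_eq_card[OF _ B(1)]) (simp only: B(2)[symmetric] rat_vs.span_span)
  then show card: "card B = m"
    by (simp add: dim_K)
  then show fin: "finite B"
    using m_pos card_ge_0_finite by force
  assume w: "bij_betw w {..<m} B"
  have "\<exists>q::nat \<Rightarrow> rat. x = (\<Sum>i<m. of_rat (q i) * w i)" if "x \<in> K" for x
  proof -
    have "x \<in> range (\<lambda>u. \<Sum>b\<in>B. of_rat (u b) * b)"
      using B(2) that rat_vs.span_finite[OF fin] by simp
    then obtain u where "x = (\<Sum>b\<in>B. of_rat (u b) * b)"
      by (rule rangeE)
    also have "\<dots> = (\<Sum>i<m. of_rat (u (w i)) * w i)"
      by (rule sum.reindex_bij_betw[OF w, symmetric])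
    finally show ?thesis
      by (intro exI[of _ "\<lambda>i. u (w i)"])
  qed
  moreover have "w i \<in> K" if "i < m" for i
    using w that B(2) rat_vs.span_base[of "w i" B] by (auto simp: bij_betw_def)
  ultimately show "spanning w"
    by (simp add: spanning_def)
qed

text \<open>\<open>field_trace\<close> refers to a basis chosen arbitrarily. Whichever basis it is,
  its conjugate matrix diagonalises multiplication by \<open>x\<close>.\<close>

lemma field_trace_eq_Tr:
  assumes x: "x \<in> K"
  shows "of_rat (field_trace K x) = Tr x"
proof -
  define B where "B = (SOME B. rat_vs.independent B \<and> rat_vs.span B = K)"
  have B: "rat_vs.independent B" "rat_vs.span B = K"
    using someI[of "\<lambda>B. rat_vs.independent B \<and> rat_vs.span B = K" "(\<lambda>i. \<theta> ^ i) ` {..<m}"]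
      rat_independent_powers rat_span_powers unfolding B_def by auto
  obtain w where w: "bij_betw w {..<m} B"
    using ex_bij_betw_nat_finite[OF rat_basis_spanning(1)[OF B]] rat_basis_spanning(2)[OF B]
    by (metis atLeast0LessThan)
  have "Tr x = of_rat (\<Sum>i<m. rat_vs.representation B (x * w i) (w i))"
  proof (rule Tr_eq_matrix_trace[OF rat_basis_spanning(3)[OF B w] x,
        where M = "\<lambda>i j. rat_vs.representation B (x * w j) (w i)"])
    fix j assume j: "j < m"
    have "x * w j \<in> rat_vs.span B"
      unfolding B(2) using spanning_K[OF rat_basis_spanning(3)[OF B w] j] x by (intro K.mult_mem)
    then have "x * w j = (\<Sum>b\<in>B. of_rat (rat_vs.representation B (x * w j) b) * b)"
      using rat_vs.sum_representation_eq[OF B(1) _ rat_basis_spanning(1)[OF B] order_refl] by simp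
    also have "\<dots> = (\<Sum>i<m. of_rat (rat_vs.representation B (x * w j) (w i)) * w i)"
      by (rule sum.reindex_bij_betw[OF w, symmetric])
    finally show "x * w j = (\<Sum>i<m. of_rat (rat_vs.representation B (x * w j) (w i)) * w i)" .
  qed
  also have "(\<Sum>i<m. rat_vs.representation B (x * w i) (w i)) =
      (\<Sum>b\<in>B. rat_vs.representation B (x * b) b)"
    by (rule sum.reindex_bij_betw[OF w])
  also have "\<dots> = field_trace K x"
    by (simp add: field_trace_def B_def Let_def)
  finally show ?thesis ..
qed

text \<open>For \<open>w\<close> in \<open>O_K\<close> the traces are integers, and the floor of the
  real part is merely the cast to \<open>int\<close>. With integer entries, the determinant and the
  adjugate can be examined for divisibility by \<open>p\<close>.\<close>

definition trace_form :: "(nat \<Rightarrow> complex) \<Rightarrow> int mat" where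
  "trace_form w = mat m m (\<lambda>(i, j). \<lfloor>Re (Tr (w i * w j))\<rfloor>)"

lemma trace_form_carrier: "trace_form w \<in> carrier_mat m m"
  by (simp add: trace_form_def)

lemma trace_form_index:
  assumes "\<And>i. i < m \<Longrightarrow> w i \<in> O_K" "i < m" "j < m"
  shows "of_int (trace_form w $$ (i, j)) = Tr (w i * w j)"
proof -
  have "Tr (w i * w j) \<in> \<int>"
    using assms by (intro Tr_Ints O_K.mult_mem)
  then show ?thesis
    using assms by (auto simp: trace_form_def elim!: Ints_cases)
qed

text \<open>The trace form is \<open>S^T * S\<close> for the conjugate matrix
  \<open>S\<close>.\<close>

lemma det_trace_form:
  assumes w: "\<And>i. i < m \<Longrightarrow> w i \<in> O_K"
  shows "of_int (det (trace_form w)) = det (conj_mat w) ^ 2"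
proof -
  let ?S = "conj_mat w"
  have "map_mat of_int (trace_form w) = transpose_mat ?S * ?S"
  proof (rule eq_matI)
    fix i j assume "i < dim_row (transpose_mat ?S * ?S)" "j < dim_col (transpose_mat ?S * ?S)"
    then have ij: "i < m" "j < m"
      using conj_mat_carrier[of w] by auto
    have "(transpose_mat ?S * ?S) $$ (i, j) = (\<Sum>k<m. gal k (w i) * gal k (w j))"
      using ij conj_mat_carrier[of w] by (simp add: scalar_prod_def atLeast0LessThan conj_mat_index)
    also have "\<dots> = Tr (w i * w j)"
      unfolding Tr_def using ij w
      by (intro sum.cong) (auto simp: subfield_hom.hom_mult[OF gal_hom] O_K_iff)
    finally show "map_mat of_int (trace_form w) $$ (i, j) = (transpose_mat ?S * ?S) $$ (i, j)"
      using ij w trace_form_carrier[of w] by (simp add: trace_form_index)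
  qed (use conj_mat_carrier[of w] trace_form_carrier[of w] in auto)
  then have "det (map_mat of_int (trace_form w)) = det (transpose_mat ?S) * det ?S"
    using det_mult[of "transpose_mat ?S" m ?S] conj_mat_carrier[of w] by simp
  then show ?thesis
    using det_transpose[OF conj_mat_carrier] by (simp add: of_int_hom.hom_det power2_eq_square)
qed

lemma det_trace_form_nonzero:
  assumes "\<And>i. i < m \<Longrightarrow> w i \<in> O_K" "spanning w"
  shows "det (trace_form w) \<noteq> 0"
  using det_trace_form[OF assms(1)] det_conj_mat[OF assms(2)] by fastforce

text \<open>Cramer's rule for the linear system that the traces \<open>Tr (x * w j)\<close> impose
  on the coordinates of \<open>x\<close>. It serves twice: to bound the denominators of algebraic
  integers, and to show that coordinates are divisible by \<open>p\<close>.\<close>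

lemma trace_form_coordinate:
  fixes q :: "nat \<Rightarrow> rat"
  assumes w: "\<And>i. i < m \<Longrightarrow> w i \<in> O_K" and x: "x = (\<Sum>i<m. of_rat (q i) * w i)" and l: "l < m"
  shows "of_int (det (trace_form w)) * of_rat (q l) =
    (\<Sum>j<m. Tr (x * w j) * of_int (adj_mat (trace_form w) $$ (j, l)))"
proof -
  let ?T = "trace_form w"
  have T: "?T \<in> carrier_mat m m"
    by (rule trace_form_carrier)
  have "(\<Sum>j<m. ?T $$ (i, j) * adj_mat ?T $$ (j, l)) = (if i = l then det ?T else 0)" if "i < m" for i
    using arg_cong[OF adj_mat(2)[OF T], of "\<lambda>A. A $$ (i, l)"] adj_mat(1)[OF T] T that l
    by (auto simp: scalar_prod_def atLeast0LessThan)
  then have T_adj: "(\<Sum>j<m. of_int (?T $$ (i, j)) * of_int (adj_mat ?T $$ (j, l)) :: complex) =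
      (if i = l then of_int (det ?T) else 0)" if "i < m" for i
    using that by (simp flip: of_int_mult of_int_sum)
  have Trx: "Tr (x * w j) = (\<Sum>i<m. of_rat (q i) * of_int (?T $$ (i, j)))" if "j < m" for j
  proof -
    have "x * w j = (\<Sum>i<m. of_rat (q i) * (w i * w j))"
      unfolding x by (simp add: sum_distrib_right mult.assoc)
    then have "Tr (x * w j) = (\<Sum>i<m. of_rat (q i) * Tr (w i * w j))"
      using Tr_rat_combination[of "{..<m}" "\<lambda>i. w i * w j" q] w that K.mult_mem by (auto simp: O_K_iff)
    then show ?thesis
      using w that by (simp add: trace_form_index)
  qed
  have "(\<Sum>j<m. Tr (x * w j) * of_int (adj_mat ?T $$ (j, l))) =
      (\<Sum>j<m. \<Sum>i<m. of_rat (q i) * (of_int (?T $$ (i, j)) * of_int (adj_mat ?T $$ (j, l))))"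
    by (intro sum.cong) (auto simp: Trx sum_distrib_right mult.assoc)
  also have "\<dots> = (\<Sum>i<m. of_rat (q i) * (\<Sum>j<m. of_int (?T $$ (i, j)) * of_int (adj_mat ?T $$ (j, l))))"
    by (subst sum.swap) (simp add: sum_distrib_left)
  also have "\<dots> = (\<Sum>i<m. if i = l then of_rat (q i) * of_int (det ?T) else 0)"
    by (intro sum.cong) (auto simp: T_adj)
  finally show ?thesis
    using l by simp
qed

end

section \<open>Integral bases\<close>

lemma int_subgroup_generator:
  fixes A :: "int set"
  assumes "0 \<in> A" and "\<And>x y. x \<in> A \<Longrightarrow> y \<in> A \<Longrightarrow> x - y \<in> A" and "\<And>k x. x \<in> A \<Longrightarrow> k * x \<in> A"
  obtains a where "a \<in> A" "\<And>x. x \<in> A \<Longrightarrow> a dvd x"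
proof (cases "A = {0}")
  case True
  then show ?thesis
    using that by auto
next
  case False
  then obtain y where y: "y \<in> A" "y \<noteq> 0"
    using assms(1) by blast
  have "\<exists>n::nat. n > 0 \<and> int n \<in> A"
    using y assms(3)[of y "-1"] by (intro exI[of _ "nat \<bar>y\<bar>"]) (auto simp: abs_if)
  define n where "n = (LEAST n::nat. n > 0 \<and> int n \<in> A)"
  have n: "n > 0" "int n \<in> A"
    using LeastI_ex[OF \<open>\<exists>n::nat. n > 0 \<and> int n \<in> A\<close>] unfolding n_def by auto
  have min: "n \<le> k" if "k > 0" "int k \<in> A" for k
    unfolding n_def using that by (intro Least_le) auto
  have "int n dvd x" if x: "x \<in> A" for x
  proof (rule ccontr)
    assume "\<not> int n dvd x"
    then have pos: "x mod int n > 0"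
      using n(1) by (metis dvd_eq_mod_eq_0 le_less of_nat_0_less_iff pos_mod_sign)
    have "x mod int n = x - (x div int n) * int n"
      by (simp add: minus_div_mult_eq_mod)
    also have "\<dots> \<in> A"
      using x n assms by blast
    finally have "int (nat (x mod int n)) \<in> A"
      using pos by simp
    then have "n \<le> nat (x mod int n)"
      using pos by (intro min) auto
    moreover have "x mod int n < int n"
      using n(1) by simp
    ultimately show False
      using pos by linarith
  qed
  then show ?thesis
    using that n(2) by blast
qed

lemma int_independent_insert_coeff:
  assumes W: "finite W" "w \<notin> W" "int_mod.independent (insert w W)"
    and y: "y \<in> int_mod.span W" and eq: "of_int c * w + y = 0"
  shows "c = 0"
proof (rule ccontr)
  assume "c \<noteq> 0"
  have "y \<in> range (\<lambda>u. \<Sum>v\<in>W. of_int (u v) * v)"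
    using y int_mod.span_finite[OF W(1)] by simp
  then obtain u where u: "y = (\<Sum>v\<in>W. of_int (u v) * v)"
    by (rule rangeE)
  have "(\<Sum>v\<in>insert w W. of_int ((u(w := c)) v) * v) = of_int c * w + (\<Sum>v\<in>W. of_int ((u(w := c)) v) * v)"
    using W by simp
  also have "(\<Sum>v\<in>W. of_int ((u(w := c)) v) * v) = y"
    unfolding u using W by (intro sum.cong) auto
  finally have "(\<Sum>v\<in>insert w W. of_int ((u(w := c)) v) * v) = 0"
    using eq by simp
  moreover have "\<exists>v\<in>insert w W. (u(w := c)) v \<noteq> 0"
    using \<open>c \<noteq> 0\<close> by auto
  ultimately have "int_mod.dependent (insert w W)"
    using int_mod.dependent_finite[of "insert w W"] W(1) by blast
  then show False
    using W by simp
qed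

text \<open>The coefficients at \<open>w\<close> of the elements of \<open>M\<close> form a subgroup
  of the integers, generated by some \<open>a\<close>. An element \<open>b\<close> of
  \<open>M\<close> with coefficient \<open>a\<close> complements a basis of the intersection of
  \<open>M\<close> with \<open>span W\<close>; if \<open>a = 0\<close>, then \<open>M\<close>
  already lies in \<open>span W\<close>.\<close>

lemma int_submodule_free:
  assumes "finite W" "int_mod.independent W" "int_mod.subspace M" "M \<subseteq> int_mod.span W"
  shows "\<exists>B. finite B \<and> int_mod.independent B \<and> int_mod.span B = M"
  using assms
proof (induction W arbitrary: M rule: finite_induct)
  case empty
  then have "M = {0}"
    using int_mod.subspace_0[of M] by auto
  then show ?case
    by (intro exI[of _ "{}"]) (simp add: int_mod.independent_empty)
next
  case (insert w W)
  have indW: "int_mod.independent W"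
    using insert.prems(1) int_mod.dependent_mono[of W "insert w W"] by blast
  define A where "A = {c. \<exists>y\<in>int_mod.span W. of_int c * w + y \<in> M}"
  have split: "\<exists>c. \<exists>y\<in>int_mod.span W. x = of_int c * w + y" if "x \<in> M" for x
  proof -
    have "x \<in> int_mod.span (insert w W)"
      using that insert.prems by blast
    then obtain k where "x - of_int k * w \<in> int_mod.span W"
      by (auto simp: int_mod.span_insert)
    then show ?thesis
      by (intro exI[of _ k] bexI[of _ "x - of_int k * w"]) auto
  qed
  obtain a where a: "a \<in> A" "\<And>c. c \<in> A \<Longrightarrow> a dvd c"
  proof (rule int_subgroup_generator[of A])
    show "0 \<in> A"
      unfolding A_def using int_mod.span_zero int_mod.subspace_0[OF insert.prems(2)]
      by (auto intro!: bexI[of _ 0])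
    show "c - e \<in> A" if ce: "c \<in> A" "e \<in> A" for c e
    proof -
      obtain y z where "y \<in> int_mod.span W" "z \<in> int_mod.span W" "of_int c * w + y \<in> M" "of_int e * w + z \<in> M"
        using ce by (auto simp: A_def)
      then have "y - z \<in> int_mod.span W" "of_int (c - e) * w + (y - z) \<in> M"
        using int_mod.span_diff int_mod.subspace_diff[OF insert.prems(2), of "of_int c * w + y" "of_int e * w + z"]
        by (auto simp: algebra_simps)
      then show ?thesis
        by (auto simp: A_def)
    qed
    show "k * c \<in> A" if c: "c \<in> A" for k c
    proof -
      obtain y where "y \<in> int_mod.span W" "of_int c * w + y \<in> M"
        using c by (auto simp: A_def)
      then have "of_int k * y \<in> int_mod.span W" "of_int (k * c) * w + of_int k * y \<in> M"
        using int_mod.span_scale int_mod.subspace_scale[OF insert.prems(2), of "of_int c * w + y" k]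
        by (auto simp: algebra_simps)
      then show ?thesis
        by (auto simp: A_def)
    qed
  qed blast
  obtain y0 where y0: "y0 \<in> int_mod.span W" "of_int a * w + y0 \<in> M"
    using a(1) by (auto simp: A_def)
  define b where "b = of_int a * w + y0"
  have "int_mod.subspace (M \<inter> int_mod.span W)"
    using insert.prems(2) int_mod.subspace_span by (rule int_mod.subspace_inter)
  then obtain B where B: "finite B" "int_mod.independent B" "int_mod.span B = M \<inter> int_mod.span W"
    using insert.IH[OF indW] by (meson inf_le2)
  show ?case
  proof (cases "a = 0")
    case True
    have "M \<subseteq> int_mod.span W"
    proof
      fix x assume x: "x \<in> M"
      obtain c y where cy: "y \<in> int_mod.span W" "x = of_int c * w + y"
        using split[OF x] by blast
      then have "c \<in> A"
        using x by (auto simp: A_def)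
      then show "x \<in> int_mod.span W"
        using a(2)[of c] True cy by simp
    qed
    then show ?thesis
      using B by (intro exI[of _ B]) auto
  next
    case False
    \<comment> \<open>The coefficient of \<open>c * b + z\<close> at \<open>w\<close> is
      \<open>c * a\<close>, since \<open>z\<close> lies in \<open>span W\<close>.\<close>
    have key: "c = 0" if z: "z \<in> int_mod.span B" and eq: "of_int c * b + z = 0" for c z
    proof -
      have "of_int c * y0 + z \<in> int_mod.span W"
        using y0(1) z B(3) by (intro int_mod.span_add int_mod.span_scale) auto
      moreover have "of_int (c * a) * w + (of_int c * y0 + z) = 0"
        using eq by (simp add: b_def algebra_simps)
      ultimately have "c * a = 0"
        by (rule int_independent_insert_coeff[OF insert.hyps insert.prems(1)])
      then show ?thesis
        using False by simp
    qed
    have "b \<notin> B"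
    proof
      assume "b \<in> B"
      then have "- b \<in> int_mod.span B"
        by (intro int_mod.span_neg int_mod.span_base)
      from key[OF this, of 1] show False
        by simp
    qed
    have "int_mod.independent (insert b B)"
    proof
      assume "int_mod.dependent (insert b B)"
      then obtain u where u: "\<exists>v\<in>insert b B. u v \<noteq> 0" "(\<Sum>v\<in>insert b B. of_int (u v) * v) = 0"
        using int_mod.dependent_finite[of "insert b B"] B(1) by blast
      have eq: "of_int (u b) * b + (\<Sum>v\<in>B. of_int (u v) * v) = 0"
        using u(2) B(1) \<open>b \<notin> B\<close> by simp
      moreover have "(\<Sum>v\<in>B. of_int (u v) * v) \<in> int_mod.span B"
        by (intro int_mod.span_sum int_mod.span_scale int_mod.span_base)
      ultimately have "u b = 0"
        using key by blast
      then have "\<exists>v\<in>B. u v \<noteq> 0" "(\<Sum>v\<in>B. of_int (u v) * v) = 0"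
        using u(1) eq by auto
      then show False
        using B int_mod.dependent_finite[of B] by blast
    qed
    moreover have "int_mod.span (insert b B) = M"
    proof
      have "insert b B \<subseteq> M"
        using y0(2) B(3) int_mod.span_superset[of B] by (auto simp: b_def)
      then show "int_mod.span (insert b B) \<subseteq> M"
        using insert.prems(2) by (rule int_mod.span_minimal)
      show "M \<subseteq> int_mod.span (insert b B)"
      proof
        fix x assume x: "x \<in> M"
        obtain c y where cy: "y \<in> int_mod.span W" "x = of_int c * w + y"
          using split[OF x] by blast
        then have "c \<in> A"
          using x by (auto simp: A_def)
        then have "a dvd c"
          by (rule a(2))
        then obtain k where "c = a * k"
          by (rule dvdE)
        then have k: "c = k * a"
          by (simp add: mult.commute)
        have "x - of_int k * b \<in> M"
          using x y0(2) insert.prems(2) unfolding b_def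
          by (intro int_mod.subspace_diff int_mod.subspace_scale)
        moreover have "x - of_int k * b = y - of_int k * y0"
          by (simp add: cy(2) k b_def algebra_simps)
        moreover have "y - of_int k * y0 \<in> int_mod.span W"
          using cy y0 by (intro int_mod.span_diff int_mod.span_scale)
        ultimately have "x - of_int k * b \<in> int_mod.span B"
          using B(3) by simp
        then show "x \<in> int_mod.span (insert b B)"
          by (auto simp: int_mod.span_insert)
      qed
    qed
    ultimately show ?thesis
      using B(1) by blast
  qed
qed

lemma common_denominator:
  fixes u :: "'a \<Rightarrow> rat"
  assumes "finite B"
  shows "\<exists>N::int. N > 0 \<and> (\<forall>v\<in>B. of_int N * u v \<in> \<int>)"
  using assms
proof (induction B rule: finite_induct)
  case empty
  then show ?case
    by (intro exI[of _ 1]) auto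
next
  case (insert v B)
  then obtain N where N: "N > 0" "\<forall>v\<in>B. of_int N * u v \<in> \<int>"
    by blast
  obtain a b where ab: "b > 0" "u v = of_int a / of_int b"
    by (metis quotient_of_denom_pos quotient_of_div surj_pair)
  have "of_int (N * b) * u v = of_int (N * a)"
    using ab by simp
  moreover have "of_int (N * b) * u x \<in> \<int>" if "x \<in> B" for x
  proof -
    have "of_int (N * b) * u x = of_int b * (of_int N * u x)"
      by simp
    then show ?thesis
      using N that by (metis Ints_mult Ints_of_int)
  qed
  ultimately show ?case
    using ab N by (intro exI[of _ "N * b"]) (auto simp del: of_int_mult)
qed

context splitting_field
begin

lemma \<theta>_O_K: "\<theta> \<in> O_K"
  by (simp add: O_K_iff \<theta>_K algebraic_int_\<theta>)

lemma int_subspace_O_K: "int_mod.subspace O_K"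
  unfolding int_mod.subspace_def using O_K.zero_mem O_K.add_mem O_K.mult_mem O_K.of_int_mem by blast

text \<open>By Cramer's rule for the trace form on the powers of \<open>\<theta>\<close>, the
  determinant \<open>N\<close> is a common denominator for the coordinates of all algebraic integers
  of \<open>K\<close>. So \<open>O_K\<close> is a subgroup of the free group generated by the
  \<open>\<theta>^i / N\<close>.\<close>

lemma ex_integral_basis: "\<exists>bs. integral_basis K bs"
proof -
  let ?w = "\<lambda>i. \<theta> ^ i"
  define N where "N = det (trace_form ?w)"
  have w: "\<theta> ^ i \<in> O_K" for i
    by (intro O_K.power_mem \<theta>_O_K)
  have N0: "N \<noteq> 0"
    unfolding N_def using w spanning_powers by (rule det_trace_form_nonzero)
  define W where "W = (\<lambda>i. \<theta> ^ i / of_int N) ` {..<m}"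
  have inj: "inj_on (\<lambda>i. \<theta> ^ i / of_int N) {..<m}"
    using inj_on_powers N0 by (auto simp: inj_on_def)
  have "int_mod.independent W"
  proof
    assume "int_mod.dependent W"
    then obtain u where u: "\<exists>v\<in>W. u v \<noteq> 0" "(\<Sum>v\<in>W. of_int (u v) * v) = 0"
      using int_mod.dependent_finite[of W] by (auto simp: W_def)
    have "(\<Sum>i<m. of_rat (of_int (u (\<theta> ^ i / of_int N))) * \<theta> ^ i) =
        of_int N * (\<Sum>i<m. of_int (u (\<theta> ^ i / of_int N)) * (\<theta> ^ i / of_int N))"
      using N0 by (simp add: sum_distrib_left)
    also have "\<dots> = of_int N * (\<Sum>v\<in>W. of_int (u v) * v)"
      unfolding W_def by (subst sum.reindex[OF inj]) simp
    finally have "(\<Sum>i<m. of_rat (of_int (u (\<theta> ^ i / of_int N))) * \<theta> ^ i) = 0"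
      using u(2) by simp
    from powers_independent[OF this] have "u (\<theta> ^ i / of_int N) = 0" if "i < m" for i
      using that by simp
    then show False
      using u(1) by (auto simp: W_def)
  qed
  moreover have "O_K \<subseteq> int_mod.span W"
  proof
    fix x assume x: "x \<in> O_K"
    then obtain q where q: "x = (\<Sum>i<m. of_rat (q i) * \<theta> ^ i)"
      using K_power_combination[of x] by (auto simp: O_K_iff)
    have "\<exists>c. of_int N * of_rat (q l) = (of_int c :: complex)" if l: "l < m" for l
    proof -
      have "of_int N * of_rat (q l) =
          (\<Sum>j<m. Tr (x * \<theta> ^ j) * of_int (adj_mat (trace_form ?w) $$ (j, l)))"
        unfolding N_def by (rule trace_form_coordinate[OF w q l])
      also have "\<dots> \<in> \<int>"
        by (intro Ints_sum Ints_mult Ints_of_int Tr_Ints O_K.mult_mem x w)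
      finally show ?thesis
        by (auto elim: Ints_cases)
    qed
    then obtain c where c: "\<And>l. l < m \<Longrightarrow> of_int N * of_rat (q l) = (of_int (c l) :: complex)"
      by metis
    have "x = (\<Sum>i<m. of_int (c i) * (\<theta> ^ i / of_int N))"
      unfolding q using N0 by (intro sum.cong) (auto simp: field_simps simp flip: c)
    also have "\<dots> \<in> int_mod.span W"
      by (intro int_mod.span_sum int_mod.span_scale int_mod.span_base) (auto simp: W_def)
    finally show "x \<in> int_mod.span W" .
  qed
  ultimately obtain B where B: "finite B" "int_mod.independent B" "int_mod.span B = O_K"
    using int_submodule_free[of W O_K] int_subspace_O_K by (auto simp: W_def)
  obtain bs where "set bs = B" "distinct bs"
    using finite_distinct_list[OF B(1)] by blast
  then show ?thesis
    using B by (auto simp: integral_basis_def)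
qed

text \<open>Denominators are cleared twice: in a rational relation, to contradict integral
  independence, and in an element of \<open>K\<close>, to move it into \<open>O_K\<close>. This
  yields that an integral basis has \<open>m\<close> elements.\<close>

lemma integral_basis_rat_basis:
  assumes B: "finite B" "int_mod.independent B" "int_mod.span B = O_K"
  shows "rat_vs.independent B" "rat_vs.span B = K"
proof -
  show "rat_vs.independent B"
  proof
    assume "rat_vs.dependent B"
    then obtain u v0 where u: "v0 \<in> B" "u v0 \<noteq> 0" "(\<Sum>v\<in>B. of_rat (u v) * v) = 0"
      using rat_vs.dependent_finite[OF B(1)] by blast
    obtain N :: int where N: "N > 0" "\<forall>v\<in>B. of_int N * u v \<in> \<int>"
      using common_denominator[OF B(1), of u] by blast
    then have "\<forall>v\<in>B. \<exists>c::int. of_int N * u v = of_int c"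
      by (auto elim: Ints_cases)
    then obtain c :: "complex \<Rightarrow> int" where c: "\<And>v. v \<in> B \<Longrightarrow> of_int N * u v = of_int (c v)"
      by metis
    have "of_int (c v) = of_int N * (of_rat (u v) :: complex)" if "v \<in> B" for v
      using arg_cong[OF c[OF that], of "of_rat :: rat \<Rightarrow> complex"] by (simp add: of_rat_mult)
    then have "(\<Sum>v\<in>B. of_int (c v) * v) = of_int N * (\<Sum>v\<in>B. of_rat (u v) * v)"
      by (simp add: sum_distrib_left mult.assoc)
    then have "(\<Sum>v\<in>B. of_int (c v) * v) = 0"
      using u(3) by simp
    moreover have "c v0 \<noteq> 0"
      using c[OF u(1)] u(2) N(1) by auto
    ultimately show False
      using B int_mod.dependent_finite[OF B(1)] u(1) by blast
  qed
  have BO: "B \<subseteq> O_K"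
    using B(3) int_mod.span_superset by blast
  show "rat_vs.span B = K"
  proof
    show "rat_vs.span B \<subseteq> K"
      using BO by (intro rat_vs.span_minimal rat_subspace_K) (auto simp: O_K_iff)
    have "int_mod.subspace (rat_vs.span B)"
      unfolding int_mod.subspace_def
      using rat_vs.span_zero rat_vs.span_add rat_vs.span_scale[of _ B "of_int _"] by auto
    then have int_rat: "O_K \<subseteq> rat_vs.span B"
      unfolding B(3)[symmetric] using rat_vs.span_superset by (intro int_mod.span_minimal)
    show "K \<subseteq> rat_vs.span B"
    proof
      fix x assume x: "x \<in> K"
      obtain N :: int where N: "N > 0" "algebraic_int (of_int N * x)"
        using K_clear_denominators[OF x] by blast
      then have "of_int N * x \<in> rat_vs.span B"
        using x int_rat by (auto simp: O_K_iff K.mult_mem K.of_int_mem)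
      then have "of_rat (inverse (of_int N)) * (of_int N * x) \<in> rat_vs.span B"
        by (rule rat_vs.span_scale)
      moreover have "of_rat (inverse (of_int N)) * (of_int N * x) = x"
        using N(1) by (simp add: of_rat_inverse)
      ultimately show "x \<in> rat_vs.span B"
        by (simp only:)
    qed
  qed
qed

lemma integral_basis_nth:
  assumes bs: "integral_basis K bs"
  shows "length bs = m" "\<And>i. i < m \<Longrightarrow> bs ! i \<in> O_K" "spanning (\<lambda>i. bs ! i)"
    and "x \<in> O_K \<Longrightarrow> \<exists>c::nat \<Rightarrow> int. x = (\<Sum>i<m. of_int (c i) * bs ! i)"
proof -
  have bs': "distinct bs" "int_mod.independent (set bs)" "int_mod.span (set bs) = O_K"
    using bs by (auto simp: integral_basis_def)
  have B: "rat_vs.independent (set bs)" "rat_vs.span (set bs) = K"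
    using integral_basis_rat_basis[OF _ bs'(2,3)] by auto
  show len: "length bs = m"
    using rat_basis_spanning(2)[OF B] distinct_card[OF bs'(1)] by simp
  then have bij: "bij_betw (\<lambda>i. bs ! i) {..<m} (set bs)"
    using bij_betw_nth[OF bs'(1)] by simp
  show "spanning (\<lambda>i. bs ! i)"
    using bij by (rule rat_basis_spanning(3)[OF B])
  show "bs ! i \<in> O_K" if "i < m" for i
    using int_mod.span_superset[of "set bs"] bs'(3) len that by auto
  assume "x \<in> O_K"
  then have "x \<in> range (\<lambda>u. \<Sum>v\<in>set bs. of_int (u v) * v)"
    using bs'(3) int_mod.span_finite[of "set bs"] by simp
  then obtain u where "x = (\<Sum>v\<in>set bs. of_int (u v) * v)"
    by (rule rangeE)
  also have "\<dots> = (\<Sum>i<m. of_int (u (bs ! i)) * bs ! i)"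
    by (rule sum.reindex_bij_betw[OF bij, symmetric])
  finally show "\<exists>c::nat \<Rightarrow> int. x = (\<Sum>i<m. of_int (c i) * bs ! i)"
    by (intro exI[of _ "\<lambda>i. u (bs ! i)"])
qed

lemma det_field_trace_integral_basis:
  assumes bs: "integral_basis K bs"
  shows "det (mat (length bs) (length bs) (\<lambda>(i, j). field_trace K (bs ! i * bs ! j))) =
    of_int (det (trace_form (\<lambda>i. bs ! i)))"
proof -
  have "mat (length bs) (length bs) (\<lambda>(i, j). field_trace K (bs ! i * bs ! j)) =
      map_mat of_int (trace_form (\<lambda>i. bs ! i))"
  proof (rule eq_matI)
    fix i j assume "i < dim_row (map_mat of_int (trace_form (\<lambda>i. bs ! i)))"
      "j < dim_col (map_mat of_int (trace_form (\<lambda>i. bs ! i)))"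
    then have ij: "i < m" "j < m"
      using trace_form_carrier[of "\<lambda>i. bs ! i"] by auto
    have "bs ! i * bs ! j \<in> K"
      using integral_basis_nth(2)[OF bs] ij by (intro K.mult_mem) (auto simp: O_K_iff)
    then have "of_rat (field_trace K (bs ! i * bs ! j)) = Tr (bs ! i * bs ! j)"
      by (rule field_trace_eq_Tr)
    also have "\<dots> = of_rat (of_int (trace_form (\<lambda>i. bs ! i) $$ (i, j)))"
      using trace_form_index[of "\<lambda>i. bs ! i" i j] integral_basis_nth(2)[OF bs] ij by simp
    finally have "field_trace K (bs ! i * bs ! j) = of_int (trace_form (\<lambda>i. bs ! i) $$ (i, j))"
      by (simp only: of_rat_eq_iff)
    then show "mat (length bs) (length bs) (\<lambda>(i, j). field_trace K (bs ! i * bs ! j)) $$ (i, j) =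
        map_mat of_int (trace_form (\<lambda>i. bs ! i)) $$ (i, j)"
      using ij integral_basis_nth(1)[OF bs] trace_form_carrier[of "\<lambda>i. bs ! i"] by simp
  qed (use integral_basis_nth(1)[OF bs] trace_form_carrier[of "\<lambda>i. bs ! i"] in auto)
  then show ?thesis
    by (simp add: of_int_hom.hom_det)
qed

text \<open>The value selected in \<open>field_discriminant\<close> comes with some integral basis
  realising it. That basis is fixed as \<open>\<omega>\<close> from here on, so that the
  discriminant is literally the determinant of its trace form.\<close>

lemma ex_discriminant_family:
  "\<exists>w. (\<forall>i<m. w i \<in> O_K) \<and> spanning w \<and>
     (\<forall>x\<in>O_K. \<exists>c::nat \<Rightarrow> int. x = (\<Sum>i<m. of_int (c i) * w i)) \<and>
     field_discriminant K = det (trace_form w)"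
proof -
  obtain bs0 where bs0: "integral_basis K bs0"
    using ex_integral_basis by blast
  let ?P = "\<lambda>D::int. \<exists>bs. integral_basis K bs \<and>
        of_int D = det (mat (length bs) (length bs) (\<lambda>(i, j). field_trace K (bs ! i * bs ! j)))"
  have "?P (det (trace_form (\<lambda>i. bs0 ! i)))"
    using bs0 det_field_trace_integral_basis[OF bs0] by (intro exI[of _ bs0]) simp
  then have "?P (field_discriminant K)"
    unfolding field_discriminant_def by (rule someI[of ?P])
  then obtain bs where bs: "integral_basis K bs"
    "of_int (field_discriminant K) = det (mat (length bs) (length bs) (\<lambda>(i, j). field_trace K (bs ! i * bs ! j)))"
    by blast
  then have "field_discriminant K = det (trace_form (\<lambda>i. bs ! i))"
    using det_field_trace_integral_basis[OF bs(1)] by simp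
  then show ?thesis
    using integral_basis_nth[OF bs(1)] by (intro exI[of _ "\<lambda>i. bs ! i"] conjI allI impI ballI)
qed

definition \<omega> :: "nat \<Rightarrow> complex" where
  "\<omega> = (SOME w. (\<forall>i<m. w i \<in> O_K) \<and> spanning w \<and>
     (\<forall>x\<in>O_K. \<exists>c::nat \<Rightarrow> int. x = (\<Sum>i<m. of_int (c i) * w i)) \<and>
     field_discriminant K = det (trace_form w))"

lemma \<omega>_O_K: "i < m \<Longrightarrow> \<omega> i \<in> O_K"
  and spanning_\<omega>: "spanning \<omega>"
  and \<omega>_coordinates: "x \<in> O_K \<Longrightarrow> \<exists>c::nat \<Rightarrow> int. x = (\<Sum>i<m. of_int (c i) * \<omega> i)"
  and field_discriminant_\<omega>: "field_discriminant K = det (trace_form \<omega>)"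
  using someI_ex[OF ex_discriminant_family] unfolding \<omega>_def[symmetric] by simp_all

lemma field_discriminant_nonzero: "field_discriminant K \<noteq> 0"
  unfolding field_discriminant_\<omega> using \<omega>_O_K spanning_\<omega> by (rule det_trace_form_nonzero)

end

section \<open>Prime ideals and Frobenius\<close>

context comm_subring
begin

definition ideal_in :: "'a set \<Rightarrow> bool" where
  "ideal_in I \<longleftrightarrow> I \<subseteq> R \<and> 0 \<in> I \<and> (\<forall>x\<in>I. \<forall>y\<in>I. x + y \<in> I) \<and> (\<forall>x\<in>I. \<forall>y\<in>R. x * y \<in> I)"

definition prime_in :: "'a set \<Rightarrow> bool" where
  "prime_in P \<longleftrightarrow> ideal_in P \<and> 1 \<notin> P \<and> (\<forall>x\<in>R. \<forall>y\<in>R. x * y \<in> P \<longrightarrow> x \<in> P \<or> y \<in> P)"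

lemma ideal_inD:
  assumes "ideal_in I"
  shows "x \<in> I \<Longrightarrow> x \<in> R" "0 \<in> I" "x \<in> I \<Longrightarrow> y \<in> I \<Longrightarrow> x + y \<in> I" "x \<in> I \<Longrightarrow> y \<in> R \<Longrightarrow> x * y \<in> I"
    "x \<in> I \<Longrightarrow> y \<in> R \<Longrightarrow> y * x \<in> I"
  using assms by (auto simp: ideal_in_def mult.commute[of y])

lemma ideal_in_uminus: "ideal_in I \<Longrightarrow> x \<in> I \<Longrightarrow> - x \<in> I"
  using ideal_inD(4)[of I x "- 1"] uminus_mem[OF one_mem] by simp

lemma ideal_in_diff: "ideal_in I \<Longrightarrow> x \<in> I \<Longrightarrow> y \<in> I \<Longrightarrow> x - y \<in> I"
  using ideal_inD(3)[of I x "- y"] ideal_in_uminus by simp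

lemma ideal_in_sum: "ideal_in I \<Longrightarrow> (\<And>i. i \<in> A \<Longrightarrow> f i \<in> I) \<Longrightarrow> sum f A \<in> I"
  by (induction A rule: infinite_finite_induct) (auto intro: ideal_inD)

lemma ideal_in_power_diff:
  assumes "ideal_in I" "x \<in> R" "y \<in> R" "x - y \<in> I"
  shows "x ^ n - y ^ n \<in> I"
  unfolding power_diff_sumr2 using assms by (intro ideal_inD(4) sum_mem mult_mem power_mem)

lemma ideal_in_multiples:
  assumes "q \<in> R"
  shows "ideal_in {x. cong_mod q x 0}"
  unfolding ideal_in_def
proof (intro conjI ballI)
  show "{x. cong_mod q x 0} \<subseteq> R"
    using assms by (auto elim!: cong_modE intro: mult_mem)
  fix x assume x: "x \<in> {x. cong_mod q x 0}"
  show "x + y \<in> {x. cong_mod q x 0}" if "y \<in> {x. cong_mod q x 0}" for y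
    using cong_mod_add[of q x 0 y 0] x that by simp
  show "x * y \<in> {x. cong_mod q x 0}" if "y \<in> R" for y
    using cong_mod_zero_mult x that by simp
qed (simp add: cong_mod_refl)

text \<open>Let \<open>M\<close> be maximal among the ideals that contain \<open>q\<close> and no
  power of \<open>x\<close>. If \<open>a\<close> and \<open>b\<close> lie outside \<open>M\<close>,
  both \<open>M + a R\<close> and \<open>M + b R\<close> contain a power of \<open>x\<close>; the
  product of these powers lies in \<open>M + a b R\<close>, so \<open>a * b\<close> is outside
  \<open>M\<close> too.\<close>

lemma ex_prime_avoiding:
  assumes q: "q \<in> R" and x: "x \<in> R" and nil: "\<And>n. \<not> cong_mod q (x ^ n) 0"
  shows "\<exists>P. prime_in P \<and> q \<in> P \<and> x \<notin> P"
proof -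
  define \<A> where "\<A> = {I. ideal_in I \<and> q \<in> I \<and> (\<forall>n. x ^ n \<notin> I)}"
  have "\<exists>M\<in>\<A>. \<forall>X\<in>\<A>. M \<subseteq> X \<longrightarrow> X = M"
  proof (rule subset_Zorn_nonempty)
    have "cong_mod q q 0"
      using one_mem by (rule cong_modI) simp
    then have "{x. cong_mod q x 0} \<in> \<A>"
      using ideal_in_multiples[OF q] nil by (simp add: \<A>_def)
    then show "\<A> \<noteq> {}"
      by blast
    fix \<C> assume \<C>: "\<C> \<noteq> {}" "subset.chain \<A> \<C>"
    then have sub: "\<C> \<subseteq> \<A>" and chain: "\<And>X Y. X \<in> \<C> \<Longrightarrow> Y \<in> \<C> \<Longrightarrow> X \<subseteq> Y \<or> Y \<subseteq> X"
      by (auto simp: subset_chain_def)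
    have mem: "ideal_in X" "q \<in> X" "x ^ n \<notin> X" if "X \<in> \<C>" for X n
      using sub that by (auto simp: \<A>_def)
    have "ideal_in (\<Union>\<C>)"
      unfolding ideal_in_def
    proof (intro conjI ballI)
      show "\<Union>\<C> \<subseteq> R"
        using mem(1) ideal_inD(1) by blast
      show "0 \<in> \<Union>\<C>"
        using \<C>(1) mem(1) ideal_inD(2) by blast
      show "u * v \<in> \<Union>\<C>" if "u \<in> \<Union>\<C>" "v \<in> R" for u v
        using that mem(1) ideal_inD(4) by blast
      show "u + v \<in> \<Union>\<C>" if uv: "u \<in> \<Union>\<C>" "v \<in> \<Union>\<C>" for u v
      proof -
        obtain X Y where XY: "X \<in> \<C>" "Y \<in> \<C>" "u \<in> X" "v \<in> Y"
          using uv by blast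
        then have "u + v \<in> X \<or> u + v \<in> Y"
          using chain[of X Y] ideal_inD(3)[OF mem(1)] by blast
        then show ?thesis
          using XY by blast
      qed
    qed
    then show "\<Union>\<C> \<in> \<A>"
      using mem \<C>(1) by (auto simp: \<A>_def)
  qed
  then obtain M where M: "M \<in> \<A>" and max: "\<And>X. X \<in> \<A> \<Longrightarrow> M \<subseteq> X \<Longrightarrow> X = M"
    by blast
  have idM: "ideal_in M" and qM: "q \<in> M" and xM: "x ^ n \<notin> M" for n
    using M by (auto simp: \<A>_def)
  have ext: "\<exists>n. \<exists>u\<in>M. \<exists>s\<in>R. x ^ n = u + a * s" if a: "a \<in> R" "a \<notin> M" for a
  proof (rule ccontr)
    assume no: "\<not> ?thesis"
    define X where "X = {u + a * s | u s. u \<in> M \<and> s \<in> R}"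
    have MX: "M \<subseteq> X"
    proof
      fix u assume "u \<in> M"
      moreover have "u = u + a * 0"
        by simp
      ultimately show "u \<in> X"
        unfolding X_def using zero_mem by blast
    qed
    have "a = 0 + a * 1"
      by simp
    then have aX: "a \<in> X"
      unfolding X_def using ideal_inD(2)[OF idM] one_mem by blast
    have "ideal_in X"
      unfolding ideal_in_def
    proof (intro conjI ballI)
      show "X \<subseteq> R"
        using a ideal_inD(1)[OF idM] by (auto simp: X_def intro!: add_mem mult_mem)
      show "0 \<in> X"
        using MX ideal_inD(2)[OF idM] by blast
      fix y assume "y \<in> X"
      then obtain u s where us: "u \<in> M" "s \<in> R" "y = u + a * s"
        by (auto simp: X_def)
      show "y + z \<in> X" if z: "z \<in> X" for z
      proof -
        obtain v t where vt: "v \<in> M" "t \<in> R" "z = v + a * t"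
          using z by (auto simp: X_def)
        have "y + z = (u + v) + a * (s + t)"
          using us vt by (simp add: algebra_simps)
        then show ?thesis
          unfolding X_def using us vt ideal_inD(3)[OF idM] add_mem by blast
      qed
      show "y * z \<in> X" if z: "z \<in> R" for z
      proof -
        have "y * z = u * z + a * (s * z)"
          using us by (simp add: algebra_simps)
        then show ?thesis
          unfolding X_def using us z ideal_inD(4)[OF idM] mult_mem by blast
      qed
    qed
    moreover have "x ^ n \<notin> X" for n
      using no by (auto simp: X_def)
    ultimately have "X \<in> \<A>"
      using MX qM by (auto simp: \<A>_def)
    then show False
      using max MX aX a by blast
  qed
  have "prime_in M"
    unfolding prime_in_def
  proof (intro conjI ballI impI)
    show "ideal_in M"
      by (rule idM)
    show "1 \<notin> M"
      using xM[of 0] by simp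
    show "a \<in> M \<or> b \<in> M" if ab: "a \<in> R" "b \<in> R" "a * b \<in> M" for a b
    proof (rule ccontr)
      assume "\<not> ?thesis"
      then obtain i u s j v t where 1: "u \<in> M" "s \<in> R" "x ^ i = u + a * s"
        and 2: "v \<in> M" "t \<in> R" "x ^ j = v + b * t"
        using ext[OF ab(1)] ext[OF ab(2)] by metis
      have "x ^ (i + j) = u * (v + b * t) + a * s * v + (a * b) * (s * t)"
        by (simp add: power_add 1 2 algebra_simps)
      moreover have "u * (v + b * t) \<in> M"
        using 1(1) by (rule ideal_inD(4)[OF idM]) (use 2 ab ideal_inD(1)[OF idM] in \<open>auto intro: mult_mem add_mem\<close>)
      moreover have "a * s * v \<in> M"
        using 2(1) by (rule ideal_inD(5)[OF idM]) (use 1 ab in \<open>auto intro: mult_mem\<close>)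
      moreover have "(a * b) * (s * t) \<in> M"
        using ab(3) by (rule ideal_inD(4)[OF idM]) (use 1 2 in \<open>auto intro: mult_mem\<close>)
      ultimately have "x ^ (i + j) \<in> M"
        by (simp add: ideal_inD(3)[OF idM])
      then show False
        using xM by blast
    qed
  qed
  moreover have "x \<notin> M"
    using xM[of 1] by simp
  ultimately show ?thesis
    using qM by blast
qed

text \<open>Here \<open>polys_over P\<close> is the set of polynomials that vanish modulo
  \<open>P\<close>, and the claim is Gauss's lemma. With the first coefficients outside
  \<open>P\<close> at \<open>i\<close> and \<open>j\<close>, every summand of the coefficient
  \<open>i + j\<close> of the product except one lies in \<open>P\<close>.\<close>

lemma prime_in_polys_mult:
  assumes P: "prime_in P" and fg: "f \<in> polys_over R" "g \<in> polys_over R" "f * g \<in> polys_over P"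
  shows "f \<in> polys_over P \<or> g \<in> polys_over P"
proof (rule ccontr)
  assume "\<not> ?thesis"
  then have ex: "\<exists>i. coeff f i \<notin> P" "\<exists>j. coeff g j \<notin> P"
    by (auto simp: polys_over_def)
  define i where "i = (LEAST i. coeff f i \<notin> P)"
  define j where "j = (LEAST j. coeff g j \<notin> P)"
  have i: "coeff f i \<notin> P" "\<And>k. k < i \<Longrightarrow> coeff f k \<in> P"
    unfolding i_def using LeastI_ex[OF ex(1)] not_less_Least by blast+
  have j: "coeff g j \<notin> P" "\<And>k. k < j \<Longrightarrow> coeff g k \<in> P"
    unfolding j_def using LeastI_ex[OF ex(2)] not_less_Least by blast+
  have idP: "ideal_in P"
    using P by (simp add: prime_in_def)
  have "coeff (f * g) (i + j) = (\<Sum>k\<le>i + j. coeff f k * coeff g (i + j - k))"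
    by (rule coeff_mult)
  also have "\<dots> = coeff f i * coeff g j + (\<Sum>k\<in>{..i + j} - {i}. coeff f k * coeff g (i + j - k))"
    by (subst sum.remove[of _ i]) auto
  finally have "coeff f i * coeff g j =
      coeff (f * g) (i + j) - (\<Sum>k\<in>{..i + j} - {i}. coeff f k * coeff g (i + j - k))"
    by simp
  also have "\<dots> \<in> P"
  proof (intro ideal_in_diff[OF idP] ideal_in_sum[OF idP])
    show "coeff (f * g) (i + j) \<in> P"
      using fg(3) by (rule coeff_polys_over)
    fix k assume k: "k \<in> {..i + j} - {i}"
    show "coeff f k * coeff g (i + j - k) \<in> P"
    proof (cases "k < i")
      case True
      then show ?thesis
        using i(2) fg by (intro ideal_inD(4)[OF idP]) (auto intro: coeff_polys_over)
    next
      case False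
      then have "i + j - k < j"
        using k by auto
      then show ?thesis
        using j(2) fg by (intro ideal_inD(5)[OF idP]) (auto intro: coeff_polys_over)
    qed
  qed
  finally show False
    using P i(1) j(1) fg(1,2) coeff_polys_over unfolding prime_in_def by blast
qed

lemma prime_in_polys_prod:
  assumes P: "prime_in P" and "finite A" "\<And>k. k \<in> A \<Longrightarrow> f k \<in> polys_over R" "prod f A \<in> polys_over P"
  shows "\<exists>k\<in>A. f k \<in> polys_over P"
  using assms(2-)
proof (induction A rule: finite_induct)
  case empty
  then have "coeff (1 :: 'a poly) 0 \<in> P"
    using coeff_polys_over[of 1 P 0] by simp
  then show ?case
    using P by (simp add: prime_in_def)
next
  case (insert k A)
  have "prod f A \<in> polys_over R"
    using insert.prems by (intro comm_subring.prod_mem[OF comm_subring_polys_over]) auto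
  then have "f k \<in> polys_over P \<or> prod f A \<in> polys_over P"
    using insert by (intro prime_in_polys_mult[OF P]) auto
  then show ?case
    using insert by auto
qed

lemma cong_mod_fermat:
  assumes p: "prime p"
  shows "cong_mod (of_nat p) (of_int a ^ p) (of_int a)"
proof -
  have nat: "cong_mod (of_nat p) (of_nat n ^ p) (of_nat n)" for n
  proof (induction n)
    case 0
    then show ?case
      using p by (simp add: cong_mod_refl power_0_left prime_gt_0_nat)
  next
    case (Suc n)
    have "cong_mod (of_nat p) ((1 + of_nat n) ^ p) (1 ^ p + of_nat n ^ p)"
      by (intro cong_mod_freshman p one_mem of_nat_mem)
    moreover have "cong_mod (of_nat p) (1 ^ p + of_nat n ^ p) (1 + of_nat n)"
      using Suc by (simp add: cong_mod_add cong_mod_refl)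
    ultimately show ?case
      using cong_mod_trans by simp
  qed
  show ?thesis
  proof (cases a rule: int_cases2)
    case (nonneg n)
    then show ?thesis
      using nat[of n] by simp
  next
    case (nonpos n)
    have "cong_mod (of_nat p) ((- of_nat n) ^ p) (- (of_nat n ^ p))"
      by (intro cong_mod_freshman_uminus p of_nat_mem)
    then show ?thesis
      using nonpos cong_mod_uminus[OF nat[of n]] cong_mod_trans by simp
  qed
qed

text \<open>\<open>g(X)^p\<close> is congruent to \<open>g\<close> with \<open>\<psi>\<close>
  applied to its coefficients and \<open>X^p\<close> substituted. The map \<open>\<psi>\<close>
  stands for any lift of the \<open>p\<close>-th power: the identity on the integers, by Fermat, and
  the power itself on \<open>O_K\<close>. It must fix 0 to act coefficientwise through
  \<open>map_poly\<close>.\<close>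

lemma poly_power_prime_cong:
  assumes p: "prime p" and g: "g \<in> polys_over S" and S: "S \<subseteq> R"
    and \<psi>: "\<psi> 0 = 0" "\<And>a. a \<in> S \<Longrightarrow> \<psi> a \<in> R" "\<And>a. a \<in> S \<Longrightarrow> cong_mod (of_nat p) (a ^ p) (\<psi> a)"
  shows "comm_subring.cong_mod (polys_over R) (of_nat p) (g ^ p) (pcompose (map_poly \<psi> g) (monom 1 p))"
  using g
proof (induction g)
  case 0
  interpret RX: comm_subring "polys_over R"
    by (rule comm_subring_polys_over)
  show ?case
    using p by (simp add: RX.cong_mod_refl power_0_left prime_gt_0_nat)
next
  case (pCons a g)
  interpret RX: comm_subring "polys_over R"
    by (rule comm_subring_polys_over)
  have a: "a \<in> S" and g: "g \<in> polys_over S"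
    using pCons.prems unfolding polys_over_def
    by (auto simp: coeff_pCons dest: spec[of _ 0] spec[of _ "Suc _"])
  have aR: "[:a:] \<in> polys_over R" and gR: "g \<in> polys_over R"
    using a g S polys_over_mono[OF S] by (auto simp: pCons_polys_over RX.zero_mem)
  have X: "monom 1 n \<in> polys_over R" for n
    by (intro monom_polys_over one_mem)
  have "pCons a g = [:a:] + monom 1 1 * g"
    by (simp add: monom_altdef)
  then have "RX.cong_mod (of_nat p) (pCons a g ^ p) ([:a:] ^ p + (monom 1 1 * g) ^ p)"
    using RX.cong_mod_freshman[OF p aR RX.mult_mem[OF X gR]] by simp
  moreover have "RX.cong_mod (of_nat p) ([:a:] ^ p + (monom 1 1 * g) ^ p)
      ([:\<psi> a:] + monom 1 p * pcompose (map_poly \<psi> g) (monom 1 p))"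
  proof (rule RX.cong_mod_add)
    obtain c where c: "c \<in> R" "a ^ p = \<psi> a + of_nat p * c"
      using \<psi>(3)[OF a] by (elim cong_modE)
    have "[:a:] ^ p - [:\<psi> a:] = of_nat p * [:c:]"
      by (simp add: poly_const_pow c of_nat_poly)
    then show "RX.cong_mod (of_nat p) ([:a:] ^ p) [:\<psi> a:]"
      using c by (intro RX.cong_modI[of "[:c:]"]) (auto simp: pCons_polys_over RX.zero_mem)
    show "RX.cong_mod (of_nat p) ((monom 1 1 * g) ^ p) (monom 1 p * pcompose (map_poly \<psi> g) (monom 1 p))"
      unfolding power_mult_distrib monom_power using X gR pCons.IH[OF g]
      by (intro RX.cong_mod_mult) (auto intro: RX.cong_mod_refl RX.power_mem)
  qed
  ultimately have "RX.cong_mod (of_nat p) (pCons a g ^ p)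
      ([:\<psi> a:] + monom 1 p * pcompose (map_poly \<psi> g) (monom 1 p))"
    by (rule RX.cong_mod_trans)
  moreover have "[:\<psi> a:] + monom 1 p * pcompose (map_poly \<psi> g) (monom 1 p) =
      pcompose (map_poly \<psi> (pCons a g)) (monom 1 p)"
    by (simp add: Polynomial.map_poly_pCons[of \<psi>, OF \<psi>(1)] pcompose_pCons)
  ultimately show ?case
    by (simp only:)
qed

end

lemma coeff_pcompose_monom:
  fixes g :: "'a::comm_ring_1 poly"
  assumes "p > 0"
  shows "coeff (pcompose g (monom 1 p)) (p * i) = coeff g i"
proof (induction g arbitrary: i)
  case (pCons a g)
  have "coeff (pcompose (pCons a g) (monom 1 p)) (p * i) =
      coeff [:a:] (p * i) + (if p * i < p then 0 else coeff (pcompose g (monom 1 p)) (p * i - p))"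
    by (simp add: pcompose_pCons coeff_monom_mult)
  also have "\<dots> = coeff (pCons a g) i"
  proof (cases i)
    case 0
    then show ?thesis
      using assms by simp
  next
    case (Suc j)
    have "coeff [:a:] (p * i) = 0"
      using assms Suc by (intro coeff_eq_0) simp
    then show ?thesis
      using Suc pCons.IH[of j] by simp
  qed
  finally show ?case .
qed simp

section \<open>The radical of a rational prime in the ring of integers\<close>

context splitting_field
begin

text \<open>The quotient is rational and integral over the integers, hence an integer. This carries
  divisibility found in \<open>O_K\<close> back to the integers.\<close>

lemma of_int_dvd_O_K:
  assumes "of_int a = of_int n * c" "c \<in> O_K"
  shows "n dvd a"
proof (cases "n = 0")
  case False
  then have "c = of_int a / of_int n"
    using assms(1) by simp
  then have "c \<in> \<int>"
    using assms(2) O_K_Rats by (metis Rats_divide Rats_of_int)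
  then obtain b where "c = of_int b"
    by (elim Ints_cases)
  then have "(of_int a :: complex) = of_int (n * b)"
    using assms(1) by simp
  then show ?thesis
    unfolding of_int_eq_iff by simp
qed (use assms in simp)

text \<open>The radical of the ideal generated by \<open>p\<close>. Restricting the exponents to
  powers of \<open>p\<close> gives the same set for prime \<open>p\<close>, because every exponent
  is below such a power, and lets closure under differences follow from additivity of the
  \<open>p\<close>-th power modulo \<open>p\<close>.\<close>

definition nil_rad :: "nat \<Rightarrow> complex set" where
  "nil_rad p = {x \<in> O_K. \<exists>n. O_K.cong_mod (of_nat p) (x ^ (p ^ n)) 0}"

lemma nil_rad_O_K: "x \<in> nil_rad p \<Longrightarrow> x \<in> O_K"
  by (simp add: nil_rad_def)

lemma cong_mod_power_prime_mono:
  assumes "prime p" "x \<in> O_K" "O_K.cong_mod (of_nat p) (x ^ (p ^ n)) 0" "n \<le> l"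
  shows "O_K.cong_mod (of_nat p) (x ^ (p ^ l)) 0"
proof -
  have "p ^ l = p ^ n * p ^ (l - n)"
    using assms(4) by (simp flip: power_add)
  moreover have "O_K.cong_mod (of_nat p) ((x ^ (p ^ n)) ^ (p ^ (l - n))) (0 ^ (p ^ (l - n)))"
    using assms by (intro O_K.cong_mod_power O_K.power_mem O_K.zero_mem)
  ultimately show ?thesis
    using assms(1) by (simp add: power_mult power_0_left prime_gt_0_nat)
qed

lemma nil_rad_diff:
  assumes p: "prime p" and xy: "x \<in> nil_rad p" "y \<in> nil_rad p"
  shows "x - y \<in> nil_rad p"
proof -
  obtain n l where nl: "O_K.cong_mod (of_nat p) (x ^ (p ^ n)) 0" "O_K.cong_mod (of_nat p) (y ^ (p ^ l)) 0"
    using xy by (auto simp: nil_rad_def)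
  let ?N = "n + l"
  have "O_K.cong_mod (of_nat p) ((x - y) ^ (p ^ ?N)) (x ^ (p ^ ?N) - y ^ (p ^ ?N))"
    using xy by (intro O_K.cong_mod_freshman_diff_power p nil_rad_O_K)
  moreover have "O_K.cong_mod (of_nat p) (x ^ (p ^ ?N) - y ^ (p ^ ?N)) (0 - 0)"
    using cong_mod_power_prime_mono[OF p nil_rad_O_K[OF xy(1)] nl(1)]
      cong_mod_power_prime_mono[OF p nil_rad_O_K[OF xy(2)] nl(2)]
    by (intro O_K.cong_mod_diff) auto
  ultimately have "O_K.cong_mod (of_nat p) ((x - y) ^ (p ^ ?N)) (0 - 0)"
    by (rule O_K.cong_mod_trans)
  then show ?thesis
    using xy O_K.diff_mem by (auto simp: nil_rad_def)
qed

lemma nil_rad_mult: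
  assumes "x \<in> nil_rad p" "y \<in> O_K"
  shows "x * y \<in> nil_rad p"
  using assms O_K.cong_mod_zero_mult[OF _ O_K.power_mem[OF assms(2)]]
  by (auto simp: nil_rad_def power_mult_distrib intro: O_K.mult_mem)

lemma nil_rad_zero: "prime p \<Longrightarrow> 0 \<in> nil_rad p"
  using O_K.zero_mem O_K.cong_mod_refl by (auto simp: nil_rad_def intro!: exI[of _ 0])

lemma ideal_in_nil_rad:
  assumes p: "prime p"
  shows "O_K.ideal_in (nil_rad p)"
proof -
  have "x + y \<in> nil_rad p" if "x \<in> nil_rad p" "y \<in> nil_rad p" for x y
    using nil_rad_diff[OF p that(1) nil_rad_diff[OF p nil_rad_zero[OF p] that(2)]] by simp
  then show ?thesis
    unfolding O_K.ideal_in_def using nil_rad_O_K nil_rad_mult nil_rad_zero[OF p] by blast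
qed

lemma nil_rad_gal:
  assumes k: "k < m" and x: "x \<in> nil_rad p"
  shows "gal k x \<in> nil_rad p"
proof -
  interpret subfield_hom K "gal k"
    using k by (rule gal_hom)
  obtain n where "O_K.cong_mod (of_nat p) (x ^ (p ^ n)) 0"
    using x by (auto simp: nil_rad_def)
  then obtain c where c: "c \<in> O_K" "x ^ (p ^ n) = of_nat p * c"
    by (elim O_K.cong_modE) simp
  have xK: "x \<in> K" "c \<in> K"
    using x c by (auto simp: nil_rad_def O_K_iff)
  have "gal k x ^ (p ^ n) = gal k (x ^ (p ^ n))"
    using xK by (simp add: hom_power)
  also have "\<dots> = of_nat p * gal k c"
    unfolding c(2) using xK by (simp add: hom_mult hom_of_nat K.of_nat_mem)
  finally have "O_K.cong_mod (of_nat p) (gal k x ^ (p ^ n)) 0"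
    using gal_O_K[OF k c(1)] by (intro O_K.cong_modI[of "gal k c"]) auto
  then show ?thesis
    using gal_O_K[OF k nil_rad_O_K[OF x]] by (auto simp: nil_rad_def)
qed

lemma nil_rad_of_int:
  assumes p: "prime p" and a: "of_int a \<in> nil_rad p"
  shows "int p dvd a"
proof -
  obtain n where "O_K.cong_mod (of_nat p) (of_int a ^ (p ^ n)) 0"
    using a by (auto simp: nil_rad_def)
  then obtain c where "c \<in> O_K" "of_int (a ^ (p ^ n)) = of_int (int p) * c"
    by (elim O_K.cong_modE) simp
  then have "int p dvd a ^ (p ^ n)"
    by (intro of_int_dvd_O_K)
  then show ?thesis
    using p by (simp add: prime_dvd_power)
qed

lemma nil_rad_Ints:
  assumes "prime p" "x \<in> nil_rad p" "x \<in> \<int>"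
  obtains b where "x = of_int (int p * b)"
proof -
  obtain a where a: "x = of_int a"
    using assms(3) by (elim Ints_cases)
  then have "int p dvd a"
    using assms nil_rad_of_int by blast
  then obtain b where "a = int p * b"
    by (rule dvdE)
  then show ?thesis
    using that[of b] a by simp
qed

text \<open>The trace form maps \<open>nil_rad p\<close> into multiples of \<open>p\<close> and is invertible modulo \<open>p\<close> when \<open>p\<close>
  does not divide the discriminant.\<close>

lemma nil_rad_unramified:
  assumes p: "prime p" and D: "\<not> int p dvd field_discriminant K" and x: "x \<in> nil_rad p"
  shows "O_K.cong_mod (of_nat p) x 0"
proof -
  obtain c :: "nat \<Rightarrow> int" where c: "x = (\<Sum>i<m. of_int (c i) * \<omega> i)"
    using \<omega>_coordinates[OF nil_rad_O_K[OF x]] by blast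
  have "\<exists>e. Tr (x * \<omega> j) = of_int (int p * e)" if j: "j < m" for j
  proof -
    have "x * \<omega> j \<in> nil_rad p"
      using x \<omega>_O_K[OF j] by (rule nil_rad_mult)
    then have "Tr (x * \<omega> j) \<in> nil_rad p"
      unfolding Tr_def by (intro O_K.ideal_in_sum[OF ideal_in_nil_rad[OF p]] nil_rad_gal) auto
    moreover have "Tr (x * \<omega> j) \<in> \<int>"
      by (intro Tr_Ints O_K.mult_mem nil_rad_O_K[OF x] \<omega>_O_K[OF j])
    ultimately show ?thesis
      using nil_rad_Ints[OF p] by metis
  qed
  then obtain e where e: "\<And>j. j < m \<Longrightarrow> Tr (x * \<omega> j) = of_int (int p * e j)"
    by metis
  have "int p dvd c l" if l: "l < m" for l
  proof -
    have cq: "x = (\<Sum>i<m. of_rat (of_int (c i)) * \<omega> i)"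
      using c by simp
    have "of_int (det (trace_form \<omega>)) * of_rat (of_int (c l)) =
        (\<Sum>j<m. Tr (x * \<omega> j) * of_int (adj_mat (trace_form \<omega>) $$ (j, l)))"
      by (rule trace_form_coordinate[OF \<omega>_O_K cq l])
    also have "\<dots> = of_int (\<Sum>j<m. int p * e j * adj_mat (trace_form \<omega>) $$ (j, l))"
      by (simp add: e)
    finally have "of_int (det (trace_form \<omega>) * c l) =
        (of_int (\<Sum>j<m. int p * e j * adj_mat (trace_form \<omega>) $$ (j, l)) :: complex)"
      by simp
    then have "det (trace_form \<omega>) * c l = (\<Sum>j<m. int p * e j * adj_mat (trace_form \<omega>) $$ (j, l))"
      unfolding of_int_eq_iff .
    also have "int p dvd \<dots>"
      by (intro dvd_sum) simp
    finally show ?thesis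
      using D p field_discriminant_\<omega> by (simp add: prime_dvd_mult_iff)
  qed
  then have "of_int (c i) = of_nat p * (of_int (c i div int p) :: complex)" if "i < m" for i
    using that by (metis dvd_mult_div_cancel of_int_mult of_int_of_nat_eq)
  then have "x = of_nat p * (\<Sum>i<m. of_int (c i div int p) * \<omega> i)"
    unfolding c sum_distrib_left mult.assoc[symmetric] by (intro sum.cong) simp_all
  then show ?thesis
    using \<omega>_O_K by (intro O_K.cong_modI[of "\<Sum>i<m. of_int (c i div int p) * \<omega> i"])
      (auto intro!: O_K.sum_mem O_K.mult_mem O_K.of_int_mem)
qed

section \<open>Multiplication matrices over a polynomial ring\<close>

lemma comm_ring_hom_const_poly: "comm_ring_hom (\<lambda>c::complex. [:c:])"
  by unfold_locales (auto simp: one_pCons)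

definition conj_poly_mat :: "(nat \<Rightarrow> complex) \<Rightarrow> complex poly mat" where
  "conj_poly_mat w = map_mat (\<lambda>c. [:c:]) (conj_mat w)"

lemma conj_poly_mat_carrier: "conj_poly_mat w \<in> carrier_mat m m"
  using conj_mat_carrier by (simp add: conj_poly_mat_def)

lemma conj_poly_mat_index: "k < m \<Longrightarrow> i < m \<Longrightarrow> conj_poly_mat w $$ (k, i) = [:gal k (w i):]"
  using conj_mat_carrier[of w] by (simp add: conj_poly_mat_def conj_mat_index)

lemma det_conj_poly_mat: "spanning w \<Longrightarrow> det (conj_poly_mat w) \<noteq> 0"
  using comm_ring_hom.hom_det[OF comm_ring_hom_const_poly, of "conj_mat w"] det_conj_mat[of w]
  by (simp add: conj_poly_mat_def)

text \<open>Multiplication by \<open>f\<close> on the ring of integers, extended to polynomials, has an integral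
  matrix \<open>N\<close> whose eigenvalues are the conjugates of \<open>f\<close>.\<close>

lemma ex_multiplication_matrix:
  assumes w: "\<And>i. i < m \<Longrightarrow> w i \<in> O_K"
    "\<And>x. x \<in> O_K \<Longrightarrow> \<exists>c::nat \<Rightarrow> int. x = (\<Sum>i<m. of_int (c i) * w i)"
    and f: "f \<in> polys_over O_K"
  obtains N where "N \<in> carrier_mat m m" "\<And>i j. i < m \<Longrightarrow> j < m \<Longrightarrow> N $$ (i, j) \<in> polys_over \<int>"
    "\<And>k j. k < m \<Longrightarrow> j < m \<Longrightarrow> map_poly (gal k) f * conj_poly_mat w $$ (k, j) =
      (\<Sum>i<m. conj_poly_mat w $$ (k, i) * N $$ (i, j))"
proof -
  have "\<forall>x\<in>O_K. \<forall>j<m. \<exists>c::nat \<Rightarrow> int. x * w j = (\<Sum>i<m. of_int (c i) * w i)"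
    using w by (auto intro: O_K.mult_mem)
  then obtain M :: "complex \<Rightarrow> nat \<Rightarrow> nat \<Rightarrow> int" where
    M: "\<And>x j. x \<in> O_K \<Longrightarrow> j < m \<Longrightarrow> x * w j = (\<Sum>i<m. of_int (M x j i) * w i)"
    by metis
  \<comment> \<open>\<open>map_poly\<close> acts coefficientwise only for a function fixing 0, and
    the coordinates that \<open>M\<close> selects for 0 need not vanish, as \<open>w\<close> is not
    assumed independent.\<close>
  define \<mu> where "\<mu> i j x = (if x = 0 then 0 else of_int (M x j i) :: complex)" for i j x
  have \<mu>: "x * w j = (\<Sum>i<m. \<mu> i j x * w i)" if "x \<in> O_K" "j < m" for x j
  proof (cases "x = 0")
    case False
    then show ?thesis
      using M[OF that] by (simp add: \<mu>_def)
  qed (simp add: \<mu>_def)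
  define N where "N = mat m m (\<lambda>(i, j). map_poly (\<mu> i j) f)"
  have N: "N $$ (i, j) = map_poly (\<mu> i j) f" if "i < m" "j < m" for i j
    using that by (simp add: N_def)
  have coeff_N: "coeff (map_poly (\<mu> i j) f) n = \<mu> i j (coeff f n)" for i j n
    by (rule coeff_map_poly) (simp add: \<mu>_def)
  show ?thesis
  proof (rule that[of N])
    show "N \<in> carrier_mat m m"
      by (simp add: N_def)
    show "N $$ (i, j) \<in> polys_over \<int>" if "i < m" "j < m" for i j
      unfolding N[OF that] polys_over_def by (auto simp: coeff_N) (auto simp: \<mu>_def)
    fix k j assume kj: "k < m" "j < m"
    interpret subfield_hom K "gal k"
      using kj(1) by (rule gal_hom)
    show "map_poly (gal k) f * conj_poly_mat w $$ (k, j) = (\<Sum>i<m. conj_poly_mat w $$ (k, i) * N $$ (i, j))"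
    proof (rule poly_eqI)
      fix n
      have fn: "coeff f n \<in> O_K"
        using f by (rule coeff_polys_over)
      have \<mu>Z: "\<mu> i j x \<in> \<int>" for i x
        by (simp add: \<mu>_def)
      have \<mu>h: "\<mu> i j x \<in> K" "gal k (\<mu> i j x) = \<mu> i j x" for i x
      proof -
        obtain z where z: "\<mu> i j x = of_int z"
          using \<mu>Z[of i x] by (rule Ints_cases)
        show "\<mu> i j x \<in> K" "gal k (\<mu> i j x) = \<mu> i j x"
          unfolding z by (simp_all add: K.of_int_mem hom_of_int)
      qed
      have wK: "w i \<in> K" if "i < m" for i
        using w(1)[OF that] by (simp add: O_K_iff)
      have "coeff (map_poly (gal k) f * conj_poly_mat w $$ (k, j)) n = gal k (coeff f n) * gal k (w j)"
        using kj by (simp add: conj_poly_mat_index coeff_map_poly[of "gal k"] hom_zero)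
      also have "\<dots> = gal k (coeff f n * w j)"
        using fn wK kj by (simp add: hom_mult O_K_iff)
      also have "\<dots> = (\<Sum>i<m. \<mu> i j (coeff f n) * gal k (w i))"
      proof -
        have "gal k (\<Sum>i<m. \<mu> i j (coeff f n) * w i) = (\<Sum>i<m. gal k (\<mu> i j (coeff f n) * w i))"
          using wK \<mu>h(1) by (intro hom_sum K.mult_mem) auto
        then show ?thesis
          unfolding \<mu>[OF fn kj(2)] using wK \<mu>h by (simp add: hom_mult)
      qed
      also have "\<dots> = coeff (\<Sum>i<m. conj_poly_mat w $$ (k, i) * N $$ (i, j)) n"
        unfolding coeff_sum using kj by (intro sum.cong) (auto simp: conj_poly_mat_index N coeff_N)
      finally show "coeff (map_poly (gal k) f * conj_poly_mat w $$ (k, j)) n =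
          coeff (\<Sum>i<m. conj_poly_mat w $$ (k, i) * N $$ (i, j)) n" .
    qed
  qed
qed

text \<open>Up to sign, the lower coefficients are elementary symmetric functions of the
  \<open>y k\<close>, so each of their terms has a factor in the radical.\<close>

lemma coeff_prod_linear_nil_rad:
  assumes p: "prime p" and "finite A" "\<And>k. k \<in> A \<Longrightarrow> y k \<in> nil_rad p"
  shows "(\<Prod>k\<in>A. [:- y k, 1:]) \<in> polys_over O_K \<and> (\<forall>j<card A. coeff (\<Prod>k\<in>A. [:- y k, 1:]) j \<in> nil_rad p)"
  using assms(2,3)
proof (induction A rule: finite_induct)
  case empty
  then show ?case
    by (simp add: comm_subring.one_mem[OF O_K.comm_subring_polys_over])
next
  case (insert k A)
  let ?q = "\<Prod>k\<in>A. [:- y k, 1:]"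
  interpret OX: comm_subring "polys_over O_K"
    by (rule O_K.comm_subring_polys_over)
  have q: "?q \<in> polys_over O_K" "\<And>j. j < card A \<Longrightarrow> coeff ?q j \<in> nil_rad p"
    using insert by auto
  have y: "y k \<in> nil_rad p"
    using insert by simp
  have eq: "(\<Prod>k\<in>insert k A. [:- y k, 1:]) = pCons 0 ?q - smult (y k) ?q"
    using insert by simp
  have "coeff (pCons 0 ?q - smult (y k) ?q) j \<in> nil_rad p" if j: "j < Suc (card A)" for j
  proof -
    have "coeff (pCons 0 ?q) j \<in> nil_rad p"
      using q j nil_rad_zero[OF p] by (cases j) auto
    moreover have "y k * coeff ?q j \<in> nil_rad p"
      using y q by (intro nil_rad_mult coeff_polys_over)
    ultimately show ?thesis
      using nil_rad_diff[OF p] by simp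
  qed
  moreover have "pCons 0 ?q - smult (y k) ?q \<in> polys_over O_K"
    using q(1) nil_rad_O_K[OF y]
    by (intro OX.diff_mem O_K.smult_polys_over) (auto simp: O_K.pCons_polys_over O_K.zero_mem)
  ultimately show ?case
    unfolding eq using insert.hyps by simp
qed

text \<open>The characteristic polynomial \<open>h\<close> has two descriptions. As the determinant
  of \<open>X - N\<close> it has integer coefficients; as the product over the conjugates of
  \<open>x\<close> its lower coefficients lie in the radical. Integers in the radical are multiples
  of \<open>p\<close>. The identity automorphism makes \<open>x\<close> a root of \<open>h\<close>,
  and solving for \<open>x^m\<close> gives the claim.\<close>

lemma nil_rad_power_m:
  assumes p: "prime p" and x: "x \<in> nil_rad p"
  shows "O_K.cong_mod (of_nat p) (x ^ m) 0"
proof -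
  have xO: "[:x:] \<in> polys_over O_K"
    using nil_rad_O_K[OF x] by (simp add: O_K.pCons_polys_over comm_subring.zero_mem[OF O_K.comm_subring_polys_over])
  obtain N where N: "N \<in> carrier_mat m m" "\<And>i j. i < m \<Longrightarrow> j < m \<Longrightarrow> N $$ (i, j) \<in> polys_over \<int>"
    "\<And>k j. k < m \<Longrightarrow> j < m \<Longrightarrow> map_poly (gal k) [:x:] * conj_poly_mat \<omega> $$ (k, j) =
      (\<Sum>i<m. conj_poly_mat \<omega> $$ (k, i) * N $$ (i, j))"
    using ex_multiplication_matrix[OF \<omega>_O_K \<omega>_coordinates xO] by blast
  define h where "h = (\<Prod>k<m. [:- gal k x, 1:])"
  have map_const: "map_poly (gal k) [:x:] = [:gal k x:]" if "k < m" for k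
    using subfield_hom.hom_zero[OF gal_hom[OF that]] by (simp add: Polynomial.map_poly_pCons)
  have "det ([:0, 1:] \<cdot>\<^sub>m 1\<^sub>m m - N) = (\<Prod>k<m. [:0, 1:] - map_poly (gal k) [:x:])"
    by (rule det_shift_eq_prod[OF conj_poly_mat_carrier det_conj_poly_mat[OF spanning_\<omega>] N(1,3)])
  also have "\<dots> = h"
    unfolding h_def by (intro prod.cong) (auto simp: map_const)
  finally have h: "h = det ([:0, 1:] \<cdot>\<^sub>m 1\<^sub>m m - N)" ..
  interpret Z: comm_subring "\<int> :: complex set"
    by (rule comm_subring_Ints)
  interpret ZX: comm_subring "polys_over (\<int> :: complex set)"
    by (rule Z.comm_subring_polys_over)
  have X: "[:0, 1:] \<in> polys_over (\<int> :: complex set)"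
    by (auto simp: Z.pCons_polys_over ZX.zero_mem)
  have "h \<in> polys_over \<int>"
    unfolding h
  proof (rule ZX.det_mem)
    show "[:0, 1:] \<cdot>\<^sub>m 1\<^sub>m m - N \<in> carrier_mat m m"
      using N(1) by (rule minus_carrier_mat)
    show "([:0, 1:] \<cdot>\<^sub>m 1\<^sub>m m - N) $$ (i, j) \<in> polys_over \<int>" if "i < m" "j < m" for i j
    proof -
      have "([:0, 1:] \<cdot>\<^sub>m 1\<^sub>m m - N) $$ (i, j) = (if i = j then [:0, 1:] else 0) - N $$ (i, j)"
        using that N(1) by simp
      then show ?thesis
        using ZX.diff_mem[OF X N(2)[OF that]] ZX.diff_mem[OF ZX.zero_mem N(2)[OF that]]
        by (cases "i = j") (simp_all only: simp_thms if_True if_False)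
    qed
  qed
  moreover have "coeff h j \<in> nil_rad p" if "j < m" for j
    using coeff_prod_linear_nil_rad[OF p, of "{..<m}" "\<lambda>k. gal k x"] nil_rad_gal[OF _ x] that
    unfolding h_def by auto
  ultimately have "\<exists>b. coeff h j = of_int (int p * b)" if "j < m" for j
    using nil_rad_Ints[OF p, of "coeff h j"] coeff_polys_over[of h \<int> j] that by metis
  then obtain b where b: "\<And>j. j < m \<Longrightarrow> coeff h j = of_int (int p * b j)"
    by metis
  have deg: "degree h = m" and lead: "coeff h m = 1"
  proof -
    show "degree h = m"
      unfolding h_def by (subst degree_prod_eq_sum_degree) auto
    then show "coeff h m = 1"
      using lead_coeff_prod[of "\<lambda>k. [:- gal k x, 1:]" "{..<m}"] unfolding h_def by simp
  qed
  obtain k where "k < m" "gal k = id"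
    using ex_gal[OF id_Gal] by blast
  then have "poly h x = 0"
    unfolding h_def poly_prod by (intro prod_zero bexI[of _ k]) auto
  then have "0 = (\<Sum>j\<le>m. coeff h j * x ^ j)"
    by (simp add: poly_altdef deg)
  also have "{..m} = insert m {..<m}"
    by auto
  also have "(\<Sum>j\<in>insert m {..<m}. coeff h j * x ^ j) = x ^ m + (\<Sum>j<m. of_int (int p * b j) * x ^ j)"
    using lead b by simp
  finally have "x ^ m - 0 = of_nat p * - (\<Sum>j<m. of_int (b j) * x ^ j)"
    by (simp add: sum_distrib_left mult.assoc eq_neg_iff_add_eq_0)
  then show ?thesis
    using nil_rad_O_K[OF x]
    by (intro O_K.cong_modI[of "- (\<Sum>j<m. of_int (b j) * x ^ j)"])
      (auto intro!: O_K.uminus_mem O_K.sum_mem O_K.mult_mem O_K.of_int_mem O_K.power_mem)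
qed

text \<open>Let \<open>f = \<Sum>\<^sub>i \<alpha>\<^sub>i X\<^sup>i\<close> and let \<open>N\<close> be its multiplication matrix. Modulo \<open>p\<close>,
  \<open>\<Prod>\<^sub>\<sigma> (f\<^sup>p - \<sigma>f(X\<^sup>p)) = det (f\<^sup>p - N(X\<^sup>p)) \<equiv> det (f - N)\<^sup>p = 0\<close>. The indeterminate \<open>X\<close> forces
  one \<open>\<sigma>\<close> to work for all roots at once.\<close>

lemma Frobenius_element:
  assumes p: "prime p" and P: "O_K.prime_in P" "of_nat p \<in> P"
  shows "\<exists>\<sigma>\<in>Gal. \<forall>i<d. \<alpha> i ^ p - \<sigma> (\<alpha> i) \<in> P"
proof -
  have p0: "p > 0"
    using p prime_gt_0_nat by blast
  define f where "f = (\<Sum>i<d. monom (\<alpha> i) i)"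
  have coeff_f: "coeff f i = (if i < d then \<alpha> i else 0)" for i
    by (simp add: f_def coeff_sum)
  have f: "f \<in> polys_over O_K"
    using \<alpha>_K algebraic_int_\<alpha> O_K.zero_mem by (simp add: polys_over_def coeff_f O_K_iff)
  obtain N where N: "N \<in> carrier_mat m m" "\<And>i j. i < m \<Longrightarrow> j < m \<Longrightarrow> N $$ (i, j) \<in> polys_over \<int>"
    "\<And>k j. k < m \<Longrightarrow> j < m \<Longrightarrow> map_poly (gal k) f * conj_poly_mat \<omega> $$ (k, j) =
      (\<Sum>i<m. conj_poly_mat \<omega> $$ (k, i) * N $$ (i, j))"
    using ex_multiplication_matrix[OF \<omega>_O_K \<omega>_coordinates f] by blast
  let ?X = "monom (1 :: complex) p"
  interpret OX: comm_subring "polys_over O_K"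
    by (rule O_K.comm_subring_polys_over)
  have X: "?X \<in> polys_over O_K"
    by (intro O_K.monom_polys_over O_K.one_mem)
  have ZO: "polys_over \<int> \<subseteq> polys_over O_K"
    by (intro polys_over_mono subsetI O_K.Ints_mem)
  define N' where "N' = map_mat (\<lambda>g. pcompose g ?X) N"
  have N': "N' \<in> carrier_mat m m" "\<And>i j. i < m \<Longrightarrow> j < m \<Longrightarrow> N' $$ (i, j) = pcompose (N $$ (i, j)) ?X"
    using N(1) by (auto simp: N'_def)
  define \<phi> where "\<phi> k = map_poly (gal k) f" for k
  have coeff_\<phi>: "coeff (\<phi> k) i = gal k (coeff f i)" if "k < m" for k i
    unfolding \<phi>_def using subfield_hom.hom_zero[OF gal_hom[OF that]] by (rule coeff_map_poly)
  have \<phi>_O: "\<phi> k \<in> polys_over O_K" if "k < m" for k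
    unfolding polys_over_def using that coeff_\<phi> gal_O_K coeff_polys_over[OF f] by auto
  let ?A = "f \<cdot>\<^sub>m 1\<^sub>m m - N" and ?B = "f ^ p \<cdot>\<^sub>m 1\<^sub>m m - N'"
  have A: "?A \<in> carrier_mat m m" "\<And>i j. i < m \<Longrightarrow> j < m \<Longrightarrow> ?A $$ (i, j) = (if i = j then f else 0) - N $$ (i, j)"
    using N(1) by (auto intro: minus_carrier_mat)
  have B: "?B \<in> carrier_mat m m" "\<And>i j. i < m \<Longrightarrow> j < m \<Longrightarrow> ?B $$ (i, j) = (if i = j then f ^ p else 0) - N' $$ (i, j)"
    using N'(1) by (auto intro: minus_carrier_mat)
  have NO: "N $$ (i, j) \<in> polys_over O_K" "N' $$ (i, j) \<in> polys_over O_K" if "i < m" "j < m" for i j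
  proof -
    show "N $$ (i, j) \<in> polys_over O_K"
      using N(2)[OF that] ZO by blast
    then show "N' $$ (i, j) \<in> polys_over O_K"
      unfolding N'(2)[OF that] using X by (rule O_K.pcompose_polys_over)
  qed
  have "det ?A = (\<Prod>k<m. f - \<phi> k)"
    unfolding \<phi>_def
    by (rule det_shift_eq_prod[OF conj_poly_mat_carrier det_conj_poly_mat[OF spanning_\<omega>] N(1,3)])
  also have "\<dots> = 0"
  proof -
    \<comment> \<open>The identity automorphism contributes the factor \<open>f - f\<close>.\<close>
    obtain k where k: "k < m" "gal k = id"
      using ex_gal[OF id_Gal] by blast
    have "\<phi> k = f"
      using coeff_\<phi>[OF k(1)] k(2) by (intro poly_eqI) simp
    then show ?thesis
      using k(1) by (intro prod_zero) auto
  qed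
  finally have detA: "det ?A = 0" .
  have "OX.cong_mod (of_nat p) (det ?A ^ p) (det ?B)"
  proof (rule OX.cong_mod_det_power[OF p A(1) B(1)])
    fix i j assume ij: "i < m" "j < m"
    have f01: "(if i = j then f else 0) \<in> polys_over O_K" "(if i = j then f ^ p else 0) \<in> polys_over O_K"
      using f OX.zero_mem OX.power_mem by auto
    show "?A $$ (i, j) \<in> polys_over O_K" "?B $$ (i, j) \<in> polys_over O_K"
      unfolding A(2)[OF ij] B(2)[OF ij] using f01 NO[OF ij] by (blast intro: OX.diff_mem)+
    have "OX.cong_mod (of_nat p) (((if i = j then f else 0) - N $$ (i, j)) ^ p)
        ((if i = j then f else 0) ^ p - N $$ (i, j) ^ p)"
      using f01 NO[OF ij] by (intro OX.cong_mod_freshman_diff p)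
    moreover have "OX.cong_mod (of_nat p) ((if i = j then f else 0) ^ p - N $$ (i, j) ^ p)
        ((if i = j then f ^ p else 0) - N' $$ (i, j))"
    proof (rule OX.cong_mod_diff)
      show "OX.cong_mod (of_nat p) ((if i = j then f else 0) ^ p) (if i = j then f ^ p else 0)"
        using p0 by (auto simp: power_0_left OX.cong_mod_refl)
      \<comment> \<open>The entries of \<open>N\<close> have integer coefficients, which the
        \<open>p\<close>-th power fixes modulo \<open>p\<close> by Fermat, so only the variable
        changes.\<close>
      have "OX.cong_mod (of_nat p) (N $$ (i, j) ^ p) (pcompose (map_poly (\<lambda>x. x) (N $$ (i, j))) ?X)"
        using N(2)[OF ij] by (intro O_K.poly_power_prime_cong[of p _ \<int>] p)
          (auto intro: O_K.Ints_mem O_K.cong_mod_fermat[OF p] elim!: Ints_cases)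
      then show "OX.cong_mod (of_nat p) (N $$ (i, j) ^ p) (N' $$ (i, j))"
        using N'(2)[OF ij] by (simp add: map_poly_idI)
    qed
    ultimately show "OX.cong_mod (of_nat p) (?A $$ (i, j) ^ p) (?B $$ (i, j))"
      unfolding A(2)[OF ij] B(2)[OF ij] by (rule OX.cong_mod_trans)
  qed
  then have B0: "OX.cong_mod (of_nat p) (det ?B) 0"
    using detA p0 OX.cong_mod_sym by (simp add: power_0_left)
  \<comment> \<open>Substituting \<open>X^p\<close> into the eigenvector relation of
    \<open>N\<close> leaves the constant entries of \<open>conj_poly_mat \<omega>\<close> alone, so
    the same vectors diagonalise \<open>N'\<close>.\<close>
  have detB: "det ?B = (\<Prod>k<m. f ^ p - pcompose (\<phi> k) ?X)"
  proof (rule det_shift_eq_prod[OF conj_poly_mat_carrier det_conj_poly_mat[OF spanning_\<omega>] N'(1)])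
    fix k j assume kj: "k < m" "j < m"
    have "pcompose (\<phi> k * conj_poly_mat \<omega> $$ (k, j)) ?X =
        pcompose (\<Sum>i<m. conj_poly_mat \<omega> $$ (k, i) * N $$ (i, j)) ?X"
      unfolding \<phi>_def N(3)[OF kj] ..
    then show "pcompose (\<phi> k) ?X * conj_poly_mat \<omega> $$ (k, j) = (\<Sum>i<m. conj_poly_mat \<omega> $$ (k, i) * N' $$ (i, j))"
      using kj by (simp add: pcompose_mult pcompose_sum conj_poly_mat_index N'(2) pcompose_smult)
  qed
  \<comment> \<open>The coefficients of \<open>f\<close> are not integers, so here the power has to
    be applied to them as well. Replacing \<open>f^p\<close> by \<open>g(X^p)\<close> makes every
    factor a polynomial in \<open>X^p\<close>.\<close>
  define g where "g = map_poly (\<lambda>x. x ^ p) f"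
  have coeff_g: "coeff g i = coeff f i ^ p" for i
    unfolding g_def using p0 by (intro coeff_map_poly) (simp add: power_0_left)
  have g_O: "g \<in> polys_over O_K"
    unfolding polys_over_def using coeff_g coeff_polys_over[OF f] O_K.power_mem by auto
  have "OX.cong_mod (of_nat p) (f ^ p) (pcompose g ?X)"
    unfolding g_def using f p0
    by (intro O_K.poly_power_prime_cong[of p _ O_K] p) (auto simp: power_0_left intro: O_K.power_mem O_K.cong_mod_refl)
  then have "OX.cong_mod (of_nat p) (\<Prod>k<m. f ^ p - pcompose (\<phi> k) ?X) (\<Prod>k<m. pcompose g ?X - pcompose (\<phi> k) ?X)"
    using f g_O \<phi>_O X
    by (intro OX.cong_mod_prod conjI OX.diff_mem OX.cong_mod_diff OX.cong_mod_refl OX.power_mem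
        O_K.pcompose_polys_over) auto
  then have "OX.cong_mod (of_nat p) (\<Prod>k<m. pcompose g ?X - pcompose (\<phi> k) ?X) 0"
    using B0 detB OX.cong_mod_trans OX.cong_mod_sym by metis
  then obtain c where c: "c \<in> polys_over O_K" "(\<Prod>k<m. pcompose g ?X - pcompose (\<phi> k) ?X) = of_nat p * c"
    by (elim OX.cong_modE) simp
  have idP: "O_K.ideal_in P"
    using P(1) by (simp add: O_K.prime_in_def)
  have "(\<Prod>k<m. pcompose g ?X - pcompose (\<phi> k) ?X) \<in> polys_over P"
    unfolding c(2) polys_over_def
    using O_K.ideal_inD(4)[OF idP P(2)] coeff_polys_over[OF c(1)] by (simp add: of_nat_poly)
  then obtain k where k: "k < m" "pcompose g ?X - pcompose (\<phi> k) ?X \<in> polys_over P"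
    using O_K.prime_in_polys_prod[OF P(1), of "{..<m}" "\<lambda>k. pcompose g ?X - pcompose (\<phi> k) ?X"]
      OX.diff_mem[OF O_K.pcompose_polys_over[OF g_O X] O_K.pcompose_polys_over[OF \<phi>_O X]] by auto
  \<comment> \<open>The difference is the coefficient of \<open>X^(p * i)\<close> in the factor that
    vanishes modulo \<open>P\<close>; the same \<open>k\<close> serves every
    \<open>i\<close>.\<close>
  have "\<alpha> i ^ p - gal k (\<alpha> i) \<in> P" if "i < d" for i
  proof -
    have "coeff (pcompose g ?X - pcompose (\<phi> k) ?X) (p * i) \<in> P"
      using k(2) by (rule coeff_polys_over)
    then show ?thesis
      using that by (simp add: coeff_pcompose_monom[OF p0] coeff_g coeff_\<phi>[OF k(1)] coeff_f)
  qed
  then show ?thesis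
    using gal_Gal[OF k(1)] by blast
qed

section \<open>Powers of the roots modulo the radical\<close>

lemma Gal_permutes_roots:
  assumes "\<sigma> \<in> Gal" "i < d"
  shows "\<exists>j<d. \<sigma> (\<alpha> i) = \<alpha> j"
proof -
  interpret subfield_hom K \<sigma>
    using assms(1) by (rule Gal_hom)
  have "poly C (\<alpha> i) = 0"
    using assms(2) by (auto simp: poly_C_eq_0_iff)
  then have "poly C (\<sigma> (\<alpha> i)) = 0"
    using hom_poly[OF Ints_le_Rats_polys[OF C_int] \<alpha>_K[OF assms(2)]] hom_zero by simp
  then show ?thesis
    by (auto simp: poly_C_eq_0_iff)
qed

lemma root_power_nil_rad:
  assumes p: "prime p" and i: "i < d" and t: "m dvd t"
  shows "\<alpha> i ^ (p ^ t) - \<alpha> i \<in> nil_rad p"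
proof (rule ccontr)
  assume not: "\<alpha> i ^ (p ^ t) - \<alpha> i \<notin> nil_rad p"
  have \<alpha>_O: "\<alpha> j \<in> O_K" if "j < d" for j
    using that \<alpha>_K algebraic_int_\<alpha> by (simp add: O_K_iff)
  let ?x = "\<alpha> i ^ (p ^ t) - \<alpha> i"
  have x: "?x \<in> O_K"
    using \<alpha>_O[OF i] by (intro O_K.diff_mem O_K.power_mem)
  have "\<not> O_K.cong_mod (of_nat p) (?x ^ n) 0" for n
  proof
    assume n: "O_K.cong_mod (of_nat p) (?x ^ n) 0"
    \<comment> \<open>Vanishing modulo \<open>p\<close> of an arbitrary power passes to a power with
      exponent \<open>p^n\<close>, as the definition of \<open>nil_rad\<close> demands.\<close>
    have "n \<le> p ^ n"
      using power_gt_expt[OF prime_gt_Suc_0_nat[OF p], of n] by simp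
    then have "?x ^ (p ^ n) = ?x ^ n * ?x ^ (p ^ n - n)"
      by (simp flip: power_add)
    then have "O_K.cong_mod (of_nat p) (?x ^ (p ^ n)) 0"
      using O_K.cong_mod_zero_mult[OF n] O_K.power_mem[OF x] by metis
    then show False
      using not x by (auto simp: nil_rad_def)
  qed
  then obtain P where P: "O_K.prime_in P" "of_nat p \<in> P" "?x \<notin> P"
    using O_K.ex_prime_avoiding[OF O_K.of_nat_mem x] by blast
  then have idP: "O_K.ideal_in P"
    by (simp add: O_K.prime_in_def)
  obtain \<sigma> where \<sigma>: "\<sigma> \<in> Gal" "\<And>j. j < d \<Longrightarrow> \<alpha> j ^ p - \<sigma> (\<alpha> j) \<in> P"
    using Frobenius_element[OF p P(1,2)] by blast
  \<comment> \<open>The congruence for \<open>\<sigma>\<close> is available at roots only, so the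
    induction records that the iterated image of \<open>\<alpha> i\<close> is again some root
    \<open>\<alpha> j\<close>.\<close>
  have "\<exists>j<d. (\<sigma> ^^ n) (\<alpha> i) = \<alpha> j \<and> \<alpha> i ^ (p ^ n) - \<alpha> j \<in> P" for n
  proof (induction n)
    case 0
    then show ?case
      using i O_K.ideal_inD(2)[OF idP] by auto
  next
    case (Suc n)
    then obtain j where j: "j < d" "(\<sigma> ^^ n) (\<alpha> i) = \<alpha> j" "\<alpha> i ^ (p ^ n) - \<alpha> j \<in> P"
      by blast
    obtain l where l: "l < d" "\<sigma> (\<alpha> j) = \<alpha> l"
      using Gal_permutes_roots[OF \<sigma>(1) j(1)] by blast
    have "(\<alpha> i ^ (p ^ n)) ^ p - \<alpha> j ^ p \<in> P"
      using j \<alpha>_O i by (intro O_K.ideal_in_power_diff[OF idP] O_K.power_mem) auto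
    then have "((\<alpha> i ^ (p ^ n)) ^ p - \<alpha> j ^ p) + (\<alpha> j ^ p - \<sigma> (\<alpha> j)) \<in> P"
      using \<sigma>(2)[OF j(1)] by (rule O_K.ideal_inD(3)[OF idP])
    then have "\<alpha> i ^ (p ^ Suc n) - \<alpha> l \<in> P"
      unfolding power_Suc2 power_mult l(2) by simp
    then show ?case
      using l j(2) by auto
  qed
  from this[of t] have "?x \<in> P"
    using Gal_funpow_eq_id[OF \<sigma>(1) t] by auto
  then show False
    using P(3) by simp
qed

end

section \<open>Binet's formula and the Dold condition\<close>

lemma int_prime_dvd_rad:
  assumes "prime p" "int p dvd D" "D \<noteq> 0"
  shows "int p dvd rad D"
proof -
  have "int p \<in> prime_factors D"
    using assms by (auto simp: in_prime_factors_iff)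
  then show ?thesis
    unfolding rad_def by (metis dvd_prodI finite_set_mset)
qed

text \<open>The factor \<open>\<epsilon>\<close> is the sign \<open>(-1)^(n(n-1)/2)\<close> from
  reversing each difference once. That it is an integer is enough: \<open>\<Delta>\<close> is then
  an integer multiple of the product over ordered pairs.\<close>

lemma disc_eq_prod_differences:
  fixes a :: "nat \<Rightarrow> 'a::idom"
  shows "\<exists>\<epsilon>::int. (\<Prod>j<n. \<Prod>i<j. (a i - a j)\<^sup>2) =
    of_int \<epsilon> * (\<Prod>i<n. \<Prod>j\<in>{..<n} - {i}. a i - a j)"
proof (induction n)
  case 0
  then show ?case
    by (intro exI[of _ 1]) simp
next
  case (Suc n)
  then obtain \<epsilon> :: int where \<epsilon>: "(\<Prod>j<n. \<Prod>i<j. (a i - a j)\<^sup>2) =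
      of_int \<epsilon> * (\<Prod>i<n. \<Prod>j\<in>{..<n} - {i}. a i - a j)"
    by blast
  have "(\<Prod>j\<in>{..<Suc n} - {i}. a i - a j) = (\<Prod>j\<in>{..<n} - {i}. a i - a j) * (a i - a n)" if "i < n" for i
  proof -
    have "{..<Suc n} - {i} = insert n ({..<n} - {i})"
      using that by auto
    then show ?thesis
      by (simp add: mult.commute)
  qed
  then have "(\<Prod>i<n. \<Prod>j\<in>{..<Suc n} - {i}. a i - a j) =
      (\<Prod>i<n. \<Prod>j\<in>{..<n} - {i}. a i - a j) * (\<Prod>i<n. a i - a n)"
    by (simp add: prod.distrib)
  moreover have "{..<Suc n} - {n} = {..<n}"
    by auto
  moreover have "(\<Prod>j<n. a n - a j) = (-1) ^ n * (\<Prod>i<n. a i - a n)"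
    using prod.distrib[of "\<lambda>_. -1" "\<lambda>i. a i - a n" "{..<n}"] by simp
  ultimately have "(\<Prod>i<Suc n. \<Prod>j\<in>{..<Suc n} - {i}. a i - a j) =
      (-1) ^ n * (\<Prod>i<n. \<Prod>j\<in>{..<n} - {i}. a i - a j) * (\<Prod>i<n. a i - a n)\<^sup>2"
    by (simp add: power2_eq_square)
  moreover have "(\<Prod>j<Suc n. \<Prod>i<j. (a i - a j)\<^sup>2) =
      of_int \<epsilon> * (\<Prod>i<n. \<Prod>j\<in>{..<n} - {i}. a i - a j) * (\<Prod>i<n. a i - a n)\<^sup>2"
    using \<epsilon> by (simp add: prod_power_distrib)
  moreover have "(-1) ^ n * ((-1) ^ n * y) = y" for y :: 'a
    by (simp flip: mult.assoc power_mult_distrib)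
  ultimately show ?case
    by (intro exI[of _ "\<epsilon> * (-1) ^ n"]) (simp add: mult_ac)
qed

context splitting_field
begin

lemma \<alpha>_O_K: "i < d \<Longrightarrow> \<alpha> i \<in> O_K"
  using \<alpha>_K algebraic_int_\<alpha> by (simp add: O_K_iff)

text \<open>With \<open>y = \<alpha> i ^ s\<close> and \<open>x = y^(p^t)\<close>, the difference
  \<open>x - y\<close> lies in the radical. If \<open>p\<close> does not divide the discriminant,
  \<open>x\<close> and \<open>y\<close> agree modulo \<open>p\<close>, and \<open>l * t\<close>
  liftings give \<open>p^(l*t+1)\<close>, which suffices as \<open>t \<ge> 1\<close>. Otherwise
  \<open>t\<close> powers of \<open>p\<close> are spent to reach agreement modulo \<open>p\<close>,
  and the remaining \<open>(l-1) * t\<close> liftings give at least \<open>p^l\<close>; the factor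
  \<open>rad\<close> supplies the last \<open>p\<close>.\<close>

lemma root_power_congruence:
  assumes p: "prime p" and i: "i < d" and t: "m dvd t" "t \<ge> 1"
  shows "O_K.cong_mod (of_nat p ^ Suc l)
    (of_int (rad (field_discriminant K)) * (\<alpha> i ^ s) ^ (p ^ (Suc l * t)))
    (of_int (rad (field_discriminant K)) * (\<alpha> i ^ s) ^ (p ^ (l * t)))"
proof -
  define D where "D = field_discriminant K"
  define y where "y = \<alpha> i ^ s"
  define x where "x = y ^ (p ^ t)"
  have y: "y \<in> O_K" and x: "x \<in> O_K"
    unfolding x_def y_def using \<alpha>_O_K[OF i] by (auto intro: O_K.power_mem)
  have xl: "(\<alpha> i ^ s) ^ (p ^ (Suc l * t)) = x ^ (p ^ (l * t))"
    by (simp add: x_def y_def power_add mult.assoc flip: power_mult)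
  have "(\<alpha> i ^ (p ^ t)) ^ s - \<alpha> i ^ s \<in> nil_rad p"
    using \<alpha>_O_K[OF i] by (intro O_K.ideal_in_power_diff ideal_in_nil_rad p root_power_nil_rad i t O_K.power_mem)
  then have xy: "x - y \<in> nil_rad p"
    by (simp add: x_def y_def mult.commute flip: power_mult)
  have cong_diff: "O_K.cong_mod q u v" if "O_K.cong_mod q (u - v) 0" for q u v
    using that by (simp add: O_K.cong_mod_def)
  have "O_K.cong_mod (of_nat p ^ Suc l) (of_int (rad D) * x ^ (p ^ (l * t))) (of_int (rad D) * y ^ (p ^ (l * t)))"
  proof (cases "int p dvd D")
    case False
    then have "O_K.cong_mod (of_nat p) x y"
      unfolding D_def by (rule cong_diff[OF nil_rad_unramified[OF p _ xy]])
    then have "O_K.cong_mod (of_nat p ^ Suc (l * t)) (x ^ (p ^ (l * t))) (y ^ (p ^ (l * t)))"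
      using x y by (rule O_K.cong_mod_lift_iterate)
    then have "O_K.cong_mod (of_nat p ^ Suc l) (x ^ (p ^ (l * t))) (y ^ (p ^ (l * t)))"
      by (rule O_K.cong_mod_power_le) (use t in \<open>auto intro: O_K.of_nat_mem\<close>)
    then show ?thesis
      using x by (intro O_K.cong_mod_mult O_K.cong_mod_refl O_K.of_int_mem O_K.power_mem)
  next
    case True
    then have "int p dvd rad D"
      using p field_discriminant_nonzero by (intro int_prime_dvd_rad) (auto simp: D_def)
    then obtain e where e: "rad D = int p * e"
      by (rule dvdE)
    have "O_K.cong_mod (of_nat p ^ l) (x ^ (p ^ (l * t))) (y ^ (p ^ (l * t)))"
    \<comment> \<open>For \<open>l = 0\<close> the modulus is 1. For \<open>l = j + 1\<close>, the
      exponent \<open>p^t\<close> is at least \<open>m\<close>, so \<open>(x - y)^(p^t)\<close> is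
      divisible by \<open>p\<close>; modulo \<open>p\<close> it is the difference of the powers,
      from which \<open>j * t\<close> liftings start.\<close>
    proof (cases l)
      case 0
      then show ?thesis
        using x y by (intro O_K.cong_modI[of "x ^ (p ^ (l * t)) - y ^ (p ^ (l * t))"])
          (auto intro: O_K.diff_mem)
    next
      case (Suc j)
      have "m \<le> t"
        using t by (intro dvd_imp_le) auto
      also have "t \<le> p ^ t"
        using power_gt_expt[OF prime_gt_Suc_0_nat[OF p], of t] by simp
      finally have "(x - y) ^ (p ^ t) = (x - y) ^ m * (x - y) ^ (p ^ t - m)"
        by (simp flip: power_add)
      then have zero: "O_K.cong_mod (of_nat p) ((x - y) ^ (p ^ t)) 0"
        using O_K.cong_mod_zero_mult[OF nil_rad_power_m[OF p xy] O_K.power_mem[OF O_K.diff_mem[OF x y]]]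
        by simp
      have "O_K.cong_mod (of_nat p) ((x - y) ^ (p ^ t)) (x ^ (p ^ t) - y ^ (p ^ t))"
        using p x y by (rule O_K.cong_mod_freshman_diff_power)
      then have "O_K.cong_mod (of_nat p) (x ^ (p ^ t)) (y ^ (p ^ t))"
        by (rule cong_diff[OF O_K.cong_mod_trans[OF O_K.cong_mod_sym zero]])
      then have "O_K.cong_mod (of_nat p ^ Suc (j * t)) ((x ^ (p ^ t)) ^ (p ^ (j * t))) ((y ^ (p ^ t)) ^ (p ^ (j * t)))"
        using x y by (intro O_K.cong_mod_lift_iterate O_K.power_mem)
      then have "O_K.cong_mod (of_nat p ^ l) ((x ^ (p ^ t)) ^ (p ^ (j * t))) ((y ^ (p ^ t)) ^ (p ^ (j * t)))"
        by (rule O_K.cong_mod_power_le) (use t Suc in \<open>auto intro: O_K.of_nat_mem\<close>)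
      then show ?thesis
        by (simp add: Suc power_add flip: power_mult)
    qed
    then obtain c where c: "c \<in> O_K" "x ^ (p ^ (l * t)) = y ^ (p ^ (l * t)) + of_nat p ^ l * c"
      by (elim O_K.cong_modE)
    show ?thesis
    proof (rule O_K.cong_modI)
      show "of_int e * c \<in> O_K"
        using c(1) by (intro O_K.mult_mem O_K.of_int_mem)
      show "of_int (rad D) * x ^ (p ^ (l * t)) - of_int (rad D) * y ^ (p ^ (l * t)) = of_nat p ^ Suc l * (of_int e * c)"
        unfolding e c(2) by (simp add: algebra_simps)
    qed
  qed
  then show ?thesis
    unfolding xl D_def y_def .
qed

text \<open>The value of the derivative of \<open>C\<close> at \<open>\<alpha> i\<close>.\<close>

definition root_diff :: "nat \<Rightarrow> complex" where
  "root_diff i = (\<Prod>j\<in>{..<d} - {i}. \<alpha> i - \<alpha> j)"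

lemma root_diff_nonzero: "i < d \<Longrightarrow> root_diff i \<noteq> 0"
  using inj_\<alpha> by (auto simp: root_diff_def inj_on_def)

lemma root_diff_O_K: "i < d \<Longrightarrow> root_diff i \<in> O_K"
  unfolding root_diff_def by (intro O_K.prod_mem O_K.diff_mem \<alpha>_O_K) auto

text \<open>Rewritten over the set of roots, the product is invariant under automorphisms by
  reindexing, since they permute this set. It is therefore rational, and it is an algebraic
  integer.\<close>

lemma prod_root_diff_Ints: "(\<Prod>i<d. root_diff i) \<in> \<int>"
proof -
  let ?A = "\<alpha> ` {..<d}"
  have O: "(\<Prod>i<d. root_diff i) \<in> O_K"
    by (intro O_K.prod_mem root_diff_O_K) auto
  have eq: "(\<Prod>i<d. root_diff i) = (\<Prod>x\<in>?A. \<Prod>y\<in>?A - {x}. x - y)"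
  proof -
    have "\<alpha> ` ({..<d} - {i}) = ?A - {\<alpha> i}" if "i < d" for i
      using inj_\<alpha> that by (auto simp: inj_on_def)
    moreover have "root_diff i = (\<Prod>y\<in>\<alpha> ` ({..<d} - {i}). \<alpha> i - y)" for i
      unfolding root_diff_def by (subst prod.reindex) (auto intro: inj_on_subset[OF inj_\<alpha>])
    ultimately show ?thesis
      by (simp add: prod.reindex[OF inj_\<alpha>])
  qed
  have "\<sigma> (\<Prod>i<d. root_diff i) = (\<Prod>i<d. root_diff i)" if \<sigma>: "\<sigma> \<in> Gal" for \<sigma>
  proof -
    interpret subfield_hom K \<sigma>
      using \<sigma> by (rule Gal_hom)
    have AK: "x \<in> K" if "x \<in> ?A" for x
      using that \<alpha>_K by auto
    have "\<sigma> ` ?A \<subseteq> ?A"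
      using Gal_permutes_roots[OF \<sigma>] by force
    then have img: "\<sigma> ` ?A = ?A"
      using Gal_inj[OF \<sigma>] by (intro endo_inj_surj) (auto intro: inj_on_subset)
    have "\<sigma> (\<Prod>x\<in>?A. \<Prod>y\<in>?A - {x}. x - y) = (\<Prod>x\<in>?A. \<sigma> (\<Prod>y\<in>?A - {x}. x - y))"
      using AK by (intro hom_prod K.prod_mem K.diff_mem) auto
    also have "\<dots> = (\<Prod>x\<in>?A. \<Prod>y\<in>?A - {x}. \<sigma> (x - y))"
      using AK by (intro prod.cong refl hom_prod K.diff_mem) auto
    also have "\<dots> = (\<Prod>x\<in>?A. \<Prod>y\<in>?A - {x}. \<sigma> x - \<sigma> y)"
      using AK by (intro prod.cong refl hom_diff) auto
    also have "\<dots> = (\<Prod>x\<in>?A. \<Prod>y\<in>\<sigma> ` (?A - {x}). \<sigma> x - y)"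
    proof (rule prod.cong[OF refl])
      fix x
      have "inj_on \<sigma> (?A - {x})"
        using Gal_inj[OF \<sigma>] by (rule inj_on_subset) simp
      then show "(\<Prod>y\<in>?A - {x}. \<sigma> x - \<sigma> y) = (\<Prod>y\<in>\<sigma> ` (?A - {x}). \<sigma> x - y)"
        by (simp add: prod.reindex)
    qed
    also have "\<dots> = (\<Prod>x\<in>?A. \<Prod>y\<in>?A - {\<sigma> x}. \<sigma> x - y)"
      using image_set_diff[OF Gal_inj[OF \<sigma>]] img by simp
    also have "\<dots> = (\<Prod>x\<in>\<sigma> ` ?A. \<Prod>y\<in>?A - {x}. x - y)"
      using Gal_inj[OF \<sigma>] by (subst prod.reindex) (auto intro: inj_on_subset)
    finally show ?thesis
      unfolding eq img .
  qed
  then have "(\<Prod>i<d. root_diff i) \<in> \<rat>"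
    using O by (intro Gal_fixed_Rats) (auto simp: O_K_iff)
  then show ?thesis
    using O O_K_Rats by blast
qed

text \<open>The quotient of \<open>C\<close> by \<open>X - \<alpha> i\<close>. It is left
  unnormalised so that its coefficients stay in \<open>O_K\<close>; the normalising factor
  \<open>root_diff i\<close> is kept as an explicit denominator.\<close>

definition lagrange_poly :: "nat \<Rightarrow> complex poly" where
  "lagrange_poly i = (\<Prod>j\<in>{..<d} - {i}. [:- \<alpha> j, 1:])"

lemma lagrange_poly_O_K: "lagrange_poly i \<in> polys_over O_K"
proof -
  interpret OX: comm_subring "polys_over O_K"
    by (rule O_K.comm_subring_polys_over)
  show ?thesis
    unfolding lagrange_poly_def using \<alpha>_O_K
    by (intro OX.prod_mem) (auto simp: O_K.pCons_polys_over OX.one_mem OX.zero_mem O_K.one_mem O_K.uminus_mem)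
qed

lemma poly_lagrange_poly:
  assumes "i < d" "k < d"
  shows "poly (lagrange_poly i) (\<alpha> k) = (if i = k then root_diff i else 0)"
  using assms by (auto simp: lagrange_poly_def root_diff_def poly_prod)

text \<open>Since \<open>n < d\<close>, interpolating \<open>X^n\<close> at the \<open>d\<close>
  roots returns \<open>X^n\<close>; comparing coefficients gives the inverse of the Vandermonde
  matrix explicitly.\<close>

lemma lagrange_interpolation:
  assumes "n < d"
  shows "(\<Sum>i<d. \<alpha> i ^ n / root_diff i * coeff (lagrange_poly i) l) = (if n = l then 1 else 0)"
proof -
  let ?q = "\<Sum>i<d. smult (\<alpha> i ^ n / root_diff i) (lagrange_poly i)"
  have "monom 1 n = ?q"
  proof (rule poly_eqI_degree)
    show "poly (monom 1 n) x = poly ?q x" if x: "x \<in> \<alpha> ` {..<d}" for x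
    proof -
      obtain k where k: "k < d" "x = \<alpha> k"
        using x by auto
      have "poly ?q x = (\<Sum>i<d. if i = k then \<alpha> k ^ n else 0)"
        unfolding poly_sum k(2) using k(1)
        by (intro sum.cong) (auto simp: poly_lagrange_poly root_diff_nonzero)
      then show ?thesis
        using k by (simp add: poly_monom)
    qed
    have card: "card (\<alpha> ` {..<d}) = d"
      using inj_\<alpha> by (simp add: card_image)
    then show "degree (monom 1 n :: complex poly) < card (\<alpha> ` {..<d})"
      using assms by (simp add: degree_monom_eq)
    have "degree (lagrange_poly i) = d - 1" if "i < d" for i
      unfolding lagrange_poly_def using that by (subst degree_prod_eq_sum_degree) auto
    then have "degree ?q \<le> d - 1"
      by (intro degree_sum_le) (auto intro: order_trans[OF degree_smult_le])
    then show "degree ?q < card (\<alpha> ` {..<d})"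
      using assms card by simp
  qed
  then have "coeff (monom 1 n) l = coeff ?q l"
    by simp
  then show ?thesis
    by (simp add: coeff_sum eq_commute)
qed

text \<open>The explicit inverse of the Vandermonde matrix shows that the coefficient of
  \<open>\<alpha> i ^ n\<close> has no denominator other than \<open>root_diff i\<close>, which the
  product of all the \<open>root_diff\<close> clears.\<close>

lemma binet_formula:
  fixes U :: "nat \<Rightarrow> int" and r :: "nat \<Rightarrow> int"
  assumes U: "\<And>n. n \<ge> d \<Longrightarrow> U n = (\<Sum>i=1..d. r i * U (n - i))"
    and C: "C = monom 1 d - (\<Sum>i=1..d. monom (of_int (r i)) (d - i))"
  shows "\<exists>\<gamma>. (\<forall>i<d. \<gamma> i \<in> O_K) \<and>
    (\<forall>n. (\<Prod>i<d. root_diff i) * of_int (U n) = (\<Sum>i<d. \<gamma> i * \<alpha> i ^ n))"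
proof -
  \<comment> \<open>The solution of the linear system that matches the initial values
    \<open>U 0\<close>, ..., \<open>U (d - 1)\<close>; both sides then obey the same
    recurrence.\<close>
  define c where "c i = (\<Sum>l<d. coeff (lagrange_poly i) l * of_int (U l)) / root_diff i" for i
  have rec: "\<alpha> k ^ n = (\<Sum>i=1..d. of_int (r i) * \<alpha> k ^ (n - i))" if k: "k < d" and n: "n \<ge> d" for k n
  proof -
    have "poly C (\<alpha> k) = 0"
      using k by (auto simp: poly_C_eq_0_iff)
    then have "\<alpha> k ^ d = (\<Sum>i=1..d. of_int (r i) * \<alpha> k ^ (d - i))"
      by (simp add: C poly_sum poly_monom)
    then have "\<alpha> k ^ (n - d) * \<alpha> k ^ d = (\<Sum>i=1..d. of_int (r i) * (\<alpha> k ^ (n - d) * \<alpha> k ^ (d - i)))"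
      by (simp add: sum_distrib_left mult_ac)
    also have "\<dots> = (\<Sum>i=1..d. of_int (r i) * \<alpha> k ^ (n - i))"
      using n by (intro sum.cong) (auto simp flip: power_add)
    finally show ?thesis
      using n by (simp flip: power_add)
  qed
  have binet: "of_int (U n) = (\<Sum>i<d. c i * \<alpha> i ^ n)" for n
  proof (induction n rule: less_induct)
    case (less n)
    show ?case
    proof (cases "n < d")
      case True
      have "(\<Sum>i<d. c i * \<alpha> i ^ n) =
          (\<Sum>i<d. \<Sum>l<d. of_int (U l) * (\<alpha> i ^ n / root_diff i * coeff (lagrange_poly i) l))"
        unfolding c_def sum_divide_distrib sum_distrib_right
        by (intro sum.cong refl) (simp add: mult_ac)
      also have "\<dots> = (\<Sum>l<d. of_int (U l) * (\<Sum>i<d. \<alpha> i ^ n / root_diff i * coeff (lagrange_poly i) l))"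
        by (subst sum.swap) (simp add: sum_distrib_left)
      also have "\<dots> = (\<Sum>l<d. if n = l then of_int (U l) else 0)"
        unfolding lagrange_interpolation[OF True] by (intro sum.cong) auto
      finally show ?thesis
        using True by simp
    next
      case False
      then have "of_int (U n) = (\<Sum>j=1..d. of_int (r j) * (of_int (U (n - j)) :: complex))"
        using U[of n] by simp
      also have "\<dots> = (\<Sum>j=1..d. of_int (r j) * (\<Sum>i<d. c i * \<alpha> i ^ (n - j)))"
        using False by (intro sum.cong) (auto simp: less.IH)
      also have "\<dots> = (\<Sum>i<d. c i * (\<Sum>j=1..d. of_int (r j) * \<alpha> i ^ (n - j)))"
        unfolding sum_distrib_left by (subst sum.swap) (simp add: mult_ac)
      also have "\<dots> = (\<Sum>i<d. c i * \<alpha> i ^ n)"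
        using rec[of _ n] False by (intro sum.cong) (simp_all only: lessThan_iff not_less)
      finally show ?thesis .
    qed
  qed
  define \<gamma> where "\<gamma> i = (\<Prod>i<d. root_diff i) * c i" for i
  have "\<gamma> i \<in> O_K" if i: "i < d" for i
  proof -
    have "(\<Prod>i<d. root_diff i) = root_diff i * (\<Prod>j\<in>{..<d} - {i}. root_diff j)"
      using i by (subst prod.remove[of _ i]) auto
    then have "\<gamma> i = (\<Prod>j\<in>{..<d} - {i}. root_diff j) * (\<Sum>l<d. coeff (lagrange_poly i) l * of_int (U l))"
      using root_diff_nonzero[OF i] by (simp add: \<gamma>_def c_def)
    also have "\<dots> \<in> O_K"
      using root_diff_O_K coeff_polys_over[OF lagrange_poly_O_K]
      by (intro O_K.mult_mem O_K.prod_mem O_K.sum_mem O_K.of_int_mem) auto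
    finally show ?thesis .
  qed
  moreover have "(\<Prod>i<d. root_diff i) * of_int (U n) = (\<Sum>i<d. \<gamma> i * \<alpha> i ^ n)" for n
    by (simp add: binet \<gamma>_def sum_distrib_left mult.assoc)
  ultimately show ?thesis
    by blast
qed

end

section \<open>The Dold condition from congruences at prime powers\<close>

lemma moebius_mu_prime_mult:
  assumes p: "prime p" and e: "\<not> p dvd e" "e > 0"
  shows "moebius_mu (p * e) = - moebius_mu e"
proof -
  have cop: "Rings.coprime p e"
    using p e by (simp add: prime_imp_coprime)
  have "squarefree (p * e) \<longleftrightarrow> squarefree e"
    using squarefree_mult_coprime[OF cop squarefree_prime[OF p]] squarefree_multD[of p e]
    by blast
  moreover have "prime_factors (p * e) = insert p (prime_factors e)"
    using p e prime_factors_product[of p e] prime_prime_factors[OF p] by (auto simp: prime_gt_0_nat)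
  moreover have "p \<notin> prime_factors e"
    using e by (auto simp: in_prime_factors_iff)
  ultimately show ?thesis
    by (simp add: moebius_mu_def)
qed

text \<open>Write \<open>n = p^(l+1) * s\<close> with \<open>s\<close> prime to \<open>p\<close>.
  Divisors divisible by \<open>p^2\<close> have Moebius value 0; the others come in pairs
  \<open>e\<close>, \<open>p * e\<close> with \<open>e\<close> dividing \<open>s\<close> and
  opposite signs, so the sum is a combination of the differences in the hypothesis, taken at
  \<open>s div e\<close>.\<close>

lemma dold_condition_from_prime_powers:
  assumes A: "\<And>p l s. prime p \<Longrightarrow> s \<ge> 1 \<Longrightarrow> int p ^ Suc l dvd A (p ^ Suc l * s) - A (p ^ l * s)"
  shows "dold_condition A"
  unfolding dold_condition_def
proof (intro allI impI)
  fix n :: nat assume n: "n \<ge> 1"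
  define S where "S = (\<Sum>d | d dvd n. moebius_mu d * A (n div d))"
  have pp: "int p ^ multiplicity p n dvd S" if p: "prime p" for p
  proof (cases "multiplicity p n")
    case 0
    then show ?thesis
      by simp
  next
    case (Suc l)
    obtain s where s: "n = p ^ Suc l * s" "\<not> p dvd s"
      using multiplicity_decompose'[of n p] n p Suc not_prime_unit by (metis not_one_le_zero)
    have s0: "s > 0"
      using s n by (auto intro!: Nat.gr0I)
    have p0: "p > 0"
      using p prime_gt_0_nat by blast
    let ?D1 = "{e. e dvd s}"
    let ?f = "\<lambda>d. moebius_mu d * A (n div d)"
    have fin: "finite ?D1" "finite {d. d dvd n}"
      using s0 n by auto
    have not_p: "\<not> p dvd e" "e > 0" if "e dvd s" for e
      using that s(2) s0 by (auto intro: dvd_trans intro!: Nat.gr0I)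
    have sub: "?D1 \<union> (*) p ` ?D1 \<subseteq> {d. d dvd n}"
      using s(1) by (auto intro: dvd_mult mult_dvd_mono)
    have zero: "?f d = 0" if d: "d \<in> {d. d dvd n} - (?D1 \<union> (*) p ` ?D1)" for d
    proof -
      have cop: "e dvd s" if "\<not> p dvd e" "e dvd n" for e
      proof -
        have "Rings.coprime e (p ^ Suc l)"
          using prime_imp_coprime[OF p that(1)] coprime_commute coprime_power_right_iff by blast
        then show ?thesis
          using that(2) s(1) coprime_dvd_mult_right_iff by blast
      qed
      have "p dvd d"
        using d cop by blast
      then obtain e where e: "d = p * e"
        by (rule dvdE)
      have "e dvd n"
        using d e by (auto intro: dvd_mult_right)
      then have "p dvd e"
        using cop[of e] d e by blast
      then have "p\<^sup>2 dvd d"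
        using e by (simp add: power2_eq_square)
      then have "\<not> squarefree d"
        using p not_prime_unit unfolding squarefree_def by blast
      then show ?thesis
        by (simp add: moebius_mu_def)
    qed
    have "S = (\<Sum>d\<in>?D1 \<union> (*) p ` ?D1. ?f d)"
      unfolding S_def using fin sub zero by (intro sum.mono_neutral_right) auto
    also have "\<dots> = (\<Sum>e\<in>?D1. ?f e) + (\<Sum>d\<in>(*) p ` ?D1. ?f d)"
    proof (rule sum.union_disjoint)
      show "?D1 \<inter> (*) p ` ?D1 = {}"
        using not_p(1) dvd_triv_left by blast
    qed (use fin in auto)
    also have "(\<Sum>d\<in>(*) p ` ?D1. ?f d) = (\<Sum>e\<in>?D1. ?f (p * e))"
      using p0 by (subst sum.reindex) (auto simp: inj_on_def)
    also have "(\<Sum>e\<in>?D1. ?f e) + (\<Sum>e\<in>?D1. ?f (p * e)) =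
        (\<Sum>e\<in>?D1. moebius_mu e * (A (p ^ Suc l * (s div e)) - A (p ^ l * (s div e))))"
      unfolding sum.distrib[symmetric]
    proof (rule sum.cong)
      fix e assume "e \<in> ?D1"
      then have e: "e dvd s"
        by simp
      then have "n div e = p ^ Suc l * (s div e)" "n div (p * e) = p ^ l * (s div e)"
        using p0 by (simp_all add: s(1) div_mult_swap[symmetric] mult.assoc)
      then show "?f e + ?f (p * e) = moebius_mu e * (A (p ^ Suc l * (s div e)) - A (p ^ l * (s div e)))"
        using moebius_mu_prime_mult[OF p not_p[OF e]] by (simp add: algebra_simps)
    qed simp
    also have "int p ^ Suc l dvd \<dots>"
    proof (intro dvd_sum dvd_mult A p)
      fix e assume "e \<in> ?D1"
      then show "s div e \<ge> 1"
        using s0 not_p by (auto simp: Suc_le_eq div_greater_zero_iff dvd_imp_le)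
    qed
    finally show ?thesis
      using Suc by simp
  qed
  \<comment> \<open>Comparing multiplicities prime by prime requires a nonzero number, so
    \<open>S = 0\<close> is set apart.\<close>
  have "int n dvd S"
  proof (cases "S = 0")
    case False
    have "n dvd nat \<bar>S\<bar>"
    proof (rule multiplicity_le_imp_dvd)
      fix p :: nat assume p: "prime p"
      have "int (p ^ multiplicity p n) dvd S"
        using pp[OF p] by simp
      then have "p ^ multiplicity p n dvd nat \<bar>S\<bar>"
        by (simp add: nat_abs_dvd_iff int_dvd_int_iff flip: int_dvd_int_iff)
      then show "multiplicity p n \<le> multiplicity p (nat \<bar>S\<bar>)"
        using False p not_prime_unit by (intro multiplicity_geI) auto
    qed (use n in auto)
    then show ?thesis
      by (metis dvd_abs_iff int_dvd_int_iff int_nat_eq abs_ge_zero)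
  qed simp
  then show "int n dvd (\<Sum>d | d dvd n. moebius_mu d * A (n div d))"
    by (simp add: S_def)
qed

text \<open>The discriminant is given as a complex number in terms of the roots; that it is an
  integer is part of the claim, hence the quantified \<open>\<Delta>\<close>.\<close>

theorem theorem9:
  fixes d :: nat and r :: "nat \<Rightarrow> int" and U :: "nat \<Rightarrow> int"
    and C :: "int poly" and \<alpha> :: "nat \<Rightarrow> complex" and K :: "complex set"
  assumes "d \<ge> 1"
    and "\<And>n. n \<ge> d \<Longrightarrow> U n = (\<Sum>i=1..d. r i * U (n - i))"
    and "C = monom 1 d - (\<Sum>i=1..d. monom (r i) (d - i))"
    and "map_poly of_int C = (\<Prod>i<d. [:- \<alpha> i, 1:])"
    and "(\<Prod>j<d. \<Prod>i<j. (\<alpha> i - \<alpha> j)\<^sup>2) \<noteq> 0"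
    and "K = complex_subfield hull (\<alpha> ` {..<d})"
  shows "\<exists>\<Delta>::int. of_int \<Delta> = (\<Prod>j<d. \<Prod>i<j. (\<alpha> i - \<alpha> j)\<^sup>2) \<and>
    (\<forall>t\<ge>1. rat_vs.dim K dvd t \<longrightarrow>
       dold_condition (\<lambda>n. r d * \<Delta> * rad (field_discriminant K) * U (n ^ t)))"
proof -
  let ?C = "map_poly of_int C :: complex poly"
  have C_eq: "?C = monom 1 d - (\<Sum>i=1..d. monom (of_int (r i)) (d - i))"
    unfolding assms(3) by (rule poly_eqI) (simp add: coeff_map_poly coeff_sum if_distrib cong: if_cong)
  have inj: "inj_on \<alpha> {..<d}"
  proof (rule ccontr)
    assume "\<not> inj_on \<alpha> {..<d}"
    then obtain i j where ij: "i < j" "j < d" "\<alpha> i = \<alpha> j"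
      unfolding inj_on_def by (metis lessThan_iff linorder_neqE_nat)
    then have "\<exists>i\<in>{..<j}. (\<alpha> i - \<alpha> j)\<^sup>2 = 0"
      by (intro bexI[of _ i]) auto
    then have "(\<Prod>i<j. (\<alpha> i - \<alpha> j)\<^sup>2) = 0"
      by (rule prod_zero[OF finite_lessThan])
    then have "\<exists>j\<in>{..<d}. (\<Prod>i<j. (\<alpha> i - \<alpha> j)\<^sup>2) = 0"
      using ij(2) by (intro bexI[of _ j]) (simp_all only: lessThan_iff)
    then have "(\<Prod>j<d. \<Prod>i<j. (\<alpha> i - \<alpha> j)\<^sup>2) = 0"
      by (rule prod_zero[OF finite_lessThan])
    then show False
      using assms(5) by simp
  qed
  interpret splitting_field ?C \<alpha> d K
  proof
    show "?C \<in> polys_over \<int>"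
      by (simp add: polys_over_def coeff_map_poly)
  qed (fact assms(4) inj assms(6))+
  obtain E where E: "(\<Prod>i<d. root_diff i) = of_int E"
    using prod_root_diff_Ints by (rule Ints_cases)
  \<comment> \<open>This makes \<open>\<epsilon> * E\<close> the integer discriminant; the factor
    \<open>E\<close> is the one that clears the denominators in Binet's formula.\<close>
  obtain \<epsilon> :: int where \<epsilon>: "(\<Prod>j<d. \<Prod>i<j. (\<alpha> i - \<alpha> j)\<^sup>2) = of_int \<epsilon> * (\<Prod>i<d. root_diff i)"
    using disc_eq_prod_differences[of \<alpha> d] unfolding root_diff_def by blast
  obtain \<gamma> where \<gamma>: "\<And>i. i < d \<Longrightarrow> \<gamma> i \<in> O_K"
    "\<And>n. of_int E * of_int (U n) = (\<Sum>i<d. \<gamma> i * \<alpha> i ^ n)"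
    using binet_formula[OF assms(2) C_eq] unfolding E by blast
  define R where "R = rad (field_discriminant K)"
  have "dold_condition (\<lambda>n. r d * (\<epsilon> * E) * R * U (n ^ t))" if t: "t \<ge> 1" "m dvd t" for t
  proof (rule dold_condition_from_prime_powers)
    fix p l s :: nat assume p: "prime p"
    have EU: "of_int (R * (E * U ((p ^ k * s) ^ t))) = (\<Sum>i<d. \<gamma> i * (of_int R * (\<alpha> i ^ (s ^ t)) ^ (p ^ (k * t))))" for k
    proof -
      \<comment> \<open>Splitting off the \<open>p\<close>-part of the exponent brings the roots
        into the shape of \<open>root_power_congruence\<close>, with \<open>s ^ t\<close> in the
        place of \<open>s\<close>.\<close>
      have N: "(p ^ k * s) ^ t = s ^ t * p ^ (k * t)"
        by (simp add: power_mult_distrib power_mult mult.commute)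
      have "of_int (R * (E * U ((p ^ k * s) ^ t))) = of_int R * (of_int E * (of_int (U ((p ^ k * s) ^ t)) :: complex))"
        by (simp only: of_int_mult)
      also have "\<dots> = (\<Sum>i<d. \<gamma> i * (of_int R * (\<alpha> i ^ (s ^ t)) ^ (p ^ (k * t))))"
        unfolding \<gamma>(2) N power_mult sum_distrib_left by (simp only: mult.left_commute)
      finally show ?thesis .
    qed
    have "O_K.cong_mod (of_nat p ^ Suc l) (of_int (R * (E * U ((p ^ Suc l * s) ^ t)))) (of_int (R * (E * U ((p ^ l * s) ^ t))))"
      unfolding EU
    proof (rule O_K.cong_mod_sum)
      fix i assume "i \<in> {..<d}"
      then have i: "i < d"
        by simp
      show "O_K.cong_mod (of_nat p ^ Suc l) (\<gamma> i * (of_int R * (\<alpha> i ^ (s ^ t)) ^ (p ^ (Suc l * t))))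
          (\<gamma> i * (of_int R * (\<alpha> i ^ (s ^ t)) ^ (p ^ (l * t))))"
        unfolding R_def
        by (rule O_K.cong_mod_mult[OF O_K.cong_mod_refl root_power_congruence[OF p i t(2,1)] \<gamma>(1)[OF i]])
          (intro O_K.mult_mem O_K.of_int_mem O_K.power_mem \<alpha>_O_K[OF i])
    qed
    then obtain c where c: "c \<in> O_K" "of_int (R * (E * U ((p ^ Suc l * s) ^ t))) =
        of_int (R * (E * U ((p ^ l * s) ^ t))) + of_nat p ^ Suc l * c"
      by (elim O_K.cong_modE)
    have "int p ^ Suc l dvd R * (E * U ((p ^ Suc l * s) ^ t)) - R * (E * U ((p ^ l * s) ^ t))"
      using c by (intro of_int_dvd_O_K[of _ _ c]) auto
    then have "int p ^ Suc l dvd r d * \<epsilon> * (R * (E * U ((p ^ Suc l * s) ^ t)) - R * (E * U ((p ^ l * s) ^ t)))"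
      by (rule dvd_mult)
    then show "int p ^ Suc l dvd r d * (\<epsilon> * E) * R * U ((p ^ Suc l * s) ^ t) - r d * (\<epsilon> * E) * R * U ((p ^ l * s) ^ t)"
      by (simp add: algebra_simps)
  qed
  then show ?thesis
    using \<epsilon> E dim_K unfolding R_def by (intro exI[of _ "\<epsilon> * E"]) simp
qed

end
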